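(* Consider the CP-decomposition model with the identity target $F_{i_1,\ldots,i_\nu}=\delta_{i_1=\cdots=i_\nu}$, in either the asymmetric scenario (any $\nu\ge2$) or the symmetric scenario with $\nu$ even. For $s\ge0$ let $Y_s(H,p,\sigma^2)=\sum_{q,n,l}c_{q,n,l;s}\,p^qH^n\sigma^{2l}$ be the polynomial with $Y_s=T^s\,\mathbb E\big[\tfrac{d^s}{dt^s}\big(L-\tfrac12\|F\|_F^2\big)(0)\big]$. Then, up to nonzero numerical coefficients, the Pareto-optimal terms of $Y_s$ are $$p^{Q(n,s_D)}H^n\sigma^{\nu(s_D+1)+(\nu-2)s},\qquad 0\le s_D\le s+1,\quad 1\le n\le s_D+1,$$ where $$Q(n,s_D)=\begin{cases}1+(\nu-1)s_D-\frac{\nu}{2}(n-1), & \text{SYM, even }\nu,\\ 1+(\nu-1)(s_D+1-n), & \text{ASYM}.\end{cases}$$ In the symmetric scenario with even $\nu$, all of these terms occur. In the asymmetric scenario the following terms do not occur: (a) those with $s_R:=s+1-s_D$ odd; (b) the term with $(n,s_D)=(s+2,s+1)$.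
   Context: Model: for $i_1,\ldots,i_\nu\in\{1,\ldots,p\}$, $f_{i_1,\ldots,i_\nu}=\sum_{k=1}^H\prod_{m=1}^\nu u^{(m)}_{k,i_m}$ with learnable $u^{(m)}_{k,i}$. ASYM: no constraint on the weights. SYM: $u^{(1)}_{k,i}=\cdots=u^{(\nu)}_{k,i}=:u_{k,i}$. Loss $L=\frac12\sum_{i_1,\ldots,i_\nu}(f_{i_1,\ldots,i_\nu}-F_{i_1,\ldots,i_\nu})^2$; here $\frac12\|F\|_F^2=\frac p2$. Gradient flow $\frac{d\mathbf u}{dt}=-\frac1T\partial_{\mathbf u}L$. All free weights are initialized i.i.d. $\mathcal N(0,\sigma^2)$, and the expectation is over this initialization; $Y_s$ is a polynomial in $p,H,\sigma^2$. A monomial $c\,p^qH^n\sigma^{2l}$ of $Y_s$ with $c\neq0$ is called Pareto-optimal if there is no other monomial $c'p^{q'}H^{n'}\sigma^{2l}$ of $Y_s$ with $c'\ne0$, the same power $l$, and $(q',n')\ne(q,n)$ with $q'\ge q$, $n'\ge n$. *)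

theory Defs
  imports "HOL-Probability.Probability"
begin

text \<open>Weights are indexed by triples (m, k, i) with m < nu (mode, 0-based),
  k < H (rank component), i < p (coordinate).  In the symmetric scenario the
  free weights are u_{k,i}, stored at (0, k, i), and every mode reads them.
  Multi-indices (i_1,...,i_nu) are functions idx on {..<nu} with values < p.\<close>

type_synonym wvar = "nat \<times> nat \<times> nat"
type_synonym weights = "wvar \<Rightarrow> real"

definition multi_indices :: "nat \<Rightarrow> nat \<Rightarrow> (nat \<Rightarrow> nat) set" where
  "multi_indices \<nu> p = PiE {..<\<nu>} (\<lambda>_. {..<p})"

definition target_F :: "nat \<Rightarrow> (nat \<Rightarrow> nat) \<Rightarrow> real" where
  "target_F \<nu> idx = (if \<forall>m<\<nu>. idx m = idx 0 then 1 else 0)"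

definition model_f :: "bool \<Rightarrow> nat \<Rightarrow> nat \<Rightarrow> weights \<Rightarrow> (nat \<Rightarrow> nat) \<Rightarrow> real" where
  "model_f is_sym \<nu> H u idx =
     (\<Sum>k<H. \<Prod>m<\<nu>. u (if is_sym then 0 else m, k, idx m))"

definition free_vars :: "bool \<Rightarrow> nat \<Rightarrow> nat \<Rightarrow> nat \<Rightarrow> wvar set" where
  "free_vars is_sym \<nu> H p = (if is_sym then {0} else {..<\<nu>}) \<times> {..<H} \<times> {..<p}"

definition loss :: "bool \<Rightarrow> nat \<Rightarrow> nat \<Rightarrow> nat \<Rightarrow> weights \<Rightarrow> real" where
  "loss is_sym \<nu> H p u =
     1/2 * (\<Sum>idx\<in>multi_indices \<nu> p. (model_f is_sym \<nu> H u idx - target_F \<nu> idx)\<^sup>2)"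

definition half_normF_sq :: "nat \<Rightarrow> nat \<Rightarrow> real" where
  "half_normF_sq \<nu> p = 1/2 * (\<Sum>idx\<in>multi_indices \<nu> p. (target_F \<nu> idx)\<^sup>2)"

definition pderiv_w :: "wvar \<Rightarrow> (weights \<Rightarrow> real) \<Rightarrow> weights \<Rightarrow> real" where
  "pderiv_w v g u = deriv (\<lambda>x. g (u(v := x))) (u v)"

text \<open>Generator of the gradient flow du/dt = -(1/T) dL/du:
  along a flow line, d/dt g(u(t)) = (flow_gen g)(u(t)).  Hence
  d^s/dt^s g(u(t)) at t = 0 equals ((flow_gen ^^ s) g)(u(0)).\<close>
definition flow_gen :: "bool \<Rightarrow> nat \<Rightarrow> nat \<Rightarrow> nat \<Rightarrow> real \<Rightarrow> (weights \<Rightarrow> real) \<Rightarrow> weights \<Rightarrow> real" where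
  "flow_gen is_sym \<nu> H p T g u =
     - (1 / T) * (\<Sum>v\<in>free_vars is_sym \<nu> H p. pderiv_w v (loss is_sym \<nu> H p) u * pderiv_w v g u)"

definition init_measure :: "bool \<Rightarrow> nat \<Rightarrow> nat \<Rightarrow> nat \<Rightarrow> real \<Rightarrow> weights measure" where
  "init_measure is_sym \<nu> H p \<sigma> =
     PiM (free_vars is_sym \<nu> H p) (\<lambda>_. density lborel (normal_density 0 \<sigma>))"

definition Y :: "bool \<Rightarrow> nat \<Rightarrow> nat \<Rightarrow> nat \<Rightarrow> nat \<Rightarrow> real \<Rightarrow> real \<Rightarrow> real" where
  "Y is_sym \<nu> s H p \<sigma> T =
     T ^ s * (\<integral>u. ((flow_gen is_sym \<nu> H p T ^^ s) (\<lambda>w. loss is_sym \<nu> H p w - half_normF_sq \<nu> p)) u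
                 \<partial>init_measure is_sym \<nu> H p \<sigma>)"

definition poly_rep :: "(nat \<Rightarrow> nat \<Rightarrow> real \<Rightarrow> real \<Rightarrow> real) \<Rightarrow> (nat \<times> nat \<times> nat \<Rightarrow> real) \<Rightarrow> bool" where
  "poly_rep Yf c \<longleftrightarrow> finite {x. c x \<noteq> 0} \<and>
     (\<forall>H p \<sigma> T. 1 \<le> H \<longrightarrow> 1 \<le> p \<longrightarrow> 0 < \<sigma> \<longrightarrow> 0 < T \<longrightarrow>
        Yf H p \<sigma> T = (\<Sum>(q, n, l)\<in>{x. c x \<noteq> 0}. c (q, n, l) * real p ^ q * real H ^ n * \<sigma> ^ (2 * l)))"

definition pareto_terms :: "(nat \<times> nat \<times> nat \<Rightarrow> real) \<Rightarrow> (nat \<times> nat \<times> nat) set" where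
  "pareto_terms c = {(q, n, l). c (q, n, l) \<noteq> 0 \<and>
     \<not> (\<exists>q' n'. c (q', n', l) \<noteq> 0 \<and> (q', n') \<noteq> (q, n) \<and> q \<le> q' \<and> n \<le> n')}"

text \<open>Exponent of p; the nat subtractions never truncate under n \<le> sD + 1.\<close>
definition Q_sym :: "nat \<Rightarrow> nat \<Rightarrow> nat \<Rightarrow> nat" where
  "Q_sym \<nu> n sD = 1 + (\<nu> - 1) * sD - (\<nu> div 2) * (n - 1)"

definition Q_asym :: "nat \<Rightarrow> nat \<Rightarrow> nat \<Rightarrow> nat" where
  "Q_asym \<nu> n sD = 1 + (\<nu> - 1) * (sD + 1 - n)"

definition sym_terms :: "nat \<Rightarrow> nat \<Rightarrow> (nat \<times> nat \<times> nat) set" where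
  "sym_terms \<nu> s = {(Q_sym \<nu> n sD, n, l) | n sD l.
     sD \<le> s + 1 \<and> 1 \<le> n \<and> n \<le> sD + 1 \<and> 2 * l = \<nu> * (sD + 1) + (\<nu> - 2) * s}"

definition asym_terms :: "nat \<Rightarrow> nat \<Rightarrow> (nat \<times> nat \<times> nat) set" where
  "asym_terms \<nu> s = {(Q_asym \<nu> n sD, n, l) | n sD l.
     sD \<le> s + 1 \<and> 1 \<le> n \<and> n \<le> sD + 1 \<and> 2 * l = \<nu> * (sD + 1) + (\<nu> - 2) * s
     \<and> even (s + 1 - sD) \<and> (n, sD) \<noteq> (s + 2, s + 1)}"

end

theory Submission
  imports Defs
begin

text \<open>Up to a constant, the loss is \<open>1/2 f\<^sup>2 - f F\<close>, summed over multi-indices.  Differentiating along the flow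
  contracts one edge of a new factor with one edge of the diagram built so far, and the Gaussian expectation
  sums over all pairings of the remaining edges.  A diagram with \<open>s\<^sub>D\<close> factors \<open>f\<^sup>2\<close> therefore contributes a
  multiple of \<open>p\<^sup>q H\<^sup>n\<close>, where \<open>n\<close> and \<open>q\<close> count the classes of identified rank and coordinate indices.  The
  power of \<open>\<sigma>\<close> determines \<open>s\<^sub>D\<close> and thereby the sign of the contribution, so no cancellation occurs and the
  problem is to find the extremal pairs \<open>(q, n)\<close>.

  The bound on \<open>q\<close> is proved by removing the last factor.  Every pairing satisfies a parity condition between
  rank classes and coordinate classes; if the removed factor \<open>f\<^sup>2\<close> connects two distinct rank classes, parity
  forces many of its coordinate indices to coincide with old ones.  In the asymmetric model every rank index
  carries exactly one edge of each colour, so all rank classes have even size, which makes \<open>s\<^sub>R\<close> even and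
  excludes \<open>n = s + 2\<close>.  Equality is attained by inserting factors one at a time; in the asymmetric model one
  starts from a path of \<open>f\<^sup>2\<close> factors closed by two factors \<open>f F\<close>, or from a ring of \<open>f\<^sup>2\<close> factors.\<close>

text \<open>A compatibly labelled open diagram can be completed to a pairing that respects the
  labels exactly when every edge label (colour, rank label, coordinate label) occurs an even number
  of times among the open edges. Both bounds thus become statements about labellings: the upper
  bound is applied to the finest labelling of a pairing, while the lower bound needs only some
  labelling with even counts, since the classes of the resulting pairing can only be finer. The
  obstacle in the induction is that removing a factor destroys evenness. When the removed f^2 joins
  two old rank classes, merging them restores the parity condition at the price of one class; hence
  the bound is proved for all labellings that satisfy the condition, not just for those that come
  from pairings. Each rank class beyond the first costs \<open>wgt\<close> coordinate classes,
  \<nu>/2 in the symmetric and \<nu>-1 in the asymmetric model, and both formulas for Q read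
  \<open>1 + (\<nu> - 1) * s\<^sub>D - wgt * (n - 1)\<close>. As Q decreases strictly in n, a
  diagram that merely dominates a point of the front lies on it.\<close>

section \<open>Monomials as lists of variables\<close>

fun picks :: "'a list \<Rightarrow> ('a \<times> 'a list) list" where
  "picks [] = []"
| "picks (x # xs) = (x, xs) # map (\<lambda>(y, ys). (y, x # ys)) (picks xs)"

lemma picks_mset: "(y, ys) \<in> set (picks xs) \<Longrightarrow> mset xs = add_mset y (mset ys)"
  by (induction xs arbitrary: y ys) auto

lemma picks_ex: "y \<in> set xs \<Longrightarrow> \<exists>ys. (y, ys) \<in> set (picks xs)"
proof (induction xs)
  case (Cons x xs)
  show ?case
  proof (cases "y = x")
    case False
    with Cons obtain ys where "(y, ys) \<in> set (picks xs)" by auto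
    then show ?thesis by force
  qed auto
qed simp

lemma picks_length [termination_simp]: "(y, ys) \<in> set (picks xs) \<Longrightarrow> length ys < length xs"
  by (drule picks_mset) (metis lessI size_add_mset size_mset)

lemma picks_map: "picks (map f xs) = map (map_prod f (map f)) (picks xs)"
  by (induction xs) auto

definition wmono :: "'a list \<Rightarrow> ('a \<Rightarrow> real) \<Rightarrow> real" where
  "wmono xs u = (\<Prod>x\<leftarrow>xs. u x)"

lemma wmono_Nil [simp]: "wmono [] u = 1"
  and wmono_Cons [simp]: "wmono (x # xs) u = u x * wmono xs u"
  and wmono_append: "wmono (xs @ ys) u = wmono xs u * wmono ys u"
  by (simp_all add: wmono_def)

lemma sum_list_sum_swap: "(\<Sum>x\<leftarrow>xs. \<Sum>i\<in>A. f x i) = (\<Sum>i\<in>A. \<Sum>x\<leftarrow>xs. f x i)"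
  for f :: "'a \<Rightarrow> 'b \<Rightarrow> 'c::comm_monoid_add"
  by (induction xs) (auto simp: sum.distrib)

lemma sum_list_concat_map: "sum_list (concat xss) = (\<Sum>xs\<leftarrow>xss. sum_list xs)"
  for xss :: "'c::comm_monoid_add list list"
  by (induction xss) auto

section \<open>Derivatives of monomials\<close>

text \<open>The Leibniz rule over positions: a variable that occurs k times is picked k times, so
  the power rule needs no separate treatment.\<close>

definition wmono_deriv :: "'a \<Rightarrow> 'a list \<Rightarrow> ('a \<Rightarrow> real) \<Rightarrow> real" where
  "wmono_deriv v xs u = (\<Sum>(y, ys)\<leftarrow>picks xs. if y = v then wmono ys u else 0)"

lemma wmono_has_deriv:
  "((\<lambda>x. wmono xs (u(v := x))) has_field_derivative wmono_deriv v xs u) (at (u v))"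
proof (induction xs)
  case Nil
  then show ?case by (simp add: wmono_deriv_def)
next
  case (Cons y ys)
  have 1: "((\<lambda>x. (u(v := x)) y) has_field_derivative (if y = v then 1 else 0)) (at (u v))"
    by (cases "y = v") (auto intro!: derivative_eq_intros)
  have 2: "wmono_deriv v (y # ys) u = (if y = v then wmono ys u else 0) + u y * wmono_deriv v ys u"
    by (simp add: wmono_deriv_def o_def case_prod_beta sum_list_const_mult[symmetric]
        if_distrib[of "(*) (u y)"] cong: if_cong)
  show ?case
    unfolding wmono_Cons by (rule DERIV_cong[OF DERIV_mult[OF 1 Cons.IH]]) (auto simp: 2)
qed

text \<open>Differentiating both monomials by the same variable strikes out one equal letter from
  each, and the sum over variables leaves a sum over pairs of positions. This turns the gradient
  product into contractions of edges.\<close>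

lemma wmono_deriv_pair:
  assumes "finite V" "set xs \<subseteq> V"
  shows "(\<Sum>v\<in>V. wmono_deriv v xs u * wmono_deriv v ys u) =
    (\<Sum>(x, xs')\<leftarrow>picks xs. \<Sum>(y, ys')\<leftarrow>picks ys. if x = y then wmono (xs' @ ys') u else 0)"
proof -
  have mem: "x \<in> V" if "(x, xs') \<in> set (picks xs)" for x xs'
    using picks_mset[OF that] assms(2) by (metis mset_eq_setD list.set_intros(1) mset.simps(2) subsetD)
  have *: "(\<Sum>v\<in>V. (if x = v then a else 0) * wmono_deriv v ys u) = a * wmono_deriv x ys u"
    if "x \<in> V" for x a
    using that assms(1) by (subst sum.cong[OF refl, of _ _ "\<lambda>v. if x = v then a * wmono_deriv v ys u else 0"]) auto
  have "(\<Sum>v\<in>V. wmono_deriv v xs u * wmono_deriv v ys u) =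
    (\<Sum>(x, xs')\<leftarrow>picks xs. \<Sum>v\<in>V. (if x = v then wmono xs' u else 0) * wmono_deriv v ys u)"
    unfolding wmono_deriv_def[of _ xs] case_prod_beta
    by (simp add: sum_list_sum_swap sum_list_mult_const)
  also have "\<dots> = (\<Sum>(x, xs')\<leftarrow>picks xs. wmono xs' u * wmono_deriv x ys u)"
    by (intro arg_cong[where f = sum_list] map_cong refl) (auto simp: * dest: mem)
  also have "\<dots> = (\<Sum>(x, xs')\<leftarrow>picks xs. \<Sum>(y, ys')\<leftarrow>picks ys. if x = y then wmono (xs' @ ys') u else 0)"
    unfolding wmono_deriv_def case_prod_beta
    by (intro arg_cong[where f = sum_list] map_cong refl)
       (auto simp: sum_list_const_mult[symmetric] wmono_append intro!: arg_cong[where f = sum_list])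
  finally show ?thesis .
qed

section \<open>Gaussian moments\<close>

definition gauss :: "real \<Rightarrow> real measure" where
  "gauss \<sigma> = density lborel (normal_density 0 \<sigma>)"

definition gmoment :: "real \<Rightarrow> nat \<Rightarrow> real" where
  "gmoment \<sigma> k = (\<integral>x. x ^ k \<partial>gauss \<sigma>)"

lemma gauss_integrable: "0 < \<sigma> \<Longrightarrow> integrable (gauss \<sigma>) (\<lambda>x. x ^ k)"
  unfolding gauss_def
  by (subst integrable_real_density) (use integrable_normal_moment[of \<sigma> 0 k] in auto)

lemma gmoment_lborel: "gmoment \<sigma> k = (\<integral>x. normal_density 0 \<sigma> x * (x - 0) ^ k \<partial>lborel)"
  unfolding gmoment_def gauss_def by (subst integral_real_density) auto

lemma gmoment_odd: "0 < \<sigma> \<Longrightarrow> gmoment \<sigma> (Suc (2 * k)) = 0"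
  using integral_normal_moment_odd[of \<sigma> 0 k] unfolding gmoment_lborel by simp

lemma gmoment_even: "0 < \<sigma> \<Longrightarrow> gmoment \<sigma> (2 * k) = fact (2 * k) / ((2 / \<sigma>\<^sup>2) ^ k * fact k)"
  using integral_normal_moment_even[of \<sigma> 0 k] unfolding gmoment_lborel by simp

text \<open>Stein's identity for the centred Gaussian, read off from the closed form of the moments.
  For \<open>n = 0\<close> the truncated \<open>n - 1\<close> is harmless because of the factor
  \<open>n\<close>.\<close>

lemma gmoment_rec:
  assumes "0 < \<sigma>" shows "gmoment \<sigma> (Suc n) = \<sigma>\<^sup>2 * real n * gmoment \<sigma> (n - 1)"
proof (cases "even n")
  case True
  then obtain k where k: "n = 2 * k" by (elim evenE)
  show ?thesis
  proof (cases k)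
    case 0
    then show ?thesis using gmoment_odd[OF assms, of 0] k by simp
  next
    case (Suc j)
    then have "n - 1 = Suc (2 * j)" using k by simp
    then show ?thesis using gmoment_odd[OF assms] k by simp
  qed
next
  case False
  then obtain k where k: "n = Suc (2 * k)" by (auto elim: oddE)
  then have e: "Suc n = 2 * Suc k" "n - 1 = 2 * k" by simp_all
  have f: "fact (2 * Suc k) = (real (2 * k + 2)) * (real (2 * k + 1)) * fact (2 * k)"
    by (simp add: algebra_simps)
  \<comment> \<open>The quotient of consecutive even moments, with \<open>F\<close>,
    \<open>b\<close>, \<open>c\<close> standing for \<open>fact (2 * k)\<close>,
    \<open>(2 / \<sigma>\<^sup>2) ^ k\<close> and \<open>fact k\<close>.\<close>
  have g: "F * (2 * j + 2) * (2 * j + 1) / (2 / a * b * ((j + 1) * c)) = a * (2 * j + 1) * (F / (b * c))"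
    if "a > 0" "b > 0" "c > 0" "j \<ge> 0" for F a b c j :: real
    using that by (simp add: divide_simps)
  show ?thesis
    unfolding e(1,2) gmoment_even[OF assms] f
    using g[of "\<sigma>\<^sup>2" "(2 / \<sigma>\<^sup>2) ^ k" "fact k" "real k" "fact (2 * k)"] assms k
    by (simp add: algebra_simps)
qed

lemma init_measure_gauss: "init_measure is_sym \<nu> H p \<sigma> = PiM (free_vars is_sym \<nu> H p) (\<lambda>_. gauss \<sigma>)"
  by (simp add: init_measure_def gauss_def)

text \<open>Equal letters are collected into powers, the form to which Fubini on the product measure
  applies.\<close>

lemma wmono_count: "finite V \<Longrightarrow> set xs \<subseteq> V \<Longrightarrow> wmono xs u = (\<Prod>v\<in>V. u v ^ count (mset xs) v)"
proof (induction xs)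
  case (Cons x xs)
  have "(\<Prod>v\<in>V. u v ^ count (mset (x # xs)) v) = (\<Prod>v\<in>V. (if v = x then u v else 1) * u v ^ count (mset xs) v)"
    by (intro prod.cong) auto
  also have "\<dots> = u x * (\<Prod>v\<in>V. u v ^ count (mset xs) v)"
    using Cons.prems by (simp add: prod.distrib)
  finally show ?case using Cons by simp
qed simp

context
  fixes \<sigma> :: real and V :: "'a set"
  assumes sig: "0 < \<sigma>" and fin: "finite V"
begin

interpretation product_sigma_finite "\<lambda>_::'a. gauss \<sigma>"
  unfolding gauss_def product_sigma_finite_def
  using prob_space_normal_density[OF sig] prob_space_imp_sigma_finite by blast

lemma wmono_integrable: "set xs \<subseteq> V \<Longrightarrow> integrable (PiM V (\<lambda>_. gauss \<sigma>)) (wmono xs)"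
  using product_integrable_prod[OF fin, of "\<lambda>v x. x ^ count (mset xs) v"] gauss_integrable[OF sig]
  by (subst Bochner_Integration.integrable_cong[OF refl wmono_count[OF fin]]) auto

lemma wmono_integral:
  "set xs \<subseteq> V \<Longrightarrow> (\<integral>u. wmono xs u \<partial>PiM V (\<lambda>_. gauss \<sigma>)) = (\<Prod>v\<in>V. gmoment \<sigma> (count (mset xs) v))"
  using product_integral_prod[OF fin, of "\<lambda>v x. x ^ count (mset xs) v"] gauss_integrable[OF sig]
  by (simp add: wmono_count[OF fin] gmoment_def)

text \<open>One step of Wick's (Isserlis') formula. All partners of \<open>x\<close> leave the same
  monomial behind, so their sum is a multiplicity times one integral, which is what Stein's identity
  gives in the variable \<open>x\<close>.\<close>

lemma wmono_wick:
  assumes "set (x # xs) \<subseteq> V"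
  shows "(\<integral>u. wmono (x # xs) u \<partial>PiM V (\<lambda>_. gauss \<sigma>)) =
    \<sigma>\<^sup>2 * (\<Sum>(y, ys)\<leftarrow>picks xs. if x = y then (\<integral>u. wmono ys u \<partial>PiM V (\<lambda>_. gauss \<sigma>)) else 0)"
proof -
  let ?g = "\<lambda>M. \<Prod>v\<in>V. gmoment \<sigma> (count M v)"
  let ?n = "count (mset xs) x"
  have xV: "x \<in> V" using assms by simp
  have summand: "(if x = y then (\<integral>u. wmono ys u \<partial>PiM V (\<lambda>_. gauss \<sigma>)) else 0)
      = (if x = y then ?g (mset xs - {#x#}) else 0)" if "(y, ys) \<in> set (picks xs)" for y ys
  proof -
    have m: "mset xs = add_mset y (mset ys)" by (rule picks_mset[OF that])
    then have "set ys \<subseteq> V" using assms by (metis list.set_intros(2) mset.simps(2) mset_eq_setD subset_code(1))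
    then show ?thesis using m by (simp add: wmono_integral)
  qed
  have cnt: "(\<Sum>(y, ys)\<leftarrow>picks zs. if x = y then c else 0) = real (count (mset zs) x) * c" for zs and c :: real
    by (induction zs) (auto simp: o_def case_prod_beta algebra_simps)
  have "(\<Sum>(y, ys)\<leftarrow>picks xs. if x = y then (\<integral>u. wmono ys u \<partial>PiM V (\<lambda>_. gauss \<sigma>)) else 0)
     = (\<Sum>(y, ys)\<leftarrow>picks xs. if x = y then ?g (mset xs - {#x#}) else 0)"
    by (intro arg_cong[where f = sum_list] map_cong refl) (use summand in auto)
  also have "\<dots> = real ?n * ?g (mset xs - {#x#})" by (rule cnt)
  finally have rhs: "(\<Sum>(y, ys)\<leftarrow>picks xs. if x = y then (\<integral>u. wmono ys u \<partial>PiM V (\<lambda>_. gauss \<sigma>)) else 0)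
     = real ?n * ?g (mset xs - {#x#})" .
  have rest: "(\<Prod>v\<in>V-{x}. gmoment \<sigma> (count M v)) = (\<Prod>v\<in>V-{x}. gmoment \<sigma> (count (mset xs) v))"
    if "M = mset xs - {#x#} \<or> M = mset (x # xs)" for M
    by (intro prod.cong) (use that in auto)
  have r: "?g (mset xs - {#x#}) = gmoment \<sigma> (?n - 1) * (\<Prod>v\<in>V-{x}. gmoment \<sigma> (count (mset xs) v))"
    by (subst prod.remove[OF fin xV], subst rest[of "mset xs - {#x#}"]) auto
  have l: "?g (mset (x # xs)) = gmoment \<sigma> (Suc ?n) * (\<Prod>v\<in>V-{x}. gmoment \<sigma> (count (mset xs) v))"
    by (subst prod.remove[OF fin xV], subst rest[of "mset (x # xs)"]) auto
  show ?thesis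
    unfolding wmono_integral[OF assms] rhs r l gmoment_rec[OF sig] by simp
qed

end

section \<open>Diagrams\<close>

text \<open>A vertex is a pair of a factor index and a slot in that factor.  \<open>Edge c a b\<close> stands for a weight of
  colour (mode) \<open>c\<close>; the K-vertex \<open>a\<close> is summed over the rank components and the I-vertex \<open>b\<close> over the
  coordinates.  In the symmetric model all edges have colour 0.\<close>

type_synonym vert = "nat \<times> nat"
datatype edge = Edge (ecol: nat) (eK: vert) (eI: vert)
type_synonym diagram = "bool list \<times> (edge \<times> edge) list \<times> edge list"

definition inst :: "(vert \<Rightarrow> nat) \<Rightarrow> (vert \<Rightarrow> nat) \<Rightarrow> edge \<Rightarrow> wvar" where
  "inst \<kappa> \<iota> e = (ecol e, \<kappa> (eK e), \<iota> (eI e))"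

definition vK :: "nat \<Rightarrow> bool \<Rightarrow> vert set" where
  "vK j k = {j} \<times> {..<(if k then 2 else 1)}"

definition KV :: "bool list \<Rightarrow> vert set" where
  "KV ks = (\<Union>j<length ks. vK j (ks ! j))"

lemma finite_vK [simp]: "finite (vK j k)" by (simp add: vK_def)
lemma finite_KV [simp]: "finite (KV ks)" by (simp add: KV_def)

lemma KV_snoc: "KV (ks @ [k]) = vK (length ks) k \<union> KV ks"
  by (auto simp: KV_def nth_append lessThan_Suc)

lemma KV_fst: "x \<in> KV ks \<Longrightarrow> fst x < length ks"
  by (auto simp: KV_def vK_def)

lemma vK_disj: "vK (length ks) k \<inter> KV ks = {}"
  by (auto simp: KV_def vK_def)

definition coef :: "bool list \<Rightarrow> real" where
  "coef ks = (\<Prod>k\<leftarrow>ks. if k then 1 / 2 else - 1)"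

locale cp_model =
  fixes sy :: bool and \<nu> :: nat
  assumes nu_ge2: "2 \<le> \<nu>" and sy_even: "sy \<Longrightarrow> even \<nu>"
begin

definition col :: "nat \<Rightarrow> nat" where
  "col m = (if sy then 0 else m)"

definition vI :: "nat \<Rightarrow> bool \<Rightarrow> vert set" where
  "vI j k = {j} \<times> {..<(if k then \<nu> else 1)}"

text \<open>In f^2 both copies of f read the same multi-index, so the two rank slots share the \<nu>
  coordinate slots. In fF the target forces all coordinates to agree, which leaves one coordinate
  slot for all \<nu> edges.\<close>

definition fE :: "nat \<Rightarrow> bool \<Rightarrow> edge list" where
  "fE j k = (if k then map (\<lambda>m. Edge (col m) (j, 0) (j, m)) [0..<\<nu>] @ map (\<lambda>m. Edge (col m) (j, 1) (j, m)) [0..<\<nu>]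
     else map (\<lambda>m. Edge (col m) (j, 0) (j, 0)) [0..<\<nu>])"

definition IV :: "bool list \<Rightarrow> vert set" where
  "IV ks = (\<Union>j<length ks. vI j (ks ! j))"

lemma finite_vI [simp]: "finite (vI j k)" by (simp add: vI_def)
lemma finite_IV [simp]: "finite (IV ks)" by (simp add: IV_def)

lemma IV_snoc: "IV (ks @ [k]) = vI (length ks) k \<union> IV ks"
  by (auto simp: IV_def nth_append lessThan_Suc)

lemma IV_fst: "x \<in> IV ks \<Longrightarrow> fst x < length ks"
  by (auto simp: IV_def vI_def)

lemma vI_disj: "vI (length ks) k \<inter> IV ks = {}"
  by (auto simp: IV_def vI_def)

definition wf_edge :: "bool list \<Rightarrow> edge \<Rightarrow> bool" where
  "wf_edge ks e \<longleftrightarrow> ecol e \<in> col ` {..<\<nu>} \<and> eK e \<in> KV ks \<and> eI e \<in> IV ks"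

definition wf_diag :: "diagram \<Rightarrow> bool" where
  "wf_diag = (\<lambda>(ks, C, es). (\<forall>e\<in>set es. wf_edge ks e) \<and> (\<forall>(e, e')\<in>set C. wf_edge ks e \<and> wf_edge ks e' \<and> ecol e = ecol e'))"

lemma fE_mem: "e \<in> set (fE j k) \<Longrightarrow> ecol e \<in> col ` {..<\<nu>} \<and> eK e \<in> vK j k \<and> eI e \<in> vI j k"
  using nu_ge2 by (auto simp: fE_def vK_def vI_def split: if_splits)

lemma fE_wf: "e \<in> set (fE (length ks) k) \<Longrightarrow> wf_edge (ks @ [k]) e"
  by (drule fE_mem) (auto simp: wf_edge_def KV_snoc IV_snoc)

lemma wf_edge_snoc: "wf_edge ks e \<Longrightarrow> wf_edge (ks @ [k]) e"
  by (auto simp: wf_edge_def KV_snoc IV_snoc)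

text \<open>In a diagram \<open>(ks, C, es)\<close> the list \<open>ks\<close> records the factors of the loss (\<open>True\<close> for \<open>f\<^sup>2\<close>, \<open>False\<close> for
  \<open>f F\<close>), \<open>C\<close> the edge pairs contracted so far and \<open>es\<close> the open edges.  \<open>ext\<close> is one step of the flow
  (a new factor is contracted with the diagram along one edge), \<open>wick\<close> lists the complete pairings of Wick's formula.\<close>

definition ext :: "diagram \<Rightarrow> diagram list" where
  "ext = (\<lambda>(ks, C, es). concat (map (\<lambda>k. concat (map (\<lambda>(e, r). concat (map (\<lambda>(e', r').
      if ecol e = ecol e' then [(ks @ [k], (e, e') # C, r @ r')] else [])
     (picks es))) (picks (fE (length ks) k)))) [True, False]))"

fun gens :: "nat \<Rightarrow> diagram list" where
  "gens 0 = map (\<lambda>k. ([k], [], fE 0 k)) [True, False]"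
| "gens (Suc s) = concat (map ext (gens s))"

function (sequential) wick :: "edge list \<Rightarrow> (edge \<times> edge) list \<Rightarrow> (edge \<times> edge) list list" where
  "wick [] C = [C]"
| "wick (e # es) C = concat (map (\<lambda>(e', r). if ecol e = ecol e' then wick r ((e, e') # C) else []) (picks es))"
  by pat_completeness auto
termination by (relation "Wellfounded.measure (\<lambda>(es, _). length es)") (auto dest: picks_length)

lemma ext_mem:
  "(ks', C', es') \<in> set (ext (ks, C, es)) \<longleftrightarrow>
    (\<exists>k e r e' r'. (e, r) \<in> set (picks (fE (length ks) k)) \<and> (e', r') \<in> set (picks es) \<and> ecol e = ecol e' \<and>
       ks' = ks @ [k] \<and> C' = (e, e') # C \<and> es' = r @ r')"
proof -
  have cm: "x \<in> set (concat (map f xs)) \<longleftrightarrow> (\<exists>y\<in>set xs. x \<in> set (f y))" for x and f :: "'a \<Rightarrow> 'b list" and xs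
    by auto
  have bl: "k \<in> set [True, False]" for k by (cases k) auto
  have "(ks', C', es') \<in> set (ext (ks, C, es)) \<longleftrightarrow>
    (\<exists>k. \<exists>x\<in>set (picks (fE (length ks) k)). \<exists>y\<in>set (picks es). ecol (fst x) = ecol (fst y) \<and>
       ks' = ks @ [k] \<and> C' = (fst x, fst y) # C \<and> es' = snd x @ snd y)"
  proof -
    have iff: "z \<in> set (if P then [w] else []) \<longleftrightarrow> P \<and> z = w" for P and z w :: 'c
      by auto
    show ?thesis
      unfolding ext_def case_prod_beta fst_conv snd_conv cm iff prod.inject using bl by blast
  qed
  then show ?thesis by (simp add: Bex_def)
qed

lemma picks_set: "(y, ys) \<in> set (picks xs) \<Longrightarrow> set xs = insert y (set ys)"
  by (drule picks_mset) (metis set_mset_add_mset_insert set_mset_mset)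

lemma ext_wf:
  assumes "wf_diag d" "d' \<in> set (ext d)"
  shows "wf_diag d'"
proof -
  obtain ks C es where d: "d = (ks, C, es)" by (rule prod_cases3)
  obtain ks' C' es' where d': "d' = (ks', C', es')" by (rule prod_cases3)
  obtain k e r e' r' where p: "(e, r) \<in> set (picks (fE (length ks) k))" "(e', r') \<in> set (picks es)"
    and c: "ecol e = ecol e'" and eq: "ks' = ks @ [k]" "C' = (e, e') # C" "es' = r @ r'"
    using assms(2) unfolding d d' ext_mem by blast
  have "wf_edge (ks @ [k]) x" if "x \<in> insert e (set r) \<union> insert e' (set r')" for x
    using that picks_set[OF p(1)] picks_set[OF p(2)] assms(1) fE_wf wf_edge_snoc
    unfolding d wf_diag_def by (auto simp del: split_paired_All)
  moreover have "wf_edge (ks @ [k]) x \<and> wf_edge (ks @ [k]) y \<and> ecol x = ecol y" if "(x, y) \<in> set C" for x y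
    using that assms(1) wf_edge_snoc unfolding d wf_diag_def by blast
  ultimately show ?thesis
    using c unfolding d' eq wf_diag_def by (simp add: ball_Un) blast
qed

lemma gens_wf: "d \<in> set (gens s) \<Longrightarrow> wf_diag d"
proof (induction s arbitrary: d)
  case 0
  then show ?case using fE_wf[of _ "[]"] by (auto simp: wf_diag_def)
qed (auto intro: ext_wf)

lemma gens_length: "(ks, C, es) \<in> set (gens s) \<Longrightarrow> length ks = Suc s"
proof (induction s arbitrary: ks C es)
  case (Suc s)
  then obtain ks0 C0 es0 where "(ks0, C0, es0) \<in> set (gens s)" "(ks, C, es) \<in> set (ext (ks0, C0, es0))"
    by auto
  then show ?case using Suc.IH by (auto simp: ext_mem)
qed auto

section \<open>Diagrams as functions of the weights\<close>

definition Asg :: "nat \<Rightarrow> nat \<Rightarrow> bool list \<Rightarrow> (edge \<times> edge) list \<Rightarrow> ((vert \<Rightarrow> nat) \<times> (vert \<Rightarrow> nat)) set" where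
  "Asg H p ks C = {(\<kappa>, \<iota>) \<in> (KV ks \<rightarrow>\<^sub>E {..<H}) \<times> (IV ks \<rightarrow>\<^sub>E {..<p}).
     \<forall>(e, e')\<in>set C. inst \<kappa> \<iota> e = inst \<kappa> \<iota> e'}"

definition fAsg :: "nat \<Rightarrow> nat \<Rightarrow> nat \<Rightarrow> bool \<Rightarrow> ((vert \<Rightarrow> nat) \<times> (vert \<Rightarrow> nat)) set" where
  "fAsg H p j k = (vK j k \<rightarrow>\<^sub>E {..<H}) \<times> (vI j k \<rightarrow>\<^sub>E {..<p})"

definition Val :: "nat \<Rightarrow> nat \<Rightarrow> diagram \<Rightarrow> weights \<Rightarrow> real" where
  "Val H p = (\<lambda>(ks, C, es) u. \<Sum>(\<kappa>, \<iota>)\<in>Asg H p ks C. wmono (map (inst \<kappa> \<iota>) es) u)"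

definition fVal :: "nat \<Rightarrow> nat \<Rightarrow> nat \<Rightarrow> bool \<Rightarrow> weights \<Rightarrow> real" where
  "fVal H p j k u = (\<Sum>(\<kappa>, \<iota>)\<in>fAsg H p j k. wmono (map (inst \<kappa> \<iota>) (fE j k)) u)"

lemma finite_Asg [simp]: "finite (Asg H p ks C)"
  by (rule finite_subset[of _ "(KV ks \<rightarrow>\<^sub>E {..<H}) \<times> (IV ks \<rightarrow>\<^sub>E {..<p})"])
     (auto simp: Asg_def intro!: finite_PiE)

lemma finite_fAsg [simp]: "finite (fAsg H p j k)"
  by (auto simp: fAsg_def intro!: finite_PiE)

definition DVal :: "nat \<Rightarrow> nat \<Rightarrow> wvar \<Rightarrow> diagram \<Rightarrow> weights \<Rightarrow> real" where
  "DVal H p v = (\<lambda>(ks, C, es) u. \<Sum>(\<kappa>, \<iota>)\<in>Asg H p ks C. wmono_deriv v (map (inst \<kappa> \<iota>) es) u)"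

definition DfVal :: "nat \<Rightarrow> nat \<Rightarrow> wvar \<Rightarrow> nat \<Rightarrow> bool \<Rightarrow> weights \<Rightarrow> real" where
  "DfVal H p v j k u = (\<Sum>(\<kappa>, \<iota>)\<in>fAsg H p j k. wmono_deriv v (map (inst \<kappa> \<iota>) (fE j k)) u)"

lemma Val_deriv: "((\<lambda>x. Val H p d (u(v := x))) has_field_derivative DVal H p v d u) (at (u v))"
  unfolding Val_def DVal_def by (auto split: prod.splits intro!: DERIV_sum wmono_has_deriv)

lemma fVal_deriv: "((\<lambda>x. fVal H p j k (u(v := x))) has_field_derivative DfVal H p v j k u) (at (u v))"
  unfolding fVal_def DfVal_def by (auto split: prod.splits intro!: DERIV_sum wmono_has_deriv)

lemma inst_free:
  assumes "\<kappa> \<in> A \<rightarrow>\<^sub>E {..<H}" "\<iota> \<in> B \<rightarrow>\<^sub>E {..<p}" "ecol e \<in> col ` {..<\<nu>}" "eK e \<in> A" "eI e \<in> B"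
  shows "inst \<kappa> \<iota> e \<in> free_vars sy \<nu> H p"
  using assms by (auto simp: inst_def free_vars_def col_def PiE_iff)

lemma finite_free [simp]: "finite (free_vars sy \<nu> H p)"
  by (simp add: free_vars_def)

definition jn :: "vert set \<Rightarrow> vert set \<Rightarrow> (vert \<Rightarrow> nat) \<Rightarrow> (vert \<Rightarrow> nat) \<Rightarrow> vert \<Rightarrow> nat" where
  "jn A B f g x = (if x \<in> A then f x else if x \<in> B then g x else undefined)"

lemma jn_PiE: "f \<in> A \<rightarrow>\<^sub>E S \<Longrightarrow> g \<in> B \<rightarrow>\<^sub>E S \<Longrightarrow> jn A B f g \<in> (A \<union> B) \<rightarrow>\<^sub>E S"
  by (auto simp: jn_def PiE_iff extensional_def)

lemma jn_restrict:
  "f \<in> (A \<union> B) \<rightarrow>\<^sub>E S \<Longrightarrow> jn A B (restrict f A) (restrict f B) = f"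
  by (auto simp: jn_def PiE_iff extensional_def fun_eq_iff)

lemma restrict_jn1: "f \<in> A \<rightarrow>\<^sub>E S \<Longrightarrow> restrict (jn A B f g) A = f"
  by (auto simp: jn_def PiE_iff extensional_def fun_eq_iff)

lemma restrict_jn2: "A \<inter> B = {} \<Longrightarrow> g \<in> B \<rightarrow>\<^sub>E S \<Longrightarrow> restrict (jn A B f g) B = g"
  by (auto simp: jn_def PiE_iff extensional_def fun_eq_iff)

text \<open>The new factor has index \<open>length ks\<close>, so its vertices are disjoint from the
  old ones; assignments of the extended diagram are pairs of assignments of the two parts that give
  the contracted edges the same weight.\<close>

lemma Val_snoc:
  assumes wf: "wf_diag (ks, C, es)"
    and pe: "(e, r) \<in> set (picks (fE (length ks) k))" and pe': "(e', r') \<in> set (picks es)"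
  shows "Val H p (ks @ [k], (e, e') # C, r @ r') u =
    (\<Sum>(\<kappa>1, \<iota>1)\<in>fAsg H p (length ks) k. \<Sum>(\<kappa>2, \<iota>2)\<in>Asg H p ks C.
       if inst \<kappa>1 \<iota>1 e = inst \<kappa>2 \<iota>2 e' then wmono (map (inst \<kappa>1 \<iota>1) r @ map (inst \<kappa>2 \<iota>2) r') u else 0)"
proof -
  let ?j = "length ks"
  let ?K1 = "vK ?j k" and ?I1 = "vI ?j k" and ?K2 = "KV ks" and ?I2 = "IV ks"
  let ?P = "\<lambda>((\<kappa>1, \<iota>1), (\<kappa>2, \<iota>2)). inst \<kappa>1 \<iota>1 e = inst \<kappa>2 \<iota>2 e'"
  let ?g = "\<lambda>((\<kappa>1, \<iota>1), (\<kappa>2, \<iota>2)). wmono (map (inst \<kappa>1 \<iota>1) r @ map (inst \<kappa>2 \<iota>2) r') u"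
  let ?S = "{x \<in> fAsg H p ?j k \<times> Asg H p ks C. ?P x}"
  have fE1: "eK x \<in> ?K1 \<and> eI x \<in> ?I1" if "x \<in> insert e (set r)" for x
    using that picks_set[OF pe] fE_mem[of x ?j k] by auto
  have es2: "eK x \<in> ?K2 \<and> eI x \<in> ?I2" if "x \<in> insert e' (set r')" for x
    using that picks_set[OF pe'] wf by (auto simp: wf_diag_def wf_edge_def)
  have C2: "eK x \<in> ?K2 \<and> eI x \<in> ?I2 \<and> eK y \<in> ?K2 \<and> eI y \<in> ?I2" if "(x, y) \<in> set C" for x y
    using that wf by (auto simp: wf_diag_def wf_edge_def)
  have dK: "x \<notin> ?K1" if "x \<in> ?K2" for x using vK_disj[of ks k] that by auto
  have dI: "x \<notin> ?I1" if "x \<in> ?I2" for x using vI_disj[of ks k] that by auto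
  have r1: "inst (restrict \<kappa> ?K1) (restrict \<iota> ?I1) x = inst \<kappa> \<iota> x" if "x \<in> insert e (set r)" for \<kappa> \<iota> x
    using fE1[OF that] by (simp add: inst_def)
  have r2: "inst (restrict \<kappa> ?K2) (restrict \<iota> ?I2) x = inst \<kappa> \<iota> x" if "x \<in> insert e' (set r')" for \<kappa> \<iota> x
    using es2[OF that] by (simp add: inst_def)
  have rC: "inst (restrict \<kappa> ?K2) (restrict \<iota> ?I2) x = inst \<kappa> \<iota> x \<and> inst (restrict \<kappa> ?K2) (restrict \<iota> ?I2) y = inst \<kappa> \<iota> y"
    if "(x, y) \<in> set C" for \<kappa> \<iota> x y
    using C2[OF that] by (simp add: inst_def)
  have j1: "inst (jn ?K1 ?K2 \<kappa>1 \<kappa>2) (jn ?I1 ?I2 \<iota>1 \<iota>2) x = inst \<kappa>1 \<iota>1 x" if "x \<in> insert e (set r)" for \<kappa>1 \<kappa>2 \<iota>1 \<iota>2 x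
    using fE1[OF that] by (simp add: inst_def jn_def)
  have j2: "inst (jn ?K1 ?K2 \<kappa>1 \<kappa>2) (jn ?I1 ?I2 \<iota>1 \<iota>2) x = inst \<kappa>2 \<iota>2 x" if "x \<in> insert e' (set r')" for \<kappa>1 \<kappa>2 \<iota>1 \<iota>2 x
    using es2[OF that] dK dI by (simp add: inst_def jn_def)
  have jC: "inst (jn ?K1 ?K2 \<kappa>1 \<kappa>2) (jn ?I1 ?I2 \<iota>1 \<iota>2) x = inst \<kappa>2 \<iota>2 x \<and> inst (jn ?K1 ?K2 \<kappa>1 \<kappa>2) (jn ?I1 ?I2 \<iota>1 \<iota>2) y = inst \<kappa>2 \<iota>2 y"
    if "(x, y) \<in> set C" for \<kappa>1 \<kappa>2 \<iota>1 \<iota>2 x y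
    using C2[OF that] dK dI by (simp add: inst_def jn_def)
  have "Val H p (ks @ [k], (e, e') # C, r @ r') u =
     (\<Sum>w\<in>Asg H p (ks @ [k]) ((e, e') # C). (\<lambda>(\<kappa>, \<iota>). wmono (map (inst \<kappa> \<iota>) (r @ r')) u) w)"
    by (simp add: Val_def)
  also have "\<dots> = sum ?g ?S"
  proof (rule sum.reindex_bij_witness[where
        j = "\<lambda>(\<kappa>, \<iota>). ((restrict \<kappa> ?K1, restrict \<iota> ?I1), (restrict \<kappa> ?K2, restrict \<iota> ?I2))" and
        i = "\<lambda>((\<kappa>1, \<iota>1), (\<kappa>2, \<iota>2)). (jn ?K1 ?K2 \<kappa>1 \<kappa>2, jn ?I1 ?I2 \<iota>1 \<iota>2)"], goal_cases)
    case (1 a)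
    then show ?case by (auto simp: Asg_def KV_snoc IV_snoc jn_restrict split: prod.splits)
  next
    case (2 a)
    then show ?case
      by (auto simp: Asg_def KV_snoc IV_snoc fAsg_def r1 r2 rC split: prod.splits)
  next
    case (3 b)
    then show ?case
      by (auto simp: Asg_def fAsg_def restrict_jn1 restrict_jn2[OF vK_disj] restrict_jn2[OF vI_disj])
  next
    case (4 b)
    then show ?case
      using j1[of e] j2[of e'] jC
      by (auto simp: Asg_def fAsg_def KV_snoc IV_snoc intro!: jn_PiE split: prod.splits)
  next
    case (5 a)
    have m: "map (inst (restrict \<kappa> ?K1) (restrict \<iota> ?I1)) r = map (inst \<kappa> \<iota>) r"
      "map (inst (restrict \<kappa> ?K2) (restrict \<iota> ?I2)) r' = map (inst \<kappa> \<iota>) r'" for \<kappa> \<iota>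
      using r1 r2 by auto
    show ?case by (cases a) (simp only: prod.case map_append m)
  qed
  also have "\<dots> = (\<Sum>x\<in>fAsg H p ?j k \<times> Asg H p ks C. if ?P x then ?g x else 0)"
    by (rule sum.inter_filter) simp
  also have "\<dots> = (\<Sum>(\<kappa>1, \<iota>1)\<in>fAsg H p (length ks) k. \<Sum>(\<kappa>2, \<iota>2)\<in>Asg H p ks C.
       if inst \<kappa>1 \<iota>1 e = inst \<kappa>2 \<iota>2 e' then wmono (map (inst \<kappa>1 \<iota>1) r @ map (inst \<kappa>2 \<iota>2) r') u else 0)"
    by (simp add: sum.cartesian_product' case_prod_unfold cong: if_cong)
  finally show ?thesis .
qed

text \<open>The sum runs over all pairs of edges. Pairs of different colour never name the same
  weight and contribute 0 (\<open>Val_mismatch\<close>), which is why \<open>ext\<close> may omit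
  them.\<close>

lemma DVal_pair:
  assumes wf: "wf_diag (ks, C, es)"
  shows "(\<Sum>v\<in>free_vars sy \<nu> H p. DfVal H p v (length ks) k u * DVal H p v (ks, C, es) u) =
    (\<Sum>(e, r)\<leftarrow>picks (fE (length ks) k). \<Sum>(e', r')\<leftarrow>picks es. Val H p (ks @ [k], (e, e') # C, r @ r') u)"
proof -
  let ?V = "free_vars sy \<nu> H p" and ?F = "fAsg H p (length ks) k" and ?A = "Asg H p ks C"
  let ?fE = "fE (length ks) k"
  have sub: "set (map (inst (fst x) (snd x)) ?fE) \<subseteq> ?V" if "x \<in> ?F" for x
    using that inst_free[of _ "vK (length ks) k" H _ "vI (length ks) k" p] fE_mem by (fastforce simp: fAsg_def)
  have "(\<Sum>v\<in>?V. DfVal H p v (length ks) k u * DVal H p v (ks, C, es) u) =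
    (\<Sum>x\<in>?F. \<Sum>y\<in>?A. \<Sum>v\<in>?V. wmono_deriv v (map (inst (fst x) (snd x)) ?fE) u * wmono_deriv v (map (inst (fst y) (snd y)) es) u)"
    unfolding DfVal_def DVal_def case_prod_unfold fst_conv snd_conv sum_product
    by (subst sum.swap, rule sum.cong[OF refl], rule sum.swap)
  also have "\<dots> = (\<Sum>x\<in>?F. \<Sum>y\<in>?A. \<Sum>(e, r)\<leftarrow>picks ?fE. \<Sum>(e', r')\<leftarrow>picks es.
      if inst (fst x) (snd x) e = inst (fst y) (snd y) e' then wmono (map (inst (fst x) (snd x)) r @ map (inst (fst y) (snd y)) r') u else 0)"
    unfolding case_prod_unfold
    by (intro sum.cong refl) (simp add: wmono_deriv_pair[OF finite_free sub] picks_map o_def case_prod_unfold del: set_map cong: if_cong)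
  also have "\<dots> = (\<Sum>(e, r)\<leftarrow>picks ?fE. \<Sum>(e', r')\<leftarrow>picks es. \<Sum>x\<in>?F. \<Sum>y\<in>?A.
      if inst (fst x) (snd x) e = inst (fst y) (snd y) e' then wmono (map (inst (fst x) (snd x)) r @ map (inst (fst y) (snd y)) r') u else 0)"
    by (simp add: case_prod_unfold sum_list_sum_swap)
  also have "\<dots> = (\<Sum>(e, r)\<leftarrow>picks ?fE. \<Sum>(e', r')\<leftarrow>picks es. Val H p (ks @ [k], (e, e') # C, r @ r') u)"
    by (intro arg_cong[where f = sum_list] map_cong refl)
       (auto simp: Val_snoc[OF wf] case_prod_unfold cong: if_cong intro!: arg_cong[where f = sum_list])
  finally show ?thesis .
qed

section \<open>The loss as a combination of two factors\<close>

lemma vI_True: "vI j True = {j} \<times> {..<\<nu>}" and vI_False: "vI j False = {(j, 0)}"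
  by (auto simp: vI_def)

lemma vK_True: "vK j True = {(j, 0), (j, 1)}" and vK_False: "vK j False = {(j, 0)}"
  by (auto simp: vK_def less_2_cases_iff)

lemma wmono_upt: "wmono (map f [0..<n]) u = (\<Prod>m<n. u (f m))"
  using prod.distinct_set_conv_list[of "[0..<n]" "\<lambda>m. u (f m)"]
  by (simp add: wmono_def o_def atLeast0LessThan)

lemma sum_PiE_single: "(\<Sum>\<kappa>\<in>{x} \<rightarrow>\<^sub>E S. g (\<kappa> x)) = (\<Sum>a\<in>S. g a)"
  for g :: "'b \<Rightarrow> real"
  by (rule sum.reindex_bij_witness[where j = "\<lambda>\<kappa>. \<kappa> x" and i = "\<lambda>a. \<lambda>y\<in>{x}. a"])
     (auto simp: PiE_iff extensional_def fun_eq_iff)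

lemma sum_PiE_double:
  fixes g :: "'b \<Rightarrow> 'b \<Rightarrow> real"
  assumes "x \<noteq> y"
  shows "(\<Sum>\<kappa>\<in>{x, y} \<rightarrow>\<^sub>E S. g (\<kappa> x) (\<kappa> y)) = (\<Sum>a\<in>S. \<Sum>b\<in>S. g a b)"
  unfolding sum.cartesian_product
  by (rule sum.reindex_bij_witness[where j = "\<lambda>\<kappa>. (\<kappa> x, \<kappa> y)" and i = "\<lambda>(a, b). \<lambda>z\<in>{x, y}. if z = x then a else b"])
     (use assms in \<open>auto simp: PiE_iff extensional_def fun_eq_iff\<close>)

lemma sum_PiE_row: "(\<Sum>\<iota>\<in>({j} \<times> {..<n}) \<rightarrow>\<^sub>E S. g (\<lambda>m\<in>{..<n}. \<iota> (j, m))) = (\<Sum>f\<in>{..<n} \<rightarrow>\<^sub>E S. g f)"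
  for g :: "(nat \<Rightarrow> 'b) \<Rightarrow> real"
  by (rule sum.reindex_bij_witness[where j = "\<lambda>\<iota>. \<lambda>m\<in>{..<n}. \<iota> (j, m)" and i = "\<lambda>f. \<lambda>z\<in>{j} \<times> {..<n}. f (snd z)"])
     (auto simp: PiE_iff extensional_def fun_eq_iff)

lemma fVal_True: "fVal H p j True u = (\<Sum>idx\<in>multi_indices \<nu> p. (model_f sy \<nu> H u idx)\<^sup>2)"
proof -
  let ?m = "\<lambda>k f. \<Prod>m<\<nu>. u (col m, k, f m)"
  have "fVal H p j True u = (\<Sum>\<kappa>\<in>{(j, 0), (j, 1::nat)} \<rightarrow>\<^sub>E {..<H}. \<Sum>\<iota>\<in>({j} \<times> {..<\<nu>}) \<rightarrow>\<^sub>E {..<p}.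
      ?m (\<kappa> (j, 0)) (\<lambda>m\<in>{..<\<nu>}. \<iota> (j, m)) * ?m (\<kappa> (j, 1)) (\<lambda>m\<in>{..<\<nu>}. \<iota> (j, m)))"
    unfolding fVal_def fAsg_def vI_True vK_True sum.cartesian_product
    by (rule sum.cong[OF refl]) (auto simp: fE_def wmono_append wmono_upt inst_def o_def)
  also have "\<dots> = (\<Sum>\<kappa>\<in>{(j, 0), (j, 1::nat)} \<rightarrow>\<^sub>E {..<H}. \<Sum>f\<in>multi_indices \<nu> p.
      ?m (\<kappa> (j, 0)) f * ?m (\<kappa> (j, 1)) f)"
    unfolding multi_indices_def by (intro sum.cong refl sum_PiE_row)
  also have "\<dots> = (\<Sum>a<H. \<Sum>b<H. \<Sum>f\<in>multi_indices \<nu> p. ?m a f * ?m b f)"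
    by (rule sum_PiE_double) simp
  also have "\<dots> = (\<Sum>a<H. \<Sum>f\<in>multi_indices \<nu> p. \<Sum>b<H. ?m a f * ?m b f)"
    by (rule sum.cong[OF refl], rule sum.swap)
  also have "\<dots> = (\<Sum>f\<in>multi_indices \<nu> p. \<Sum>a<H. \<Sum>b<H. ?m a f * ?m b f)"
    by (rule sum.swap)
  also have "\<dots> = (\<Sum>idx\<in>multi_indices \<nu> p. (model_f sy \<nu> H u idx)\<^sup>2)"
    by (simp add: model_f_def col_def power2_eq_square sum_product)
  finally show ?thesis .
qed

lemma fVal_False: "fVal H p j False u = (\<Sum>idx\<in>multi_indices \<nu> p. model_f sy \<nu> H u idx * target_F \<nu> idx)"
proof -
  let ?m = "\<lambda>k i. \<Prod>m<\<nu>. u (col m, k, i)"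
  have "fVal H p j False u = (\<Sum>\<kappa>\<in>{(j, 0::nat)} \<rightarrow>\<^sub>E {..<H}. \<Sum>\<iota>\<in>{(j, 0::nat)} \<rightarrow>\<^sub>E {..<p}. ?m (\<kappa> (j, 0)) (\<iota> (j, 0)))"
    unfolding fVal_def fAsg_def vI_False vK_False sum.cartesian_product
    by (rule sum.cong[OF refl]) (auto simp: fE_def wmono_upt inst_def o_def)
  also have "\<dots> = (\<Sum>k<H. \<Sum>i<p. ?m k i)"
    by (simp only: sum_PiE_single[of "\<lambda>k. \<Sum>i<p. ?m k i"] sum_PiE_single[of "?m _"])
  also have "\<dots> = (\<Sum>i<p. \<Sum>k<H. ?m k i)" by (rule sum.swap)
  also have "\<dots> = (\<Sum>idx | idx \<in> multi_indices \<nu> p \<and> (\<forall>m<\<nu>. idx m = idx 0). model_f sy \<nu> H u idx)"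
  \<comment> \<open>Multi-indices on the support of the target are constant, hence determined by
    their value at mode 0.\<close>
  proof (rule sum.reindex_bij_witness[where i = "\<lambda>idx. idx 0" and j = "\<lambda>i. \<lambda>m\<in>{..<\<nu>}. i"], goal_cases)
    case (3 idx)
    have c: "idx m = idx 0" if "m < \<nu>" for m using 3 that by blast
    have "idx m = undefined" if "\<not> m < \<nu>" for m
      using 3 that PiE_arb[of idx "{..<\<nu>}" "\<lambda>_. {..<p}" m] by (simp add: multi_indices_def)
    then show ?case by (intro ext) (metis c lessThan_iff restrict_apply)
  next
    case (4 idx)
    then have "idx \<in> {..<\<nu>} \<rightarrow>\<^sub>E {..<p}" by (simp only: multi_indices_def mem_Collect_eq)
    from PiE_mem[OF this, of 0] show ?case using nu_ge2 by simp
  next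
    case (5 i)
    then show ?case by (auto simp: model_f_def col_def intro!: sum.cong prod.cong)
  qed (use nu_ge2 in \<open>auto simp: multi_indices_def\<close>)
  also have "\<dots> = (\<Sum>idx\<in>multi_indices \<nu> p. model_f sy \<nu> H u idx * target_F \<nu> idx)"
  proof -
    have fin: "finite (multi_indices \<nu> p)" by (simp add: multi_indices_def finite_PiE)
    have P: "(if Q then a else 0) = a * (if Q then 1 else 0)" for Q and a :: real by simp
    show ?thesis unfolding target_F_def sum.inter_filter[OF fin] by (rule sum.cong[OF refl P])
  qed
  finally show ?thesis .
qed

text \<open>The factor index \<open>j\<close> is arbitrary, so at every step of the flow the loss
  can be written with an index not yet used by the diagram.\<close>

lemma loss_fVal: "loss sy \<nu> H p u = 1 / 2 * fVal H p j True u - fVal H p j False u + half_normF_sq \<nu> p"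
  unfolding fVal_True fVal_False loss_def half_normF_sq_def power2_diff
  by (simp add: sum.distrib sum_subtractf sum_distrib_left algebra_simps)

lemma pderiv_loss: "pderiv_w v (loss sy \<nu> H p) u = 1 / 2 * DfVal H p v j True u - DfVal H p v j False u"
  unfolding pderiv_w_def loss_fVal[of _ _ _ j]
  by (rule DERIV_imp_deriv) (auto intro!: derivative_eq_intros fVal_deriv)

section \<open>The gradient flow as an operation on diagrams\<close>

definition comb :: "nat \<Rightarrow> nat \<Rightarrow> diagram list \<Rightarrow> weights \<Rightarrow> real" where
  "comb H p L u = (\<Sum>d\<leftarrow>L. coef (fst d) * Val H p d u)"

lemma comb_Nil [simp]: "comb H p [] u = 0"
  and comb_Cons [simp]: "comb H p (d # L) u = coef (fst d) * Val H p d u + comb H p L u"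
  and comb_append: "comb H p (L @ L') u = comb H p L u + comb H p L' u"
  by (simp_all add: comb_def)

lemma comb_concat_map: "comb H p (concat (map f xs)) u = (\<Sum>x\<leftarrow>xs. comb H p (f x) u)"
  by (induction xs) (auto simp: comb_append)

lemma comb_deriv:
  "((\<lambda>x. comb H p L (u(v := x))) has_field_derivative (\<Sum>d\<leftarrow>L. coef (fst d) * DVal H p v d u)) (at (u v))"
proof (induction L)
  case (Cons d L)
  show ?case
    unfolding comb_Cons list.map sum_list.Cons by (intro DERIV_add DERIV_cmult Val_deriv Cons.IH)
qed simp

lemma Val_mismatch: "ecol e \<noteq> ecol e' \<Longrightarrow> Val H p (ks, (e, e') # C, es) u = 0"
  by (auto simp: Val_def Asg_def inst_def)

lemma coef_snoc: "coef (ks @ [k]) = coef ks * (if k then 1 / 2 else - 1)"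
  by (simp add: coef_def)

lemma comb_ext:
  assumes wf: "wf_diag (ks, C, es)"
  shows "comb H p (ext (ks, C, es)) u = coef ks * (\<Sum>v\<in>free_vars sy \<nu> H p.
    (1 / 2 * DfVal H p v (length ks) True u - DfVal H p v (length ks) False u) * DVal H p v (ks, C, es) u)"
proof -
  have if_val: "comb H p (if ecol e = ecol e' then [(ks @ [k], (e, e') # C, r @ r')] else []) u =
      coef (ks @ [k]) * Val H p (ks @ [k], (e, e') # C, r @ r') u" for e e' r r' k
    using Val_mismatch[of e e'] by simp
  have "comb H p (ext (ks, C, es)) u = (\<Sum>k\<leftarrow>[True, False]. coef (ks @ [k]) *
     (\<Sum>(e, r)\<leftarrow>picks (fE (length ks) k). \<Sum>(e', r')\<leftarrow>picks es. Val H p (ks @ [k], (e, e') # C, r @ r') u))"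
    unfolding ext_def case_prod_unfold fst_conv snd_conv comb_concat_map if_val
    by (simp add: sum_list_const_mult)
  also have "\<dots> = coef ks * (\<Sum>v\<in>free_vars sy \<nu> H p.
    (1 / 2 * DfVal H p v (length ks) True u - DfVal H p v (length ks) False u) * DVal H p v (ks, C, es) u)"
    unfolding DVal_pair[OF wf, symmetric] coef_snoc
    by (simp add: algebra_simps sum_subtractf sum_negf sum.distrib sum_distrib_left sum_distrib_right)
  finally show ?thesis .
qed

text \<open>The factors 1/2 and -1 of the loss are absorbed by \<open>coef\<close>; only -1/T stays
  outside.\<close>

lemma flow_gen_comb:
  assumes wf: "\<And>d. d \<in> set L \<Longrightarrow> wf_diag d"
  shows "flow_gen sy \<nu> H p T (\<lambda>u. c * comb H p L u) = (\<lambda>u. (- 1 / T) * c * comb H p (concat (map ext L)) u)"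
proof
  fix u
  let ?V = "free_vars sy \<nu> H p"
  have pd: "pderiv_w v (\<lambda>u. c * comb H p L u) u = c * (\<Sum>d\<leftarrow>L. coef (fst d) * DVal H p v d u)" for v
    unfolding pderiv_w_def by (rule DERIV_imp_deriv) (auto intro!: derivative_eq_intros comb_deriv)
  have ex: "comb H p (ext d) u = (\<Sum>v\<in>?V. pderiv_w v (loss sy \<nu> H p) u * (coef (fst d) * DVal H p v d u))"
    if "d \<in> set L" for d
    using comb_ext[of "fst d" "fst (snd d)" "snd (snd d)" H p u] wf[OF that]
    by (simp add: pderiv_loss[of _ _ _ _ "length (fst d)"] sum_distrib_left mult_ac)
  have "(\<Sum>v\<in>?V. pderiv_w v (loss sy \<nu> H p) u * (\<Sum>d\<leftarrow>L. coef (fst d) * DVal H p v d u)) =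
     (\<Sum>d\<leftarrow>L. comb H p (ext d) u)"
    by (simp add: sum_list_const_mult[symmetric] sum_list_sum_swap[symmetric] ex cong: map_cong)
  then show "flow_gen sy \<nu> H p T (\<lambda>u. c * comb H p L u) u = (- 1 / T) * c * comb H p (concat (map ext L)) u"
    unfolding flow_gen_def pd comb_concat_map
    by (simp add: mult.left_commute[of _ c] sum_distrib_left[symmetric])
qed

lemma flow_gen_iter:
  "(flow_gen sy \<nu> H p T ^^ s) (\<lambda>w. loss sy \<nu> H p w - half_normF_sq \<nu> p) =
    (\<lambda>u. (- 1 / T) ^ s * comb H p (gens s) u)"
proof (induction s)
  case 0
  have fV: "Val H p ([k], [], fE 0 k) u = fVal H p 0 k u" for k u
    by (simp add: Val_def fVal_def Asg_def fAsg_def KV_def IV_def lessThan_Suc)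
  show ?case by (simp add: loss_fVal[of _ _ _ 0] fV coef_def fun_eq_iff)
next
  case (Suc s)
  show ?case
    using flow_gen_comb[of "gens s" H p T "(- 1 / T) ^ s"] gens_wf[of _ s] Suc.IH by simp
qed

section \<open>Wick's formula for diagrams\<close>

lemma Asg_Cons: "Asg H p ks ((e, e') # C) = {w \<in> Asg H p ks C. inst (fst w) (snd w) e = inst (fst w) (snd w) e'}"
  by (auto simp: Asg_def)

lemma Asg_inst_free:
  assumes "w \<in> Asg H p ks C" "\<And>e. e \<in> set es \<Longrightarrow> wf_edge ks e"
  shows "set (map (inst (fst w) (snd w)) es) \<subseteq> free_vars sy \<nu> H p"
  using assms inst_free[of "fst w" "KV ks" H "snd w" "IV ks" p] by (fastforce simp: Asg_def wf_edge_def)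

context
  fixes \<sigma> :: real
  assumes sig: "0 < \<sigma>"
begin

abbreviation "E \<equiv> \<lambda>H p f. (\<integral>u. f u \<partial>init_measure sy \<nu> H p \<sigma>)"

lemma Val_integrable:
  assumes "\<And>e. e \<in> set es \<Longrightarrow> wf_edge ks e"
  shows "integrable (init_measure sy \<nu> H p \<sigma>) (Val H p (ks, C, es))"
  unfolding Val_def init_measure_gauss case_prod_unfold
  by (simp, intro Bochner_Integration.integrable_sum wmono_integrable[OF sig finite_free] Asg_inst_free[OF _ assms]) auto

lemma E_Val_sum:
  assumes "\<And>e. e \<in> set es \<Longrightarrow> wf_edge ks e"
  shows "E H p (Val H p (ks, C, es)) = (\<Sum>w\<in>Asg H p ks C. E H p (wmono (map (inst (fst w) (snd w)) es)))"
  unfolding Val_def init_measure_gauss case_prod_unfold fst_conv snd_conv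
  by (intro Bochner_Integration.integral_sum wmono_integrable[OF sig finite_free] Asg_inst_free[OF _ assms])

text \<open>Induction along \<open>wick\<close>: the first open edge is matched with each possible
  partner, a matched pair becomes a further constraint on assignments, and each match yields
  \<sigma>^2.\<close>

lemma E_Val:
  assumes "\<And>e. e \<in> set es \<Longrightarrow> wf_edge ks e"
  shows "E H p (Val H p (ks, C, es)) = \<sigma> ^ length es * (\<Sum>C'\<leftarrow>wick es C. real (card (Asg H p ks C')))"
  using assms
proof (induction es C rule: wick.induct)
  case (1 C)
  have "prob_space (init_measure sy \<nu> H p \<sigma>)"
    unfolding init_measure_def by (intro prob_space_PiM prob_space_normal_density sig)
  then interpret prob_space "init_measure sy \<nu> H p \<sigma>" .
  have "wmono [] = (\<lambda>u :: weights. 1)" by (simp add: fun_eq_iff)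
  then show ?case by (subst E_Val_sum) (simp_all add: prob_space)
next
  case (2 e es C)
  let ?g = "\<lambda>w y. if inst (fst w) (snd w) e = inst (fst w) (snd w) (fst y)
        then E H p (wmono (map (inst (fst w) (snd w)) (snd y))) else 0"
  have wf: "wf_edge ks x" if "y \<in> set (picks es)" "x \<in> insert (fst y) (set (snd y))" for x y
    using that picks_set[of "fst y" "snd y" es] 2(2) by auto
  have "E H p (Val H p (ks, C, e # es)) = (\<Sum>w\<in>Asg H p ks C. E H p (wmono (map (inst (fst w) (snd w)) (e # es))))"
    by (rule E_Val_sum) (rule 2(2))
  also have "\<dots> = (\<Sum>w\<in>Asg H p ks C. \<sigma>\<^sup>2 * (\<Sum>y\<leftarrow>picks es. ?g w y))"
  proof (intro sum.cong refl)
    fix w assume w: "w \<in> Asg H p ks C"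
    have "set (map (inst (fst w) (snd w)) (e # es)) \<subseteq> free_vars sy \<nu> H p"
      by (rule Asg_inst_free[OF w 2(2)])
    from wmono_wick[OF sig finite_free this[unfolded list.map]]
    show "E H p (wmono (map (inst (fst w) (snd w)) (e # es))) = \<sigma>\<^sup>2 * (\<Sum>y\<leftarrow>picks es. ?g w y)"
      unfolding init_measure_gauss by (simp add: picks_map o_def case_prod_unfold cong: if_cong)
  qed
  also have "\<dots> = \<sigma>\<^sup>2 * (\<Sum>y\<leftarrow>picks es. \<Sum>w\<in>Asg H p ks C. ?g w y)"
    by (simp add: sum_list_sum_swap sum_distrib_left)
  also have "(\<Sum>y\<leftarrow>picks es. \<Sum>w\<in>Asg H p ks C. ?g w y) =
     (\<Sum>y\<leftarrow>picks es. E H p (Val H p (ks, (e, fst y) # C, snd y)))"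
    by (intro arg_cong[where f = sum_list] map_cong refl)
       (subst E_Val_sum, auto simp: Asg_Cons sum.inter_filter intro: wf)
  also have "\<dots> = (\<Sum>y\<leftarrow>picks es. \<sigma> ^ (length es - 1) *
       (\<Sum>C'\<leftarrow>(if ecol e = ecol (fst y) then wick (snd y) ((e, fst y) # C) else []). real (card (Asg H p ks C'))))"
  proof (intro arg_cong[where f = sum_list] map_cong refl)
    fix y assume y: "y \<in> set (picks es)"
    have len: "length (snd y) = length es - 1"
      using picks_mset[of "fst y" "snd y" es] y by (metis diff_Suc_1 prod.collapse size_add_mset size_mset)
    show "E H p (Val H p (ks, (e, fst y) # C, snd y)) = \<sigma> ^ (length es - 1) *
       (\<Sum>C'\<leftarrow>(if ecol e = ecol (fst y) then wick (snd y) ((e, fst y) # C) else []). real (card (Asg H p ks C')))"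
    proof (cases "ecol e = ecol (fst y)")
      case True
      have "E H p (Val H p (ks, (e, fst y) # C, snd y)) = \<sigma> ^ length (snd y) *
          (\<Sum>C'\<leftarrow>wick (snd y) ((e, fst y) # C). real (card (Asg H p ks C')))"
        by (rule 2(1)[OF y prod.collapse True], rule wf[OF y], simp)
      then show ?thesis using True len by simp
    qed (simp add: Val_mismatch)
  qed
  also have "\<sigma>\<^sup>2 * \<dots> = \<sigma>\<^sup>2 * \<sigma> ^ (length es - 1) * (\<Sum>C'\<leftarrow>wick (e # es) C. real (card (Asg H p ks C')))"
    by (simp add: sum_list_const_mult map_concat sum_list_concat_map o_def case_prod_unfold)
  also have "\<dots> = \<sigma> ^ length (e # es) * (\<Sum>C'\<leftarrow>wick (e # es) C. real (card (Asg H p ks C')))"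
    \<comment> \<open>With \<open>es\<close> empty there is no partner and the sum vanishes, so the
      truncated \<open>length es - 1\<close> does no damage.\<close>
    by (cases es) (auto simp: power2_eq_square)
  finally show ?case .
qed

end

definition full :: "nat \<Rightarrow> (bool list \<times> nat \<times> (edge \<times> edge) list) list" where
  "full s = concat (map (\<lambda>(ks, C, es). map (\<lambda>C'. (ks, length es, C')) (wick es C)) (gens s))"

text \<open>The prefactor T^s cancels the s factors 1/T of the flow and leaves the sign.\<close>

lemma Y_full:
  assumes "0 < \<sigma>" "0 < T"
  shows "Y sy \<nu> s H p \<sigma> T = (- 1) ^ s *
    (\<Sum>(ks, n, C)\<leftarrow>full s. coef ks * \<sigma> ^ n * real (card (Asg H p ks C)))"
proof -
  have wf: "wf_edge (fst d) e" if "d \<in> set (gens s)" "e \<in> set (snd (snd d))" for d e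
    using gens_wf[OF that(1)] that(2) by (auto simp: wf_diag_def)
  have int: "integrable (init_measure sy \<nu> H p \<sigma>) (comb H p L)" if "set L \<subseteq> set (gens s)" for L
    using that
  proof (induction L)
    case (Cons d L)
    have "integrable (init_measure sy \<nu> H p \<sigma>) (Val H p (fst d, fst (snd d), snd (snd d)))"
      by (rule Val_integrable[OF assms(1)]) (use wf Cons in auto)
    then show ?case using Cons by (simp add: comb_def[abs_def])
  qed (simp add: comb_def[abs_def])
  have "(\<integral>u. comb H p L u \<partial>init_measure sy \<nu> H p \<sigma>) =
    (\<Sum>d\<leftarrow>L. coef (fst d) * (\<integral>u. Val H p d u \<partial>init_measure sy \<nu> H p \<sigma>))" if "set L \<subseteq> set (gens s)" for L
    using that
  proof (induction L)
    case (Cons d L)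
    have "integrable (init_measure sy \<nu> H p \<sigma>) (Val H p (fst d, fst (snd d), snd (snd d)))"
      by (rule Val_integrable[OF assms(1)]) (use wf Cons in auto)
    then show ?case using Cons int[of L] by (simp add: comb_def[abs_def])
  qed (simp add: comb_def[abs_def])
  from this[of "gens s"]
  have "(\<integral>u. comb H p (gens s) u \<partial>init_measure sy \<nu> H p \<sigma>) =
    (\<Sum>d\<leftarrow>gens s. coef (fst d) * (\<integral>u. Val H p (fst d, fst (snd d), snd (snd d)) u \<partial>init_measure sy \<nu> H p \<sigma>))"
    by simp
  also have "\<dots> = (\<Sum>d\<leftarrow>gens s. coef (fst d) * (\<sigma> ^ length (snd (snd d)) *
      (\<Sum>C'\<leftarrow>wick (snd (snd d)) (fst (snd d)). real (card (Asg H p (fst d) C')))))"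
    by (intro arg_cong[where f = sum_list] map_cong refl, subst E_Val[OF assms(1)]) (use wf in auto)
  also have "\<dots> = (\<Sum>(ks, n, C)\<leftarrow>full s. coef ks * \<sigma> ^ n * real (card (Asg H p ks C)))"
    unfolding full_def map_concat sum_list_concat_map
    by (simp add: o_def case_prod_unfold sum_list_const_mult[symmetric] mult.assoc)
  finally have "(\<integral>u. comb H p (gens s) u \<partial>init_measure sy \<nu> H p \<sigma>) =
    (\<Sum>(ks, n, C)\<leftarrow>full s. coef ks * \<sigma> ^ n * real (card (Asg H p ks C)))" .
  moreover have "T ^ s * (- 1 / T) ^ s = (- 1) ^ s"
    using assms(2) by (simp add: power_mult_distrib[symmetric])
  ultimately show ?thesis
    unfolding Y_def flow_gen_iter by (simp add: mult.assoc[symmetric])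
qed

end

section \<open>Counting assignments\<close>

text \<open>The connected component of \<open>x\<close> in the undirected graph \<open>R\<close>; a
  vertex that meets no pair forms a component of its own.\<close>

definition cls :: "('a \<times> 'a) set \<Rightarrow> 'a \<Rightarrow> 'a set" where
  "cls R x = (R \<union> R\<inverse>)\<^sup>* `` {x}"

lemma cls_compat: "(x, y) \<in> R \<Longrightarrow> cls R x = cls R y"
  unfolding cls_def by (auto intro: converse_rtrancl_into_rtrancl)

lemma cls_self: "x \<in> cls R x"
  by (simp add: cls_def)

lemma compat_cls:
  assumes R: "\<And>x y. (x, y) \<in> R \<Longrightarrow> f x = f y" and "cls R x = cls R y"
  shows "f x = f y"
proof -
  have "(x, y) \<in> (R \<union> R\<inverse>)\<^sup>*"
    using cls_self[of y R] assms(2) by (auto simp: cls_def)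
  then show ?thesis
    by (induction rule: rtrancl_induct) (auto dest: R)
qed

text \<open>A function that agrees along all edges of the graph is the same as a free choice of one
  value per component.\<close>

lemma card_compat:
  assumes "finite K" "R \<subseteq> K \<times> K"
  shows "card {\<kappa> \<in> K \<rightarrow>\<^sub>E {..<H::nat}. \<forall>(x, y)\<in>R. \<kappa> x = \<kappa> y} = H ^ card (cls R ` K)"
proof -
  let ?S = "{\<kappa> \<in> K \<rightarrow>\<^sub>E {..<H}. \<forall>(x, y)\<in>R. \<kappa> x = \<kappa> y}"
  let ?r = "\<lambda>A. SOME x. x \<in> K \<and> cls R x = A"
  have r: "?r A \<in> K \<and> cls R (?r A) = A" if "A \<in> cls R ` K" for A
  proof -
    from that obtain x where "x \<in> K \<and> cls R x = A" by blast
    then show ?thesis by (rule someI)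
  qed
  have "bij_betw (\<lambda>f. \<lambda>x\<in>K. f (cls R x)) (cls R ` K \<rightarrow>\<^sub>E {..<H}) ?S"
  proof (rule bij_betwI[where g = "\<lambda>\<kappa>. \<lambda>A\<in>cls R ` K. \<kappa> (?r A)"])
    show "(\<lambda>f. \<lambda>x\<in>K. f (cls R x)) \<in> (cls R ` K \<rightarrow>\<^sub>E {..<H}) \<rightarrow> ?S"
    proof
      fix f assume f: "f \<in> cls R ` K \<rightarrow>\<^sub>E {..<H}"
      have "(\<lambda>x\<in>K. f (cls R x)) \<in> K \<rightarrow>\<^sub>E {..<H}" using PiE_mem[OF f] by auto
      moreover have "(\<lambda>x\<in>K. f (cls R x)) x = (\<lambda>x\<in>K. f (cls R x)) y" if "(x, y) \<in> R" for x y
        using that assms(2) cls_compat[OF that] by auto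
      ultimately show "(\<lambda>x\<in>K. f (cls R x)) \<in> ?S" by blast
    qed
    show "(\<lambda>\<kappa>. \<lambda>A\<in>cls R ` K. \<kappa> (?r A)) \<in> ?S \<rightarrow> (cls R ` K \<rightarrow>\<^sub>E {..<H})"
      using r by (auto simp: PiE_iff)
    fix f assume f: "f \<in> cls R ` K \<rightarrow>\<^sub>E {..<H}"
    show "(\<lambda>A\<in>cls R ` K. (\<lambda>x\<in>K. f (cls R x)) (?r A)) = f"
    proof
      fix A show "(\<lambda>A\<in>cls R ` K. (\<lambda>x\<in>K. f (cls R x)) (?r A)) A = f A"
        using r[of A] PiE_arb[OF f, of A] by (cases "A \<in> cls R ` K") auto
    qed
  next
    fix \<kappa> assume k: "\<kappa> \<in> ?S"
    show "(\<lambda>x\<in>K. (\<lambda>A\<in>cls R ` K. \<kappa> (?r A)) (cls R x)) = \<kappa>"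
    proof
      fix x show "(\<lambda>x\<in>K. (\<lambda>A\<in>cls R ` K. \<kappa> (?r A)) (cls R x)) x = \<kappa> x"
      proof (cases "x \<in> K")
        case True
        have "\<kappa> (?r (cls R x)) = \<kappa> x"
          by (rule compat_cls[of R]) (use k r[of "cls R x"] True in auto)
        then show ?thesis using True by simp
      qed (use k in \<open>auto simp: PiE_iff extensional_def\<close>)
    qed
  qed
  then show ?thesis
    using assms(1) by (simp add: bij_betw_same_card[symmetric] card_funcsetE)
qed

text \<open>Every compatible labelling factors through the components. Explicit labellings thereby
  give lower bounds on the number of classes of a pairing.\<close>

lemma card_label_le:
  assumes "finite K" "\<And>x y. (x, y) \<in> R \<Longrightarrow> f x = f y"
  shows "card (f ` K) \<le> card (cls R ` K)"
proof -
  have "f ` K \<subseteq> (\<lambda>A. f (SOME x. cls R x = A)) ` (cls R ` K)"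
  proof
    fix z assume "z \<in> f ` K"
    then obtain x where x: "x \<in> K" "z = f x" by auto
    have "cls R (SOME y. cls R y = cls R x) = cls R x" by (rule someI) simp
    then have "f (SOME y. cls R y = cls R x) = f x" by (rule compat_cls[of R f, rotated]) (rule assms(2))
    then show "z \<in> (\<lambda>A. f (SOME x. cls R x = A)) ` (cls R ` K)" using x by force
  qed
  then show ?thesis using assms(1) by (meson card_image_le card_mono finite_imageI le_trans)
qed

section \<open>Labelled edges and the parity criterion for pairings\<close>

definition RK :: "(edge \<times> edge) list \<Rightarrow> (vert \<times> vert) set" where
  "RK C = (\<lambda>(e, e'). (eK e, eK e')) ` set C"

definition RI :: "(edge \<times> edge) list \<Rightarrow> (vert \<times> vert) set" where
  "RI C = (\<lambda>(e, e'). (eI e, eI e')) ` set C"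

definition lab :: "(vert \<Rightarrow> 'a) \<Rightarrow> (vert \<Rightarrow> 'b) \<Rightarrow> edge \<Rightarrow> nat \<times> 'a \<times> 'b" where
  "lab \<alpha> \<beta> e = (ecol e, \<alpha> (eK e), \<beta> (eI e))"

text \<open>The vertex classes of a contracted diagram are the fibres of the finest compatible labelling.\<close>

definition compat :: "(vert \<Rightarrow> 'a) \<Rightarrow> (vert \<Rightarrow> 'b) \<Rightarrow> (edge \<times> edge) list \<Rightarrow> bool" where
  "compat \<alpha> \<beta> C \<longleftrightarrow> (\<forall>(e, e')\<in>set C. lab \<alpha> \<beta> e = lab \<alpha> \<beta> e')"

lemma compat_Nil [simp]: "compat \<alpha> \<beta> []"
  and compat_Cons [simp]: "compat \<alpha> \<beta> ((e, e') # C) \<longleftrightarrow> lab \<alpha> \<beta> e = lab \<alpha> \<beta> e' \<and> compat \<alpha> \<beta> C"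
  by (auto simp: compat_def)

definition cnt :: "(vert \<Rightarrow> 'a) \<Rightarrow> (vert \<Rightarrow> 'b) \<Rightarrow> edge list \<Rightarrow> nat \<times> 'a \<times> 'b \<Rightarrow> nat" where
  "cnt \<alpha> \<beta> es t = count (image_mset (lab \<alpha> \<beta>) (mset es)) t"

lemma cnt_Nil [simp]: "cnt \<alpha> \<beta> [] t = 0"
  and cnt_Cons: "cnt \<alpha> \<beta> (e # es) t = (if lab \<alpha> \<beta> e = t then 1 else 0) + cnt \<alpha> \<beta> es t"
  and cnt_append [simp]: "cnt \<alpha> \<beta> (es @ es') t = cnt \<alpha> \<beta> es t + cnt \<alpha> \<beta> es' t"
  by (auto simp: cnt_def)

lemma cnt_picks: "(e, r) \<in> set (picks es) \<Longrightarrow> cnt \<alpha> \<beta> es t = (if lab \<alpha> \<beta> e = t then 1 else 0) + cnt \<alpha> \<beta> r t"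
  using picks_mset[of e r es] by (simp add: cnt_def)

lemma cnt_pos: "cnt \<alpha> \<beta> es t \<noteq> 0 \<longleftrightarrow> (\<exists>e\<in>set es. lab \<alpha> \<beta> e = t)"
  by (induction es) (auto simp: cnt_Cons)

lemma cnt_cong: "(\<And>e. e \<in> set es \<Longrightarrow> lab \<alpha> \<beta> e = lab \<alpha>' \<beta>' e) \<Longrightarrow> cnt \<alpha> \<beta> es t = cnt \<alpha>' \<beta>' es t"
  by (induction es) (auto simp: cnt_Cons)

lemma cnt_upt:
  "cnt \<alpha> \<beta> (map f [0..<n]) t = card {m. m < n \<and> lab \<alpha> \<beta> (f m) = t}"
proof -
  have "cnt \<alpha> \<beta> (map f [0..<n]) t = count (image_mset (\<lambda>m. lab \<alpha> \<beta> (f m)) (mset_set {0..<n})) t"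
    by (simp add: cnt_def multiset.map_comp o_def)
  also have "\<dots> = card {m. m < n \<and> lab \<alpha> \<beta> (f m) = t}"
    by (subst count_image_mset_eq_card_vimage) (auto intro: arg_cong[where f = card])
  finally show ?thesis .
qed

context cp_model begin

lemma wick_set: "C' \<in> set (wick es C) \<Longrightarrow> set C \<subseteq> set C'"
proof (induction es C rule: wick.induct)
  case (2 e es C)
  from 2(2) obtain e' r where "(e', r) \<in> set (picks es)" "ecol e = ecol e'" "C' \<in> set (wick r ((e, e') # C))"
    by (auto split: if_splits)
  from 2(1)[OF this(1) refl this(2,3)] show ?case by simp
qed simp

lemma wick_even: "C' \<in> set (wick es C) \<Longrightarrow> even (length es)"
proof (induction es C rule: wick.induct)
  case (2 e es C)
  from 2(2) obtain e' r where p: "(e', r) \<in> set (picks es)" "ecol e = ecol e'" "C' \<in> set (wick r ((e, e') # C))"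
    by (auto split: if_splits)
  from 2(1)[OF p(1) refl p(2,3)] picks_mset[OF p(1)] show ?case
    by (metis even_Suc length_Cons size_add_mset size_mset)
qed simp

text \<open>Each match removes two edges with the same label.\<close>

lemma wick_parity:
  "C' \<in> set (wick es C) \<Longrightarrow> compat \<alpha> \<beta> C' \<Longrightarrow> even (cnt \<alpha> \<beta> es t)"
proof (induction es C rule: wick.induct)
  case (2 e es C)
  from 2(2) obtain e' r where p: "(e', r) \<in> set (picks es)" "ecol e = ecol e'" "C' \<in> set (wick r ((e, e') # C))"
    by (auto split: if_splits)
  have "lab \<alpha> \<beta> e = lab \<alpha> \<beta> e'"
    using wick_set[OF p(3)] 2(3) by (auto simp: compat_def)
  with 2(1)[OF p(1) refl p(2,3) 2(3)] show ?case
    by (simp add: cnt_Cons cnt_picks[OF p(1)])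
qed simp

lemma wick_wf:
  "C' \<in> set (wick es C) \<Longrightarrow> wf_diag (ks, C, es) \<Longrightarrow> wf_diag (ks, C', [])"
proof (induction es C rule: wick.induct)
  case (2 e es C)
  from 2(2) obtain e' r where p: "(e', r) \<in> set (picks es)" "ecol e = ecol e'" "C' \<in> set (wick r ((e, e') # C))"
    by (auto split: if_splits)
  have "wf_diag (ks, (e, e') # C, r)"
    using 2(3) picks_set[OF p(1)] p(2) by (auto simp: wf_diag_def)
  from 2(1)[OF p(1) refl p(2,3) this] show ?case .
qed simp

text \<open>Converse of \<open>wick_parity\<close>, by greedy matching: the label of the first edge
  occurs an odd number of times among the others, so a partner exists, and its removal keeps all
  counts even. Constructing a diagram is thereby reduced to counting labels.\<close>

lemma wick_ex:
  assumes "\<And>t. even (cnt \<alpha> \<beta> es t)" "compat \<alpha> \<beta> C"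
  shows "\<exists>C'\<in>set (wick es C). compat \<alpha> \<beta> C'"
  using assms
proof (induction es C rule: wick.induct)
  case (2 e es C)
  have "odd (cnt \<alpha> \<beta> es (lab \<alpha> \<beta> e))"
    using 2(2)[of "lab \<alpha> \<beta> e"] by (simp add: cnt_Cons)
  then have "cnt \<alpha> \<beta> es (lab \<alpha> \<beta> e) \<noteq> 0" by (intro notI) simp
  then obtain e' where e': "e' \<in> set es" "lab \<alpha> \<beta> e' = lab \<alpha> \<beta> e"
    unfolding cnt_pos by auto
  then obtain r where r: "(e', r) \<in> set (picks es)" using picks_ex by fast
  have col: "ecol e = ecol e'" using e'(2) by (simp add: lab_def)
  have "even (cnt \<alpha> \<beta> r t)" for t
    using 2(2)[of t] e'(2) by (simp add: cnt_Cons cnt_picks[OF r] split: if_splits)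
  then obtain C' where "C' \<in> set (wick r ((e, e') # C))" "compat \<alpha> \<beta> C'"
    using 2(1)[OF r refl col] 2(3) e'(2) by auto
  then show ?case using r col by auto
qed simp

text \<open>Contracted edges have equal colours, so a contraction only imposes one equation on ranks
  and one on coordinates, and the two systems are independent.\<close>

lemma card_Asg:
  assumes "wf_diag (ks, C, es)"
  shows "card (Asg H p ks C) = H ^ card (cls (RK C) ` KV ks) * p ^ card (cls (RI C) ` IV ks)"
proof -
  have wf: "wf_edge ks e \<and> wf_edge ks e' \<and> ecol e = ecol e'" if "(e, e') \<in> set C" for e e'
    using assms that by (auto simp: wf_diag_def)
  have K: "RK C \<subseteq> KV ks \<times> KV ks" and I: "RI C \<subseteq> IV ks \<times> IV ks"
    using wf by (auto simp: RK_def RI_def wf_edge_def)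
  have "Asg H p ks C = {\<kappa> \<in> KV ks \<rightarrow>\<^sub>E {..<H}. \<forall>(x, y)\<in>RK C. \<kappa> x = \<kappa> y} \<times>
      {\<iota> \<in> IV ks \<rightarrow>\<^sub>E {..<p}. \<forall>(x, y)\<in>RI C. \<iota> x = \<iota> y}"
    using wf by (auto simp: Asg_def RK_def RI_def inst_def)
  then show ?thesis
    by (simp add: card_cartesian_product card_compat[OF _ K] card_compat[OF _ I])
qed

lemma compat_cls_diag:
  assumes "wf_diag (ks, C, es)" shows "compat (cls (RK C)) (cls (RI C)) C"
  using assms unfolding compat_def wf_diag_def
  by (auto simp: lab_def RK_def RI_def intro!: cls_compat)

lemma compat_mono: "set C \<subseteq> set C' \<Longrightarrow> compat \<alpha> \<beta> C' \<Longrightarrow> compat \<alpha> \<beta> C"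
  by (auto simp: compat_def)

definition raw :: "bool list \<Rightarrow> edge list" where
  "raw ks = concat (map (\<lambda>j. fE j (ks ! j)) [0..<length ks])"

lemma raw_snoc: "raw (ks @ [k]) = raw ks @ fE (length ks) k"
  by (auto simp: raw_def nth_append intro!: arg_cong[where f = concat])

lemma raw_Nil [simp]: "raw [] = []" by (simp add: raw_def)

lemma raw_mem: "e \<in> set (raw ks) \<Longrightarrow> wf_edge ks e"
proof (induction ks rule: rev_induct)
  case (snoc k ks)
  then show ?case by (auto simp: raw_snoc fE_wf wf_edge_snoc)
qed simp

text \<open>Contracted edges have equal labels, so each contraction removes two occurrences of one
  label. Parities may therefore be computed from all edges of all factors, regardless of the
  contractions, and become additive over the factors.\<close>

lemma gens_parity:
  "(ks, C, es) \<in> set (gens s) \<Longrightarrow> compat \<alpha> \<beta> C \<Longrightarrow> even (cnt \<alpha> \<beta> es t + cnt \<alpha> \<beta> (raw ks) t)"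
proof (induction s arbitrary: ks C es)
  case 0
  then show ?case by (auto simp: raw_def)
next
  case (Suc s)
  then obtain ks0 C0 es0 k e r e' r' where g: "(ks0, C0, es0) \<in> set (gens s)"
    and p: "(e, r) \<in> set (picks (fE (length ks0) k))" "(e', r') \<in> set (picks es0)"
    and eq: "ks = ks0 @ [k]" "C = (e, e') # C0" "es = r @ r'"
    by (auto simp: ext_mem)
  show ?case
    using Suc.IH[OF g] Suc.prems(2)
    by (auto simp: eq raw_snoc cnt_picks[OF p(1)] cnt_picks[OF p(2)])
qed

section \<open>Upper bounds\<close>

lemma col_sym: "sy \<Longrightarrow> col m = 0" and col_asym: "\<not> sy \<Longrightarrow> col m = m"
  unfolding col_def by simp_all

text \<open>The number of coordinate classes lost for each rank class beyond the first.\<close>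

definition wgt :: nat where "wgt = (if sy then \<nu> div 2 else \<nu> - 1)"

lemma wgt_sym: "sy \<Longrightarrow> wgt = \<nu> div 2" and wgt_asym: "\<not> sy \<Longrightarrow> wgt = \<nu> - 1"
  unfolding wgt_def by simp_all

text \<open>The parity condition that survives removal of a factor: in the asymmetric model an \<open>fF\<close> factor
  carries one edge of each colour, so only the independence of the parity from the colour is inherited.\<close>

definition okp :: "(nat \<Rightarrow> nat) \<Rightarrow> bool" where
  "okp f \<longleftrightarrow> (if sy then even (f 0) else \<forall>c<\<nu>. \<forall>c'<\<nu>. even (f c + f c'))"

lemma okp_even: "(\<And>c. even (f c)) \<Longrightarrow> okp f"
  by (simp add: okp_def)

lemma okpD: "okp f \<Longrightarrow> \<not> sy \<Longrightarrow> c < \<nu> \<Longrightarrow> c' < \<nu> \<Longrightarrow> even (f c + f c')"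
  by (metis okp_def)

lemma okpI: "(sy \<Longrightarrow> even (f 0)) \<Longrightarrow> (\<And>c c'. \<not> sy \<Longrightarrow> c < \<nu> \<Longrightarrow> c' < \<nu> \<Longrightarrow> even (f c + f c')) \<Longrightarrow> okp f"
  by (metis okp_def)

lemma okp_sym: "okp f \<Longrightarrow> sy \<Longrightarrow> even (f 0)"
  by (metis okp_def)

lemma okp_add:
  assumes "okp f" "okp g" shows "okp (\<lambda>c. f c + g c)"
proof (rule okpI)
  fix c c' assume "\<not> sy" "c < \<nu>" "c' < \<nu>"
  from okpD[OF assms(1) this] okpD[OF assms(2) this] show "even (f c + g c + (f c' + g c'))" by presburger
qed (use assms okp_sym in auto)

lemma okp_cancel:
  assumes "okp (\<lambda>c. f c + g c)" "okp g" shows "okp f"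
proof (rule okpI)
  fix c c' assume "\<not> sy" "c < \<nu>" "c' < \<nu>"
  from okpD[OF assms(1) this] okpD[OF assms(2) this] show "even (f c + f c')" by presburger
next
  assume sy
  from okp_sym[OF assms(1) this] okp_sym[OF assms(2) this] show "even (f 0)" by simp
qed

definition valid :: "(vert \<Rightarrow> 'a) \<Rightarrow> (vert \<Rightarrow> 'b) \<Rightarrow> bool list \<Rightarrow> bool" where
  "valid \<alpha> \<beta> ks \<longleftrightarrow> (\<forall>A J. okp (\<lambda>c. cnt \<alpha> \<beta> (raw ks) (c, A, J)))"

definition mcnt :: "(nat \<Rightarrow> 'b) \<Rightarrow> 'b \<Rightarrow> nat \<Rightarrow> nat" where
  "mcnt b J c = card {m. m < \<nu> \<and> col m = c \<and> b m = J}"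

lemma cnt_fE_True: "cnt \<alpha> \<beta> (fE j True) (c, A, J) =
   (if \<alpha> (j, 0) = A then mcnt (\<lambda>m. \<beta> (j, m)) J c else 0) + (if \<alpha> (j, 1) = A then mcnt (\<lambda>m. \<beta> (j, m)) J c else 0)"
  by (cases "\<alpha> (j, 0) = A"; cases "\<alpha> (j, 1) = A") (simp_all add: fE_def cnt_upt mcnt_def lab_def)

lemma cnt_fE_False: "cnt \<alpha> \<beta> (fE j False) (c, A, J) =
   (if \<alpha> (j, 0) = A \<and> \<beta> (j, 0) = J then card {m. m < \<nu> \<and> col m = c} else 0)"
  by (cases "\<alpha> (j, 0) = A"; cases "\<beta> (j, 0) = J") (simp_all add: fE_def cnt_upt lab_def)

lemma cnt_raw_0:
  "A \<notin> \<alpha> ` KV ks \<or> J \<notin> \<beta> ` IV ks \<Longrightarrow> cnt \<alpha> \<beta> (raw ks) (c, A, J) = 0"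
  using cnt_pos[of \<alpha> \<beta> "raw ks" "(c, A, J)"] raw_mem by (fastforce simp: lab_def wf_edge_def)

text \<open>A class of new I-vertices without old I-vertices has to satisfy the parity condition on its own.\<close>

lemma new_classes_le:
  assumes "m0 < \<nu>" "b m0 \<in> Z" "\<And>J. J \<notin> Z \<Longrightarrow> okp (mcnt b J)"
  shows "card (b ` {..<\<nu>} - Z) + wgt \<le> \<nu> - 1"
proof (cases sy)
  case True
  let ?S = "b ` {..<\<nu>} - Z"
  \<comment> \<open>Each new class has at least two slots, and slot \<open>m0\<close> is not among
    them; as \<nu> is even, at most \<nu>/2 - 1 new classes fit into \<nu> - 1 slots.\<close>
  have ge: "2 \<le> card {m \<in> {..<\<nu>}. b m = J}" if "J \<in> ?S" for J
  proof -
    have "even (card {m \<in> {..<\<nu>}. b m = J})"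
      using okp_sym[OF assms(3)[of J] True] that col_sym[OF True] by (simp add: mcnt_def)
    moreover have "{m \<in> {..<\<nu>}. b m = J} \<noteq> {}" using that by auto
    then have "card {m \<in> {..<\<nu>}. b m = J} \<noteq> 0" by simp
    ultimately show ?thesis by presburger
  qed
  have "2 * card ?S = (\<Sum>J\<in>?S. 2)" by simp
  also have "\<dots> \<le> (\<Sum>J\<in>?S. card {m \<in> {..<\<nu>}. b m = J})" by (intro sum_mono ge)
  also have "\<dots> = card (\<Union>J\<in>?S. {m \<in> {..<\<nu>}. b m = J})"
    by (intro card_UN_disjoint[symmetric]) auto
  also have "\<dots> \<le> card ({..<\<nu>} - {m0})"
    by (rule card_mono) (use assms(2) in auto)
  also have "\<dots> = \<nu> - 1" using assms(1) by simp
  finally show ?thesis unfolding wgt_sym[OF True] using sy_even[OF True] nu_ge2 by (auto elim!: evenE)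
next
  case False
  \<comment> \<open>A new class through slot \<open>m\<close> has one edge of colour
    \<open>m\<close> but none of colour \<open>m0\<close>, so its parity would depend on the
    colour.\<close>
  have "b ` {..<\<nu>} - Z = {}"
  proof (rule ccontr)
    assume "b ` {..<\<nu>} - Z \<noteq> {}"
    then obtain m where m: "m < \<nu>" "b m \<notin> Z" by auto
    have mc: "mcnt b (b m) c = (if b c = b m then 1 else 0)" if "c < \<nu>" for c
    proof -
      have "{m'. m' < \<nu> \<and> col m' = c \<and> b m' = b m} = (if b c = b m then {c} else {})"
        using that by (auto simp: col_asym[OF False])
      then show ?thesis by (simp add: mcnt_def)
    qed
    have "even (mcnt b (b m) m + mcnt b (b m) m0)"
      by (rule okpD[OF assms(3)[OF m(2)] False m(1) assms(1)])
    then show False using assms(2) m mc assms(1) by (auto split: if_splits)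
  qed
  then show ?thesis unfolding wgt_asym[OF False] by simp
qed

definition nD :: "bool list \<Rightarrow> nat" where "nD ks = length (filter id ks)"

lemma nD_snoc: "nD (ks @ [k]) = nD ks + (if k then 1 else 0)" by (simp add: nD_def)

text \<open>Removal of an f^2 whose rank slot \<open>x\<close> is attached to an old class;
  \<open>y\<close> is the other rank slot. If \<open>y\<close> lies in the class of
  \<open>x\<close>, the two copies of f cancel in parity and up to \<nu> - 1 coordinates are new.
  Otherwise parity at \<open>y\<close> costs \<open>wgt\<close> of these: if the class of
  \<open>y\<close> is new, this pays for that class, and if it is old, it pays for merging it with
  the class of \<open>x\<close>. The last case is the reason for an induction hypothesis about all
  rank labellings.\<close>

lemma upper_True:
  fixes \<alpha> :: "vert \<Rightarrow> 'a" and \<beta> :: "vert \<Rightarrow> 'b"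
  assumes IH: "\<And>\<alpha>' :: vert \<Rightarrow> 'a. compat \<alpha>' \<beta> C \<Longrightarrow> valid \<alpha>' \<beta> ks \<Longrightarrow>
      card (\<beta> ` IV ks) + wgt * (card (\<alpha>' ` KV ks) - 1) \<le> 1 + (\<nu> - 1) * nD ks"
    and c: "compat \<alpha> \<beta> C" and v: "valid \<alpha> \<beta> (ks @ [True])"
    and x: "x \<in> vK (length ks) True" "\<alpha> x \<in> \<alpha> ` KV ks" and m0: "m0 < \<nu>" "\<beta> (length ks, m0) \<in> \<beta> ` IV ks"
  shows "card (\<beta> ` IV (ks @ [True])) + wgt * (card (\<alpha> ` KV (ks @ [True])) - 1) \<le> 1 + (\<nu> - 1) * nD (ks @ [True])"
proof -
  let ?j = "length ks"
  let ?b = "\<lambda>m. \<beta> (?j, m)"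
  let ?q = "card (\<beta> ` IV ks)" and ?x = "card (?b ` {..<\<nu>} - \<beta> ` IV ks)"
  obtain y where y: "vK ?j True = {x, y}" "x \<noteq> y"
    and cn: "\<And>A J c. cnt \<alpha> \<beta> (fE ?j True) (c, A, J) =
      (if \<alpha> x = A then mcnt ?b J c else 0) + (if \<alpha> y = A then mcnt ?b J c else 0)"
  proof -
    from x(1) consider "x = (?j, 0)" | "x = (?j, 1)" by (auto simp: vK_True)
    then show thesis
    proof cases
      case 1
      then show ?thesis using that[of "(?j, 1)"] by (simp add: vK_True cnt_fE_True)
    next
      case 2
      then show ?thesis using that[of "(?j, 0)"] by (simp add: vK_True cnt_fE_True insert_commute add.commute)
    qed
  qed
  have tot: "okp (\<lambda>c. cnt \<alpha> \<beta> (raw ks) (c, A, J) +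
      ((if \<alpha> x = A then mcnt ?b J c else 0) + (if \<alpha> y = A then mcnt ?b J c else 0)))" for A J
    using v by (simp add: valid_def raw_snoc cn)
  have "\<beta> ` IV (ks @ [True]) = \<beta> ` IV ks \<union> (?b ` {..<\<nu>} - \<beta> ` IV ks)"
    by (auto simp: IV_snoc vI_True)
  then have q: "card (\<beta> ` IV (ks @ [True])) = ?q + ?x"
    by (subst card_Un_disjoint[symmetric]) auto
  have aK: "\<alpha> ` KV (ks @ [True]) = insert (\<alpha> y) (\<alpha> ` KV ks)"
    using x(2) by (auto simp: KV_snoc y)
  have pos: "0 < card (\<alpha> ` KV ks)" using x(2) by (auto simp: card_gt_0_iff)
  show ?thesis
  proof (cases "\<alpha> y = \<alpha> x")
    case True
    have "valid \<alpha> \<beta> ks"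
      unfolding valid_def
    proof (intro allI)
      fix A J show "okp (\<lambda>c. cnt \<alpha> \<beta> (raw ks) (c, A, J))"
        by (rule okp_cancel[OF tot okp_even]) (simp add: True)
    qed
    from IH[OF c this] have "?q + wgt * (card (\<alpha> ` KV ks) - 1) \<le> 1 + (\<nu> - 1) * nD ks" .
    moreover have "\<alpha> ` KV (ks @ [True]) = \<alpha> ` KV ks" using aK True x(2) by auto
    moreover have "?x \<le> \<nu> - 1"
    proof -
      have "?x \<le> card (?b ` ({..<\<nu>} - {m0}))" by (rule card_mono) (use m0(2) in auto)
      also have "\<dots> \<le> card ({..<\<nu>} - {m0})" by (rule card_image_le) simp
      finally show ?thesis using m0(1) by simp
    qed
    ultimately show ?thesis by (simp add: q nD_snoc)
  next
    case False
    \<comment> \<open>If the rank label or the coordinate label is new, no old edge carries the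
      combined label, and parity concerns the new factor alone.\<close>
    have okn: "okp (mcnt ?b J)" if "\<alpha> y \<notin> \<alpha> ` KV ks \<or> J \<notin> \<beta> ` IV ks" for J
      using tot[of "\<alpha> y" J] cnt_raw_0[of "\<alpha> y" \<alpha> ks J \<beta>] that False by simp
    have xw: "?x + wgt \<le> \<nu> - 1"
      by (rule new_classes_le[where ?m0.0 = m0]) (use m0 okn in auto)
    obtain \<alpha>' :: "vert \<Rightarrow> 'a" where a': "compat \<alpha>' \<beta> C" "valid \<alpha>' \<beta> ks"
      "card (\<alpha> ` KV (ks @ [True])) = Suc (card (\<alpha>' ` KV ks))" "0 < card (\<alpha>' ` KV ks)"
    proof (cases "\<alpha> y \<in> \<alpha> ` KV ks")
      case yn: False
      have "valid \<alpha> \<beta> ks"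
        unfolding valid_def
      proof (intro allI)
        fix A J show "okp (\<lambda>c. cnt \<alpha> \<beta> (raw ks) (c, A, J))"
        proof (cases "A = \<alpha> y")
          case True
          then show ?thesis using yn by (intro okp_even) (simp add: cnt_raw_0)
        next
          case ne: False
          show ?thesis
          proof (rule okp_cancel[OF tot])
            show "okp (\<lambda>c. (if \<alpha> x = A then mcnt ?b J c else 0) + (if \<alpha> y = A then mcnt ?b J c else 0))"
              using ne okn[of J] yn by (cases "\<alpha> x = A") (auto intro: okp_even)
          qed
        qed
      qed
      then show ?thesis using that[of \<alpha>] c yn pos by (simp add: aK)
    next
      case yo: True
      \<comment> \<open>The new factor has the same edges at both rank classes. In their union it
        contributes an even count, so it can be deleted without violating the parity
        condition.\<close>
      define \<alpha>' where "\<alpha>' z = (if \<alpha> z = \<alpha> y then \<alpha> x else \<alpha> z)" for z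
      have c': "compat \<alpha>' \<beta> C" using c by (fastforce simp: compat_def lab_def \<alpha>'_def)
      have cn': "cnt \<alpha>' \<beta> es (c, A, J) = (if A = \<alpha> y then 0 else
          cnt \<alpha> \<beta> es (c, A, J) + (if A = \<alpha> x then cnt \<alpha> \<beta> es (c, \<alpha> y, J) else 0))" for es c A J
        using False by (induction es) (auto simp: cnt_Cons lab_def \<alpha>'_def)
      have "valid \<alpha>' \<beta> ks"
        unfolding valid_def
      proof (intro allI)
        fix A J
        consider "A = \<alpha> y" | "A = \<alpha> x" "A \<noteq> \<alpha> y" | "A \<noteq> \<alpha> x" "A \<noteq> \<alpha> y" by blast
        then show "okp (\<lambda>c. cnt \<alpha>' \<beta> (raw ks) (c, A, J))"
        proof cases
          case 1
          then show ?thesis by (intro okp_even) (simp add: cn')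
        next
          case 2
          have eq: "(\<lambda>c. (a c + b c) + 2 * m c) = (\<lambda>c. a c + m c + (b c + m c))" for a b m :: "nat \<Rightarrow> nat"
            by auto
          have "okp (\<lambda>c. (cnt \<alpha> \<beta> (raw ks) (c, \<alpha> x, J) + cnt \<alpha> \<beta> (raw ks) (c, \<alpha> y, J)) + 2 * mcnt ?b J c)"
            unfolding eq using okp_add[OF tot[of "\<alpha> x" J] tot[of "\<alpha> y" J]] False by simp
          then have "okp (\<lambda>c. cnt \<alpha> \<beta> (raw ks) (c, \<alpha> x, J) + cnt \<alpha> \<beta> (raw ks) (c, \<alpha> y, J))"
            by (rule okp_cancel) (simp add: okp_even)
          then show ?thesis using 2 by (simp add: cn')
        next
          case 3
          then show ?thesis using tot[of A J] by (simp add: cn')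
        qed
      qed
      moreover have "\<alpha>' ` KV ks = \<alpha> ` KV ks - {\<alpha> y}"
        using x(2) False by (auto simp: \<alpha>'_def image_iff)
      then have "card (\<alpha> ` KV ks) = Suc (card (\<alpha>' ` KV ks))" "0 < card (\<alpha>' ` KV ks)"
        using yo x(2) False by (auto simp: card_gt_0_iff card_Suc_Diff1 simp del: card_Diff_insert)
      ultimately show ?thesis using that[of \<alpha>'] c' yo by (simp add: aK insert_absorb)
    qed
    from IH[OF a'(1,2)] have "?q + wgt * (card (\<alpha>' ` KV ks) - 1) \<le> 1 + (\<nu> - 1) * nD ks" .
    moreover obtain n where "card (\<alpha>' ` KV ks) = Suc n" using a'(4) by (cases "card (\<alpha>' ` KV ks)") auto
    ultimately show ?thesis using xw a'(3) by (simp add: q nD_snoc)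
  qed
qed

text \<open>The edges of fF all carry the same rank and coordinate label: an even number of them in
  the symmetric model, one of each colour in the asymmetric one. Removing fF therefore preserves
  \<open>okp\<close>, though not evenness.\<close>

lemma okp_single: "okp (\<lambda>c. card {m. m < \<nu> \<and> col m = c})"
proof (rule okpI)
  show "even (card {m. m < \<nu> \<and> col m = 0})" if sy using sy_even[OF that] by (simp add: col_sym[OF that])
next
  fix c c' assume *: "\<not> sy" "c < \<nu>" "c' < \<nu>"
  have "{m. m < \<nu> \<and> col m = c} = {c}" "{m. m < \<nu> \<and> col m = c'} = {c'}"
    using *(2,3) by (auto simp: col_asym[OF *(1)])
  then show "even (card {m. m < \<nu> \<and> col m = c} + card {m. m < \<nu> \<and> col m = c'})" by simp
qed

text \<open>The hypothesis \<open>valid\<close> replaces the existence of a complete pairing, which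
  would not be inherited by the diagram with its last factor removed.\<close>

lemma upper:
  fixes \<alpha> :: "vert \<Rightarrow> 'a" and \<beta> :: "vert \<Rightarrow> 'b"
  assumes "(ks, C, es) \<in> set (gens s)" "compat \<alpha> \<beta> C" "valid \<alpha> \<beta> ks"
  shows "card (\<beta> ` IV ks) + wgt * (card (\<alpha> ` KV ks) - 1) \<le> 1 + (\<nu> - 1) * nD ks"
  using assms
proof (induction s arbitrary: ks C es \<alpha>)
  case 0
  then consider "ks = [True]" | "ks = [False]" by auto
  then show ?case
  proof cases
    case 1
    let ?b = "\<lambda>m. \<beta> (0, m)"
    have I: "IV [True] = {0} \<times> {..<\<nu>}" and K: "KV [True] = {(0, 0), (0, 1)}"
      using vK_True[of 0] vI_True[of 0] by (auto simp: KV_def IV_def)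
    have bI: "\<beta> ` IV [True] = ?b ` {..<\<nu>}" by (auto simp: I)
    have "card (?b ` {..<\<nu>}) \<le> card {..<\<nu>}" by (rule card_image_le) simp
    then have le: "card (\<beta> ` IV [True]) \<le> \<nu>" by (simp add: bI)
    show ?thesis
    proof (cases "\<alpha> (0, 0) = \<alpha> (0, 1)")
      case True
      then show ?thesis using le nu_ge2 by (simp add: K 1 nD_def)
    next
      case False
      have ok: "okp (mcnt ?b J)" for J
      proof -
        have "okp (\<lambda>c. cnt \<alpha> \<beta> (fE 0 True) (c, \<alpha> (0, 1), J))"
          using 0(3) by (simp add: valid_def 1 raw_def)
        then show ?thesis using False by (simp add: cnt_fE_True)
      qed
      \<comment> \<open>There is no older factor here; the coordinate class of slot 0 serves as the
        old class.\<close>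
      have "card (?b ` {..<\<nu>} - {?b 0}) + wgt \<le> \<nu> - 1"
        by (rule new_classes_le[where ?m0.0 = 0]) (use nu_ge2 ok in auto)
      moreover have "card (?b ` {..<\<nu>}) = Suc (card (?b ` {..<\<nu>} - {?b 0}))"
        using nu_ge2 by (intro card.remove) auto
      ultimately have "card (\<beta> ` IV [True]) + wgt \<le> \<nu>" unfolding bI using nu_ge2 by linarith
      moreover have "card (\<alpha> ` KV [True]) = 2" using False by (simp add: K)
      ultimately show ?thesis using nu_ge2 unfolding 1 by (simp add: nD_def)
    qed
  next
    case 2
    have "KV [False] = {(0, 0)}" "IV [False] = {(0, 0)}"
      by (simp_all add: KV_def IV_def lessThan_Suc vK_False vI_False)
    then show ?thesis by (simp add: 2)
  qed
next
  case (Suc s)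
  then obtain ks0 C0 es0 k e r e' r' where g: "(ks0, C0, es0) \<in> set (gens s)"
    and p: "(e, r) \<in> set (picks (fE (length ks0) k))" "(e', r') \<in> set (picks es0)"
    and eq: "ks = ks0 @ [k]" "C = (e, e') # C0" "es = r @ r'"
    by (auto simp: ext_mem)
  have c0: "compat \<alpha> \<beta> C0" and l: "lab \<alpha> \<beta> e = lab \<alpha> \<beta> e'" using Suc.prems(2) by (auto simp: eq)
  have "wf_edge ks0 e'" using gens_wf[OF g] picks_set[OF p(2)] by (auto simp: wf_diag_def)
  then have old: "\<alpha> (eK e) \<in> \<alpha> ` KV ks0" "\<beta> (eI e) \<in> \<beta> ` IV ks0"
    using l by (auto simp: lab_def wf_edge_def)
  have new: "eK e \<in> vK (length ks0) k" "eI e \<in> vI (length ks0) k"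
    using picks_set[OF p(1)] fE_mem[of e] by auto
  show ?case
  proof (cases k)
    case True
    obtain m0 where "m0 < \<nu>" "eI e = (length ks0, m0)" using new(2) True by (auto simp: vI_True)
    then show ?thesis
      using upper_True[OF Suc.IH[OF g] c0, where x = "eK e" and ?m0.0 = m0] Suc.prems(3) new old True
      by (simp add: eq)
  next
    case False
    have e0: "eK e = (length ks0, 0)" "eI e = (length ks0, 0)" using new False by (auto simp: vK_False vI_False)
    have "valid \<alpha> \<beta> ks0"
      unfolding valid_def
    proof (intro allI)
      fix A J
      have "okp (\<lambda>c. cnt \<alpha> \<beta> (raw ks0) (c, A, J) + cnt \<alpha> \<beta> (fE (length ks0) False) (c, A, J))"
        using Suc.prems(3) False by (simp add: valid_def eq raw_snoc)
      moreover have "okp (\<lambda>c. cnt \<alpha> \<beta> (fE (length ks0) False) (c, A, J))"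
        unfolding cnt_fE_False using okp_single okp_even[of "\<lambda>_. 0"]
        by (cases "\<alpha> (length ks0, 0) = A \<and> \<beta> (length ks0, 0) = J") (simp_all only: if_True if_False dvd_0_right simp_thms)
      ultimately show "okp (\<lambda>c. cnt \<alpha> \<beta> (raw ks0) (c, A, J))" by (rule okp_cancel)
    qed
    \<comment> \<open>The only rank and coordinate vertices of fF are both identified with old ones
      by the contraction, so no class is added.\<close>
    moreover have "\<alpha> ` KV ks = \<alpha> ` KV ks0" "\<beta> ` IV ks = \<beta> ` IV ks0"
      using old e0 False by (auto simp: eq KV_snoc IV_snoc vK_False vI_False)
    ultimately show ?thesis using Suc.IH[OF g c0] False by (simp add: eq nD_snoc)
  qed
qed

text \<open>One rank vertex of each later factor is identified with an old one, so only f^2 can add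
  a rank class, and at most one.\<close>

lemma upper_n:
  assumes "(ks, C, es) \<in> set (gens s)" "compat \<alpha> \<beta> C"
  shows "card (\<alpha> ` KV ks) \<le> nD ks + 1"
  using assms
proof (induction s arbitrary: ks C es)
  case 0
  have "card (\<alpha> ` KV [k]) \<le> card (vK 0 k)" for k
    by (rule order_trans[OF card_image_le]) (auto simp: KV_def lessThan_Suc)
  then have "card (\<alpha> ` KV [k]) \<le> nD [k] + 1" for k
    by (rule order_trans) (cases k, auto simp: nD_def vK_True vK_False)
  moreover obtain k where "ks = [k]" using 0 by auto
  ultimately show ?case by blast
next
  case (Suc s)
  then obtain ks0 C0 es0 k e r e' r' where g: "(ks0, C0, es0) \<in> set (gens s)"
    and p: "(e, r) \<in> set (picks (fE (length ks0) k))" "(e', r') \<in> set (picks es0)"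
    and eq: "ks = ks0 @ [k]" "C = (e, e') # C0" "es = r @ r'"
    by (auto simp: ext_mem)
  have c0: "compat \<alpha> \<beta> C0" and l: "lab \<alpha> \<beta> e = lab \<alpha> \<beta> e'" using Suc.prems(2) by (auto simp: eq)
  have "wf_edge ks0 e'" using gens_wf[OF g] picks_set[OF p(2)] by (auto simp: wf_diag_def)
  then have old: "\<alpha> (eK e) \<in> \<alpha> ` KV ks0" using l by (auto simp: lab_def wf_edge_def)
  have new: "eK e \<in> vK (length ks0) k" using picks_set[OF p(1)] fE_mem[of e] by auto
  have "card (\<alpha> ` KV ks) \<le> card (\<alpha> ` KV ks0) + (if k then 1 else 0)"
  proof (cases k)
    case True
    then obtain y where "vK (length ks0) k = {eK e, y}"
    proof -
      from new True consider "eK e = (length ks0, 0)" | "eK e = (length ks0, 1)" by (auto simp: vK_True)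
      then show thesis
      proof cases
        case 1
        then show ?thesis using that[of "(length ks0, 1)"] True by (simp add: vK_True)
      next
        case 2
        then show ?thesis using that[of "(length ks0, 0)"] True by (simp add: vK_True insert_commute)
      qed
    qed
    then have "\<alpha> ` KV ks = insert (\<alpha> y) (\<alpha> ` KV ks0)" using old by (auto simp: eq KV_snoc)
    then show ?thesis using True by (simp add: card_insert_if)
  next
    case False
    then have "\<alpha> ` KV ks = \<alpha> ` KV ks0" using old new by (auto simp: eq KV_snoc vK_False)
    then show ?thesis using False by simp
  qed
  then show ?case using Suc.IH[OF g c0] by (simp add: eq nD_snoc split: if_splits)
qed

text \<open>In the asymmetric model every K-vertex has exactly one edge of colour 0.\<close>

lemma cnt_raw_K:
  assumes "\<not> sy"
  shows "cnt \<alpha> (\<lambda>_. ()) (raw ks) (0, A, ()) = card {x \<in> KV ks. \<alpha> x = A}"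
proof (induction ks rule: rev_induct)
  case Nil
  then show ?case by (simp add: KV_def)
next
  case (snoc k ks)
  have m1: "card {m. m < \<nu> \<and> m = 0} = 1"
  proof -
    have "{m. m < \<nu> \<and> m = 0} = {0}" using nu_ge2 by auto
    then show ?thesis by simp
  qed
  have "cnt \<alpha> (\<lambda>_. ()) (fE (length ks) k) (0, A, ()) = card {x \<in> vK (length ks) k. \<alpha> x = A}"
  proof (cases k)
    case True
    have filt: "{x \<in> {p, q}. \<alpha> x = A} = (if \<alpha> p = A then {p} else {}) \<union> (if \<alpha> q = A then {q} else {})" for p q
      by auto
    have "{x \<in> vK (length ks) True. \<alpha> x = A} =
       (if \<alpha> (length ks, 0) = A then {(length ks, 0)} else {}) \<union> (if \<alpha> (length ks, 1) = A then {(length ks, 1)} else {})"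
      unfolding vK_True by (rule filt)
    then show ?thesis using True m1 by (simp add: cnt_fE_True mcnt_def col_asym[OF assms])
  next
    case False
    have "{x \<in> vK (length ks) False. \<alpha> x = A} = (if \<alpha> (length ks, 0) = A then {(length ks, 0)} else {})"
      by (auto simp: vK_False)
    then show ?thesis using False m1 by (simp add: cnt_fE_False col_asym[OF assms])
  qed
  moreover have "{x \<in> KV (ks @ [k]). \<alpha> x = A} = {x \<in> vK (length ks) k. \<alpha> x = A} \<union> {x \<in> KV ks. \<alpha> x = A}"
    by (auto simp: KV_snoc)
  then have "card {x \<in> KV (ks @ [k]). \<alpha> x = A} = card {x \<in> vK (length ks) k. \<alpha> x = A} + card {x \<in> KV ks. \<alpha> x = A}"
    using vK_disj[of ks k] by (subst card_Un_disjoint[symmetric]) auto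
  ultimately show ?case using snoc by (simp add: raw_snoc)
qed

text \<open>The number of rank vertices is \<open>2 * s\<^sub>D + s\<^sub>R\<close>, so its parity
  is that of \<open>s\<^sub>R\<close>.\<close>

lemma card_KV: "card (KV ks) + nD ks = length ks + 2 * nD ks"
proof (induction ks rule: rev_induct)
  case (snoc k ks)
  have "card (KV (ks @ [k])) = card (vK (length ks) k) + card (KV ks)"
    unfolding KV_snoc by (rule card_Un_disjoint) (auto simp: vK_disj)
  then show ?case using snoc by (simp add: nD_snoc vK_True vK_False)
qed (simp add: KV_def nD_def)

text \<open>The source of both exclusions in the asymmetric model: evenness of the total rules out
  odd \<open>s\<^sub>R\<close>, and classes of size at least two rule out
  \<open>n = s + 2\<close>.\<close>

lemma card_KV_even_classes:
  assumes "\<And>A. even (card {x \<in> KV ks. \<alpha> x = A})"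
  shows "even (card (KV ks))" "2 * card (\<alpha> ` KV ks) \<le> card (KV ks)"
proof -
  have s: "card (KV ks) = (\<Sum>A\<in>\<alpha> ` KV ks. card {x \<in> KV ks. \<alpha> x = A})"
    using sum.image_gen[of "KV ks" "\<lambda>_. 1::nat" \<alpha>] by simp
  show "even (card (KV ks))" unfolding s using assms by (intro dvd_sum) simp
  have "2 \<le> card {x \<in> KV ks. \<alpha> x = A}" if "A \<in> \<alpha> ` KV ks" for A
  proof -
    have "{x \<in> KV ks. \<alpha> x = A} \<noteq> {}" using that by auto
    then have "card {x \<in> KV ks. \<alpha> x = A} \<noteq> 0" by simp
    then show ?thesis using assms[of A] by presburger
  qed
  then have "(\<Sum>A\<in>\<alpha> ` KV ks. 2) \<le> (\<Sum>A\<in>\<alpha> ` KV ks. card {x \<in> KV ks. \<alpha> x = A})" by (rule sum_mono)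
  then show "2 * card (\<alpha> ` KV ks) \<le> card (KV ks)" using s by simp
qed

text \<open>Every copy of f brings \<nu> edges and every contraction uses up two. The open edges
  give the power of \<sigma>.\<close>

lemma gens_edges: "(ks, C, es) \<in> set (gens s) \<Longrightarrow> length es + 2 * s = \<nu> * (nD ks + Suc s)"
proof (induction s arbitrary: ks C es)
  case 0
  then show ?case by (auto simp: fE_def nD_def)
next
  case (Suc s)
  then obtain ks0 C0 es0 k e r e' r' where g: "(ks0, C0, es0) \<in> set (gens s)"
    and p: "(e, r) \<in> set (picks (fE (length ks0) k))" "(e', r') \<in> set (picks es0)"
    and eq: "ks = ks0 @ [k]" "C = (e, e') # C0" "es = r @ r'"
    by (auto simp: ext_mem)
  have "Suc (length r) = length (fE (length ks0) k)" "Suc (length r') = length es0"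
    using p picks_mset by (metis size_add_mset size_mset)+
  moreover have "length (fE (length ks0) k) = \<nu> * (1 + (if k then 1 else 0))" by (simp add: fE_def)
  ultimately show ?case using Suc.IH[OF g] by (auto simp: eq nD_snoc algebra_simps)
qed

section \<open>Bounds for complete pairings\<close>

definition nK :: "bool list \<Rightarrow> (edge \<times> edge) list \<Rightarrow> nat" where "nK ks C = card (cls (RK C) ` KV ks)"
definition nI :: "bool list \<Rightarrow> (edge \<times> edge) list \<Rightarrow> nat" where "nI ks C = card (cls (RI C) ` IV ks)"

lemma full_mem: "(ks, N, C') \<in> set (full s) \<longleftrightarrow>
   (\<exists>C es. (ks, C, es) \<in> set (gens s) \<and> N = length es \<and> C' \<in> set (wick es C))"
  by (simp add: full_def image_iff Bex_def) blast

lemma full_bounds: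
  assumes "(ks, N, C) \<in> set (full s)"
  shows "length ks = Suc s" "nD ks \<le> Suc s" "N + 2 * s = \<nu> * (nD ks + Suc s)" "even N"
    "1 \<le> nK ks C" "nK ks C \<le> nD ks + 1"
    "nI ks C + wgt * (nK ks C - 1) \<le> 1 + (\<nu> - 1) * nD ks"
    "\<not> sy \<Longrightarrow> even (Suc s - nD ks)" "\<not> sy \<Longrightarrow> nD ks = Suc s \<Longrightarrow> nK ks C \<le> nD ks"
    "real (card (Asg H p ks C)) = real H ^ nK ks C * real p ^ nI ks C"
proof -
  obtain C0 es where g: "(ks, C0, es) \<in> set (gens s)" and N: "N = length es" and w: "C \<in> set (wick es C0)"
    using assms unfolding full_mem by blast
  let ?a = "cls (RK C)" and ?b = "cls (RI C)"
  have wf: "wf_diag (ks, C, [])" by (rule wick_wf[OF w gens_wf[OF g]])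
  have c: "compat ?a ?b C" by (rule compat_cls_diag[OF wf])
  then have c0: "compat ?a ?b C0" using wick_set[OF w] compat_mono by blast
  show len: "length ks = Suc s" by (rule gens_length[OF g])
  show D: "nD ks \<le> Suc s" using len by (metis nD_def length_filter_le)
  show "N + 2 * s = \<nu> * (nD ks + Suc s)" using gens_edges[OF g] N by simp
  show "even N" using wick_even[OF w] N by simp
  have "(0, 0) \<in> KV ks" using len by (cases ks) (auto simp: KV_def vK_def intro!: bexI[of _ 0])
  then show "1 \<le> nK ks C" by (auto simp: nK_def Suc_le_eq card_gt_0_iff)
  show "nK ks C \<le> nD ks + 1" unfolding nK_def by (rule upper_n[OF g c0])
  have ev: "even (cnt \<alpha> \<beta> (raw ks) t)" if "compat \<alpha> \<beta> C" for \<alpha> :: "vert \<Rightarrow> 'x" and \<beta> :: "vert \<Rightarrow> 'y" and t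
    using wick_parity[OF w that] gens_parity[OF g compat_mono[OF wick_set[OF w] that]] by simp
  have "valid ?a ?b ks" unfolding valid_def using ev[OF c] by (auto intro: okp_even)
  from upper[OF g c0 this] show "nI ks C + wgt * (nK ks C - 1) \<le> 1 + (\<nu> - 1) * nD ks"
    by (simp add: nK_def nI_def)
  show "real (card (Asg H p ks C)) = real H ^ nK ks C * real p ^ nI ks C"
    by (simp add: card_Asg[OF wf] nK_def nI_def)
  \<comment> \<open>Forgetting the coordinate labels turns the parity of edge labels into the parity
    of the size of a rank class.\<close>
  have "compat ?a (\<lambda>_. ()) C" using c by (auto simp: compat_def lab_def)
  from ev[OF this] have "even (card {x \<in> KV ks. ?a x = A})" if "\<not> sy" for A
    using cnt_raw_K[OF that, of ?a ks A] by metis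
  note k = card_KV_even_classes[OF this]
  show "\<not> sy \<Longrightarrow> even (Suc s - nD ks)"
    using k(1) card_KV[of ks] len D by presburger
  show "\<not> sy \<Longrightarrow> nD ks = Suc s \<Longrightarrow> nK ks C \<le> nD ks"
    using k(2) card_KV[of ks] len unfolding nK_def by simp
qed

section \<open>Extremal diagrams\<close>

definition upd :: "nat \<Rightarrow> (nat \<Rightarrow> vert) \<Rightarrow> (vert \<Rightarrow> vert) \<Rightarrow> vert \<Rightarrow> vert" where
  "upd j f \<alpha> x = (if fst x = j then f (snd x) else \<alpha> x)"

text \<open>Labels are themselves vertices, so that every new factor supplies fresh labels.\<close>

definition state :: "nat \<Rightarrow> bool list \<Rightarrow> edge list \<Rightarrow> (vert \<Rightarrow> vert) \<Rightarrow> (vert \<Rightarrow> vert) \<Rightarrow> bool" where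
  "state s ks es \<alpha> \<beta> \<longleftrightarrow> (\<exists>C. (ks, C, es) \<in> set (gens s) \<and> compat \<alpha> \<beta> C) \<and>
     (\<forall>x\<in>KV ks. fst (\<alpha> x) < length ks) \<and> (\<forall>x\<in>IV ks. fst (\<beta> x) < length ks)"

lemma state_wf: "state s ks es \<alpha> \<beta> \<Longrightarrow> e \<in> set es \<Longrightarrow> wf_edge ks e"
  using gens_wf by (fastforce simp: state_def wf_diag_def)

text \<open>Since \<nu> is at least 2, a step never uses up more edges than it brings, so there is
  always an edge to which the next factor can be attached.\<close>

lemma state_edge:
  assumes "state s ks es \<alpha> \<beta>" shows "\<exists>e. e \<in> set es"
proof -
  obtain C where "(ks, C, es) \<in> set (gens s)" using assms by (auto simp: state_def)
  from gens_edges[OF this] have "length es + 2 * s = \<nu> * (nD ks + Suc s)" .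
  moreover have "2 * Suc s \<le> \<nu> * (nD ks + Suc s)" using nu_ge2 by (intro mult_le_mono) auto
  ultimately have "es \<noteq> []" by auto
  then show ?thesis by (cases es) auto
qed

lemma state_fresh:
  assumes "state s ks es \<alpha> \<beta>"
  shows "(length ks, i) \<notin> \<alpha> ` KV ks" "(length ks, i) \<notin> \<beta> ` IV ks"
proof -
  have "\<forall>x\<in>KV ks. fst (\<alpha> x) < length ks" "\<forall>x\<in>IV ks. fst (\<beta> x) < length ks"
    using assms unfolding state_def by blast+
  then show "(length ks, i) \<notin> \<alpha> ` KV ks" "(length ks, i) \<notin> \<beta> ` IV ks"
    by (metis fst_conv imageE less_irrefl)+
qed

lemma lab_upd: "wf_edge ks e \<Longrightarrow> lab (upd (length ks) f \<alpha>) (upd (length ks) h \<beta>) e = lab \<alpha> \<beta> e"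
  using KV_fst[of "eK e" ks] IV_fst[of "eI e" ks] by (auto simp: lab_def upd_def wf_edge_def)

lemma upd_KV: "upd (length ks) f \<alpha> ` KV (ks @ [k]) = f ` {..<(if k then 2 else 1)} \<union> \<alpha> ` KV ks"
proof -
  have "upd (length ks) f \<alpha> ` KV ks = \<alpha> ` KV ks"
    by (intro image_cong refl) (auto simp: upd_def dest: KV_fst)
  moreover have "upd (length ks) f \<alpha> ` vK (length ks) k = f ` {..<(if k then 2 else 1)}"
  proof -
    have "vK (length ks) k = Pair (length ks) ` {..<(if k then 2 else 1)}" unfolding vK_def by blast
    then show ?thesis by (simp only: image_image upd_def fst_conv snd_conv simp_thms if_True)
  qed
  ultimately show ?thesis by (simp add: KV_snoc image_Un)
qed

lemma upd_IV: "upd (length ks) f \<beta> ` IV (ks @ [k]) = f ` {..<(if k then \<nu> else 1)} \<union> \<beta> ` IV ks"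
proof -
  have "upd (length ks) f \<beta> ` IV ks = \<beta> ` IV ks"
    by (intro image_cong refl) (auto simp: upd_def dest: IV_fst)
  moreover have "upd (length ks) f \<beta> ` vI (length ks) k = f ` {..<(if k then \<nu> else 1)}"
  proof -
    have "vI (length ks) k = Pair (length ks) ` {..<(if k then \<nu> else 1)}" unfolding vI_def by blast
    then show ?thesis by (simp only: image_image upd_def fst_conv snd_conv simp_thms if_True)
  qed
  ultimately show ?thesis by (simp add: IV_snoc image_Un)
qed

text \<open>The two contracted edges have the same label, so parities change as if the whole edge
  list of the new factor were added. The last conclusion keeps the remaining edges of the new factor
  available for later attachments.\<close>

lemma state_ext:
  assumes st: "state s ks es \<alpha> \<beta>" and e: "e \<in> set (fE (length ks) k)" and e': "e' \<in> set es"
    and l: "lab (upd (length ks) f \<alpha>) (upd (length ks) h \<beta>) e = lab \<alpha> \<beta> e'"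
    and f: "\<And>t. t < (if k then 2 else 1) \<Longrightarrow> fst (f t) \<le> length ks"
    and h: "\<And>m. m < (if k then \<nu> else 1) \<Longrightarrow> fst (h m) \<le> length ks"
  obtains es' where
    "state (Suc s) (ks @ [k]) es' (upd (length ks) f \<alpha>) (upd (length ks) h \<beta>)"
    "\<And>t. even (cnt (upd (length ks) f \<alpha>) (upd (length ks) h \<beta>) es' t) \<longleftrightarrow>
       even (cnt \<alpha> \<beta> es t + cnt (upd (length ks) f \<alpha>) (upd (length ks) h \<beta>) (fE (length ks) k) t)"
    "set (fE (length ks) k) - {e} \<subseteq> set es'"
proof -
  let ?a = "upd (length ks) f \<alpha>" and ?b = "upd (length ks) h \<beta>"
  obtain C where g: "(ks, C, es) \<in> set (gens s)" and c: "compat \<alpha> \<beta> C"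
    and bd: "\<forall>x\<in>KV ks. fst (\<alpha> x) < length ks" "\<forall>x\<in>IV ks. fst (\<beta> x) < length ks"
    using st by (auto simp: state_def)
  obtain r r' where r: "(e, r) \<in> set (picks (fE (length ks) k))" and r': "(e', r') \<in> set (picks es)"
    using picks_ex[OF e] picks_ex[OF e'] by auto
  have wf: "wf_edge ks x" if "x \<in> set es" for x by (rule state_wf[OF st that])
  have l': "lab ?a ?b e = lab ?a ?b e'" using l lab_upd[OF wf[OF e']] by simp
  then have col: "ecol e = ecol e'" by (simp add: lab_def)
  have cnt_es: "cnt ?a ?b es t = cnt \<alpha> \<beta> es t" for t
    by (rule cnt_cong) (rule lab_upd[OF wf])
  have "compat ?a ?b C"
    unfolding compat_def
  proof (intro ballI, clarify)
    fix x y assume xy: "(x, y) \<in> set C"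
    then have "wf_edge ks x" "wf_edge ks y" using gens_wf[OF g] by (auto simp: wf_diag_def)
    moreover have "lab \<alpha> \<beta> x = lab \<alpha> \<beta> y" using c xy by (auto simp: compat_def)
    ultimately show "lab ?a ?b x = lab ?a ?b y" by (simp add: lab_upd)
  qed
  then have "compat ?a ?b ((e, e') # C)" using l' by simp
  moreover have "(ks @ [k], (e, e') # C, r @ r') \<in> set (gens (Suc s))"
    using g r r' col by (force simp: ext_mem)
  moreover have "fst (?a x) < length (ks @ [k])" if "x \<in> KV (ks @ [k])" for x
  proof -
    have "?a x \<in> f ` {..<(if k then 2 else 1)} \<union> \<alpha> ` KV ks" using that upd_KV[of ks f \<alpha> k] by blast
    then show ?thesis
    proof
      assume "?a x \<in> f ` {..<(if k then 2 else 1)}"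
      then obtain t where "t < (if k then 2 else 1)" "?a x = f t" by blast
      then show ?thesis using f[of t] by simp
    next
      assume "?a x \<in> \<alpha> ` KV ks"
      then obtain y where "y \<in> KV ks" "?a x = \<alpha> y" by blast
      then show ?thesis using bd(1) by (simp add: less_Suc_eq)
    qed
  qed
  moreover have "fst (?b x) < length (ks @ [k])" if "x \<in> IV (ks @ [k])" for x
  proof -
    have "?b x \<in> h ` {..<(if k then \<nu> else 1)} \<union> \<beta> ` IV ks" using that upd_IV[of ks h \<beta> k] by blast
    then show ?thesis
    proof
      assume "?b x \<in> h ` {..<(if k then \<nu> else 1)}"
      then obtain t where "t < (if k then \<nu> else 1)" "?b x = h t" by blast
      then show ?thesis using h[of t] by simp
    next
      assume "?b x \<in> \<beta> ` IV ks"
      then obtain y where "y \<in> IV ks" "?b x = \<beta> y" by blast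
      then show ?thesis using bd(2) by (simp add: less_Suc_eq)
    qed
  qed
  ultimately have "state (Suc s) (ks @ [k]) (r @ r') ?a ?b" unfolding state_def by blast
  moreover have "even (cnt ?a ?b (r @ r') t) \<longleftrightarrow> even (cnt \<alpha> \<beta> es t + cnt ?a ?b (fE (length ks) k) t)" for t
    using cnt_picks[OF r, of ?a ?b t] cnt_picks[OF r', of ?a ?b t] cnt_es[of t] l' by auto
  moreover have "set (fE (length ks) k) - {e} \<subseteq> set (r @ r')" using picks_set[OF r] by auto
  ultimately show ?thesis by (rule that)
qed

text \<open>Only lower bounds for the numbers of labels are required: the pairing obtained from the
  parity criterion may have more classes than the labelling has labels.\<close>

definition closed_diag :: "nat \<Rightarrow> nat \<Rightarrow> nat \<Rightarrow> nat \<Rightarrow> bool" where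
  "closed_diag s D n q \<longleftrightarrow> (\<exists>ks es \<alpha> \<beta>. state s ks es \<alpha> \<beta> \<and> nD ks = D \<and> (\<forall>t. even (cnt \<alpha> \<beta> es t)) \<and>
     n \<le> card (\<alpha> ` KV ks) \<and> q \<le> card (\<beta> ` IV ks))"

lemma closedI:
  assumes "state s ks es \<alpha> \<beta>" "nD ks = D" "\<And>t. even (cnt \<alpha> \<beta> es t)"
    "n \<le> card (\<alpha> ` KV ks)" "q \<le> card (\<beta> ` IV ks)"
  shows "closed_diag s D n q"
  unfolding closed_diag_def using assms by blast

lemma closed_diag_full:
  assumes "closed_diag s D n q"
  shows "\<exists>(ks, N, C)\<in>set (full s). nD ks = D \<and> n \<le> nK ks C \<and> q \<le> nI ks C"
proof -
  obtain ks es \<alpha> \<beta> where st: "state s ks es \<alpha> \<beta>" and D: "nD ks = D" and ev: "\<And>t. even (cnt \<alpha> \<beta> es t)"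
    and n: "n \<le> card (\<alpha> ` KV ks)" and q: "q \<le> card (\<beta> ` IV ks)"
    using assms unfolding closed_diag_def by blast
  obtain C where g: "(ks, C, es) \<in> set (gens s)" and c: "compat \<alpha> \<beta> C" using st by (auto simp: state_def)
  obtain C' where C': "C' \<in> set (wick es C)" and c': "compat \<alpha> \<beta> C'" using wick_ex[OF ev c] by auto
  have "\<alpha> x = \<alpha> y" if "(x, y) \<in> RK C'" for x y
    using c' that by (fastforce simp: compat_def RK_def lab_def)
  then have "card (\<alpha> ` KV ks) \<le> nK ks C'" unfolding nK_def by (rule card_label_le[OF finite_KV])
  moreover have "\<beta> x = \<beta> y" if "(x, y) \<in> RI C'" for x y
    using c' that by (fastforce simp: compat_def RI_def lab_def)
  then have "card (\<beta> ` IV ks) \<le> nI ks C'" unfolding nI_def by (rule card_label_le[OF finite_IV])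
  moreover have "(ks, length es, C') \<in> set (full s)" using g C' full_mem by blast
  ultimately show ?thesis using n q D by force
qed

section \<open>Inserting factors into a closed diagram\<close>

lemma edge_col:
  assumes "wf_edge ks e" obtains m where "m < \<nu>" "ecol e = col m"
  using assms by (auto simp: wf_edge_def)

lemma state_label:
  assumes "state s ks es \<alpha> \<beta>" "e \<in> set es"
  shows "\<alpha> (eK e) \<in> \<alpha> ` KV ks" "\<beta> (eI e) \<in> \<beta> ` IV ks" "fst (\<alpha> (eK e)) < length ks" "fst (\<beta> (eI e)) < length ks"
  using state_wf[OF assms] assms(1) by (auto simp: wf_edge_def state_def)

text \<open>Both rank slots of the new f^2 receive the old rank label, so each of its edge labels
  occurs twice and the \<nu> - 1 coordinates away from the contraction may be fresh.\<close>

lemma closed_add_D: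
  assumes "closed_diag s D n q"
  shows "closed_diag (Suc s) (Suc D) n (q + (\<nu> - 1))"
proof -
  obtain ks es \<alpha> \<beta> where st: "state s ks es \<alpha> \<beta>" and D: "nD ks = D" and ev: "\<And>t. even (cnt \<alpha> \<beta> es t)"
    and n: "n \<le> card (\<alpha> ` KV ks)" and q: "q \<le> card (\<beta> ` IV ks)"
    using assms unfolding closed_diag_def by blast
  obtain e' where e': "e' \<in> set es" using state_edge[OF st] by auto
  note lb = state_label[OF st e']
  obtain m where m: "m < \<nu>" "ecol e' = col m" using edge_col[OF state_wf[OF st e']] .
  let ?j = "length ks"
  let ?f = "\<lambda>_::nat. \<alpha> (eK e')" and ?h = "\<lambda>i. if i = m then \<beta> (eI e') else (?j, i)"
  let ?a = "upd ?j ?f \<alpha>" and ?b = "upd ?j ?h \<beta>"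
  have e: "Edge (col m) (?j, 0) (?j, m) \<in> set (fE ?j True)" using m(1) by (auto simp: fE_def)
  obtain es' where es': "state (Suc s) (ks @ [True]) es' ?a ?b"
    and par: "\<And>t. even (cnt ?a ?b es' t) \<longleftrightarrow> even (cnt \<alpha> \<beta> es t + cnt ?a ?b (fE ?j True) t)"
    by (rule state_ext[OF st e e', of ?f ?h]) (use m lb in \<open>auto simp: lab_def upd_def\<close>)
  have "even (cnt ?a ?b es' t)" for t
    unfolding par using ev by (cases t) (auto simp: cnt_fE_True upd_def)
  moreover have "\<alpha> ` KV ks \<subseteq> ?a ` KV (ks @ [True])" unfolding upd_KV by auto
  then have "card (\<alpha> ` KV ks) \<le> card (?a ` KV (ks @ [True]))" by (intro card_mono) auto
  moreover have "card (\<beta> ` IV ks) + (\<nu> - 1) \<le> card (?b ` IV (ks @ [True]))"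
  proof -
    have "Pair ?j ` ({..<\<nu>} - {m}) \<inter> \<beta> ` IV ks = {}" using state_fresh(2)[OF st] by blast
    then have 1: "card (Pair ?j ` ({..<\<nu>} - {m}) \<union> \<beta> ` IV ks) = card (\<beta> ` IV ks) + (\<nu> - 1)"
      using m(1) by (subst card_Un_disjoint) (auto simp: card_image inj_on_def)
    have "card (Pair ?j ` ({..<\<nu>} - {m}) \<union> \<beta> ` IV ks) \<le> card (?b ` IV (ks @ [True]))"
      unfolding upd_IV by (intro card_mono) auto
    then show ?thesis unfolding 1 .
  qed
  ultimately show ?thesis
    using n q D by (intro closedI[OF es']) (simp_all add: nD_snoc)
qed

lemma card_div2: fixes h :: nat shows "card {m. m < 2 * h \<and> g (m div 2) = J} = 2 * card {i. i < h \<and> g i = J}"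
proof (induction h)
  case (Suc h)
  have "{m. m < 2 * Suc h \<and> g (m div 2) = J} = {m. m < 2 * h \<and> g (m div 2) = J} \<union> (if g h = J then {2 * h, 2 * h + 1} else {})"
    by (auto simp: less_Suc_eq)
  moreover have "{i. i < Suc h \<and> g i = J} = {i. i < h \<and> g i = J} \<union> (if g h = J then {h} else {})"
    by (auto simp: less_Suc_eq)
  ultimately show ?case using Suc by (simp add: card_insert_if)
qed simp

lemma mcnt_div2: "sy \<Longrightarrow> even (mcnt (\<lambda>m. g (m div 2)) J c)"
proof -
  assume sy
  obtain h where h: "\<nu> = 2 * h" using sy_even[OF \<open>sy\<close>] by (elim evenE)
  have "{m. m < \<nu> \<and> col m = c \<and> g (m div 2) = J} = (if c = 0 then {m. m < 2 * h \<and> g (m div 2) = J} else {})"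
    unfolding h by (auto simp: col_sym[OF \<open>sy\<close>])
  then show ?thesis by (simp add: mcnt_def card_div2)
qed

text \<open>The second rank slot is fresh, and evenness at each rank label is achieved by
  identifying coordinates \<open>2 * i\<close> and \<open>2 * i + 1\<close>. The first pair carries
  the old coordinate, which leaves \<nu>/2 - 1 fresh ones.\<close>

lemma closed_add_D_sym:
  assumes sy and "closed_diag s D n q"
  shows "closed_diag (Suc s) (Suc D) (Suc n) (q + (\<nu> div 2 - 1))"
proof -
  obtain ks es \<alpha> \<beta> where st: "state s ks es \<alpha> \<beta>" and D: "nD ks = D" and ev: "\<And>t. even (cnt \<alpha> \<beta> es t)"
    and n: "n \<le> card (\<alpha> ` KV ks)" and q: "q \<le> card (\<beta> ` IV ks)"
    using assms unfolding closed_diag_def by blast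
  obtain e' where e': "e' \<in> set es" using state_edge[OF st] by auto
  note lb = state_label[OF st e']
  obtain m where m: "m < \<nu>" "ecol e' = col m" using edge_col[OF state_wf[OF st e']] .
  let ?j = "length ks"
  let ?g = "\<lambda>i. if i = 0 then \<beta> (eI e') else (?j, i)"
  let ?f = "\<lambda>t::nat. if t = 0 then \<alpha> (eK e') else (?j, 1)" and ?h = "\<lambda>i. ?g (i div 2)"
  let ?a = "upd ?j ?f \<alpha>" and ?b = "upd ?j ?h \<beta>"
  have e: "Edge (col 0) (?j, 0) (?j, 0) \<in> set (fE ?j True)" using nu_ge2 by (auto simp: fE_def)
  obtain es' where es': "state (Suc s) (ks @ [True]) es' ?a ?b"
    and par: "\<And>t. even (cnt ?a ?b es' t) \<longleftrightarrow> even (cnt \<alpha> \<beta> es t + cnt ?a ?b (fE ?j True) t)"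
    by (rule state_ext[OF st e e', of ?f ?h])
       (use m lb in \<open>auto simp: lab_def upd_def col_sym[OF assms(1)]\<close>)
  have b: "(\<lambda>m. ?b (?j, m)) = (\<lambda>m. ?g (m div 2))" by (simp add: upd_def fun_eq_iff)
  have "even (cnt ?a ?b es' t)" for t
    unfolding par using ev mcnt_div2[OF assms(1), of ?g] by (cases t) (simp add: cnt_fE_True b)
  moreover have "Suc (card (\<alpha> ` KV ks)) \<le> card (?a ` KV (ks @ [True]))"
  proof -
    have "(?j, 1) \<notin> \<alpha> ` KV ks" by (rule state_fresh(1)[OF st])
    then have "Suc (card (\<alpha> ` KV ks)) = card (insert (?j, 1) (\<alpha> ` KV ks))" by simp
    also have "\<dots> \<le> card (?a ` KV (ks @ [True]))" unfolding upd_KV by (intro card_mono) (auto intro: image_eqI[of _ _ 1])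
    finally show ?thesis .
  qed
  moreover have "card (\<beta> ` IV ks) + (\<nu> div 2 - 1) \<le> card (?b ` IV (ks @ [True]))"
  proof -
    have "Pair ?j ` {1..<\<nu> div 2} \<inter> \<beta> ` IV ks = {}" using state_fresh(2)[OF st] by blast
    then have 1: "card (Pair ?j ` {1..<\<nu> div 2} \<union> \<beta> ` IV ks) = card (\<beta> ` IV ks) + (\<nu> div 2 - 1)"
      by (subst card_Un_disjoint) (auto simp: card_image inj_on_def)
    have "Pair ?j ` {1..<\<nu> div 2} \<subseteq> ?h ` {..<\<nu>}"
    proof
      fix z assume "z \<in> Pair ?j ` {1..<\<nu> div 2}"
      then obtain i where "z = (?j, i)" "1 \<le> i" "i < \<nu> div 2" by auto
      then show "z \<in> ?h ` {..<\<nu>}" by (intro image_eqI[of _ _ "2 * i"]) auto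
    qed
    then have "card (Pair ?j ` {1..<\<nu> div 2} \<union> \<beta> ` IV ks) \<le> card (?b ` IV (ks @ [True]))"
      unfolding upd_IV by (intro card_mono) auto
    then show ?thesis unfolding 1 .
  qed
  ultimately show ?thesis
    using n q D by (intro closedI[OF es']) (simp_all add: nD_snoc)
qed

text \<open>Attaching fF creates no label and flips the parity of one place in all colours. In the
  asymmetric model \<open>e2\<close> is an open edge at the same place, where a second fF can be
  attached.\<close>

lemma state_add_R:
  assumes st: "state s ks es \<alpha> \<beta>" and e': "e' \<in> set es"
  obtains es' \<alpha>' \<beta>' e2 where "state (Suc s) (ks @ [False]) es' \<alpha>' \<beta>'"
    "\<And>c A J. even (cnt \<alpha>' \<beta>' es' (c, A, J)) \<longleftrightarrow> even (cnt \<alpha> \<beta> es (c, A, J) +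
       (if A = \<alpha> (eK e') \<and> J = \<beta> (eI e') then card {m. m < \<nu> \<and> col m = c} else 0))"
    "\<alpha>' ` KV (ks @ [False]) = \<alpha> ` KV ks" "\<beta>' ` IV (ks @ [False]) = \<beta> ` IV ks"
    "\<not> sy \<Longrightarrow> e2 \<in> set es'" "\<alpha>' (eK e2) = \<alpha> (eK e')" "\<beta>' (eI e2) = \<beta> (eI e')"
proof -
  note lb = state_label[OF st e']
  obtain m where m: "m < \<nu>" "ecol e' = col m" using edge_col[OF state_wf[OF st e']] .
  let ?j = "length ks"
  let ?f = "\<lambda>_::nat. \<alpha> (eK e')" and ?h = "\<lambda>_::nat. \<beta> (eI e')"
  let ?a = "upd ?j ?f \<alpha>" and ?b = "upd ?j ?h \<beta>"
  \<comment> \<open>Some mode other than the contracted one; it exists as \<nu> is at least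
    2.\<close>
  let ?m = "if m = 0 then 1 else 0"
  have e: "Edge (col m) (?j, 0) (?j, 0) \<in> set (fE ?j False)" using m(1) by (auto simp: fE_def)
  obtain es' where es': "state (Suc s) (ks @ [False]) es' ?a ?b"
    and par: "\<And>t. even (cnt ?a ?b es' t) \<longleftrightarrow> even (cnt \<alpha> \<beta> es t + cnt ?a ?b (fE ?j False) t)"
    and sub: "set (fE ?j False) - {Edge (col m) (?j, 0) (?j, 0)} \<subseteq> set es'"
    by (rule state_ext[OF st e e', of ?f ?h]) (use m lb in \<open>auto simp: lab_def upd_def\<close>)
  show ?thesis
  proof (rule that[OF es', of "Edge (col ?m) (?j, 0) (?j, 0)"])
    show "even (cnt ?a ?b es' (c, A, J)) \<longleftrightarrow> even (cnt \<alpha> \<beta> es (c, A, J) +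
       (if A = \<alpha> (eK e') \<and> J = \<beta> (eI e') then card {m. m < \<nu> \<and> col m = c} else 0))" for c A J
      unfolding par cnt_fE_False by (auto simp: upd_def)
    show "?a ` KV (ks @ [False]) = \<alpha> ` KV ks" "?b ` IV (ks @ [False]) = \<beta> ` IV ks"
      unfolding upd_KV upd_IV using lb by auto
    show "Edge (col ?m) (?j, 0) (?j, 0) \<in> set es'" if "\<not> sy"
    proof -
      have "col ?m \<noteq> col m" unfolding col_asym[OF that] by simp
      moreover have "Edge (col ?m) (?j, 0) (?j, 0) \<in> set (fE ?j False)" using nu_ge2 by (auto simp: fE_def)
      ultimately show ?thesis using sub by blast
    qed
  qed (simp_all add: upd_def)
qed

lemma closed_add_R_sym:
  assumes sy and "closed_diag s D n q"
  shows "closed_diag (Suc s) D n q"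
proof -
  obtain ks es \<alpha> \<beta> where st: "state s ks es \<alpha> \<beta>" and D: "nD ks = D" and ev: "\<And>t. even (cnt \<alpha> \<beta> es t)"
    and n: "n \<le> card (\<alpha> ` KV ks)" and q: "q \<le> card (\<beta> ` IV ks)"
    using assms unfolding closed_diag_def by blast
  obtain e' where e': "e' \<in> set es" using state_edge[OF st] by auto
  obtain es' \<alpha>' \<beta>' where es': "state (Suc s) (ks @ [False]) es' \<alpha>' \<beta>'"
    and par: "\<And>c A J. even (cnt \<alpha>' \<beta>' es' (c, A, J)) \<longleftrightarrow> even (cnt \<alpha> \<beta> es (c, A, J) +
       (if A = \<alpha> (eK e') \<and> J = \<beta> (eI e') then card {m. m < \<nu> \<and> col m = c} else 0))"
    and im: "\<alpha>' ` KV (ks @ [False]) = \<alpha> ` KV ks" "\<beta>' ` IV (ks @ [False]) = \<beta> ` IV ks"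
    by (rule state_add_R[OF st e']) (rule that, assumption+)
  have "{m. m < \<nu> \<and> col m = c} = (if c = 0 then {..<\<nu>} else {})" for c
    unfolding col_sym[OF assms(1)] by auto
  then have "even (card {m. m < \<nu> \<and> col m = c})" for c
    using sy_even[OF assms(1)] by simp
  then have "even (cnt \<alpha>' \<beta>' es' t)" for t
    using ev by (cases t) (simp add: par)
  then show ?thesis
    using n q D im by (intro closedI[OF es']) (simp_all add: nD_snoc)
qed

text \<open>A single fF leaves an odd edge of every colour; a second one with the same labels
  cancels them.\<close>

lemma closed_add_RR:
  assumes "\<not> sy" "closed_diag s D n q"
  shows "closed_diag (s + 2) D n q"
proof -
  obtain ks es \<alpha> \<beta> where st: "state s ks es \<alpha> \<beta>" and D: "nD ks = D" and ev: "\<And>t. even (cnt \<alpha> \<beta> es t)"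
    and n: "n \<le> card (\<alpha> ` KV ks)" and q: "q \<le> card (\<beta> ` IV ks)"
    using assms unfolding closed_diag_def by blast
  obtain e' where e': "e' \<in> set es" using state_edge[OF st] by auto
  obtain es1 \<alpha>1 \<beta>1 e2 where st1: "state (Suc s) (ks @ [False]) es1 \<alpha>1 \<beta>1"
    and par1: "\<And>c A J. even (cnt \<alpha>1 \<beta>1 es1 (c, A, J)) \<longleftrightarrow> even (cnt \<alpha> \<beta> es (c, A, J) +
       (if A = \<alpha> (eK e') \<and> J = \<beta> (eI e') then card {m. m < \<nu> \<and> col m = c} else 0))"
    and im1: "\<alpha>1 ` KV (ks @ [False]) = \<alpha> ` KV ks" "\<beta>1 ` IV (ks @ [False]) = \<beta> ` IV ks"
    and e2: "\<not> sy \<Longrightarrow> e2 \<in> set es1" "\<alpha>1 (eK e2) = \<alpha> (eK e')" "\<beta>1 (eI e2) = \<beta> (eI e')"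
    by (rule state_add_R[OF st e']) (rule that, assumption+)
  obtain es2 \<alpha>2 \<beta>2 where st2: "state (Suc (Suc s)) ((ks @ [False]) @ [False]) es2 \<alpha>2 \<beta>2"
    and par2: "\<And>c A J. even (cnt \<alpha>2 \<beta>2 es2 (c, A, J)) \<longleftrightarrow> even (cnt \<alpha>1 \<beta>1 es1 (c, A, J) +
       (if A = \<alpha> (eK e') \<and> J = \<beta> (eI e') then card {m. m < \<nu> \<and> col m = c} else 0))"
    and im2: "\<alpha>2 ` KV ((ks @ [False]) @ [False]) = \<alpha>1 ` KV (ks @ [False])"
      "\<beta>2 ` IV ((ks @ [False]) @ [False]) = \<beta>1 ` IV (ks @ [False])"
    by (rule state_add_R[OF st1 e2(1)[OF assms(1)], unfolded e2(2,3)]) (rule that, assumption+)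
  have "even (cnt \<alpha>2 \<beta>2 es2 t)" for t
    by (cases t) (simp only: par2 even_add par1, simp add: ev)
  then have "closed_diag (Suc (Suc s)) D n q"
    by (rule closedI[OF st2, rotated]) (simp_all only: nD_snoc if_False add_0_right D im1 im2 n q)
  then show ?thesis by simp
qed

text \<open>Asymmetric diagrams under construction: at each K-label in \<open>P\<close> one edge of every colour is unpaired,
  the one of colour \<open>c\<close> ending at \<open>B c\<close>.\<close>

definition star :: "(nat \<Rightarrow> vert) \<Rightarrow> nat \<Rightarrow> nat \<Rightarrow> nat \<Rightarrow> nat \<Rightarrow> vert set \<Rightarrow> bool" where
  "star B s D n q P \<longleftrightarrow> (\<exists>ks es \<alpha> \<beta>. state s ks es \<alpha> \<beta> \<and> nD ks = D \<and>
     (\<forall>c A J. odd (cnt \<alpha> \<beta> es (c, A, J)) \<longleftrightarrow> c < \<nu> \<and> J = B c \<and> A \<in> P) \<and>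
     n \<le> card (\<alpha> ` KV ks) \<and> q \<le> card (\<beta> ` IV ks))"

lemma mcnt_asym: "\<not> sy \<Longrightarrow> mcnt b J c = (if c < \<nu> \<and> b c = J then 1 else 0)"
proof -
  assume a: "\<not> sy"
  have "{m. m < \<nu> \<and> col m = c \<and> b m = J} = (if c < \<nu> \<and> b c = J then {c} else {})"
    unfolding col_asym[OF a] by auto
  then show ?thesis by (simp add: mcnt_def)
qed

lemma odd_edge:
  assumes "odd (cnt \<alpha> \<beta> es t)" obtains e where "e \<in> set es" "lab \<alpha> \<beta> e = t"
proof -
  have "cnt \<alpha> \<beta> es t \<noteq> 0" using assms by (intro notI) simp
  then show ?thesis using that unfolding cnt_pos by blast
qed

text \<open>An f^2 with rank labels \<open>a\<close> and a fresh one, and with coordinates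
  \<open>B\<close>, pairs off the odd edges at \<open>a\<close> and reproduces them at the fresh
  label: a rank class is gained without any new coordinate.\<close>

lemma star_step:
  assumes ns: "\<not> sy" and "star B s D n q (insert a P)" "a \<notin> P"
  shows "\<exists>a'. star B (Suc s) (Suc D) (Suc n) q (insert a' P) \<and> a' \<notin> P"
proof -
  obtain ks es \<alpha> \<beta> where st: "state s ks es \<alpha> \<beta>" and D: "nD ks = D"
    and par0: "\<And>c A J. odd (cnt \<alpha> \<beta> es (c, A, J)) \<longleftrightarrow> c < \<nu> \<and> J = B c \<and> A \<in> insert a P"
    and n: "n \<le> card (\<alpha> ` KV ks)" and q: "q \<le> card (\<beta> ` IV ks)"
    using assms(2) unfolding star_def by blast
  let ?j = "length ks"
  \<comment> \<open>An odd count is witnessed by an open edge, whose labels predate the new factor.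
    This bounds \<open>B\<close> and, in the same way, the labels in \<open>P\<close>, so that
    \<open>(?j, 1)\<close> is not among the latter.\<close>
  have B: "fst (B c) < ?j" if c: "c < \<nu>" for c
  proof -
    have "odd (cnt \<alpha> \<beta> es (c, a, B c))" using par0 c by simp
    then obtain e where "e \<in> set es" "lab \<alpha> \<beta> e = (c, a, B c)" by (rule odd_edge)
    then show ?thesis using state_label(4)[OF st] by (force simp: lab_def)
  qed
  have P: "fst A < ?j" if A: "A \<in> insert a P" for A
  proof -
    have "odd (cnt \<alpha> \<beta> es (0, A, B 0))" using par0 A nu_ge2 by simp
    then obtain e where "e \<in> set es" "lab \<alpha> \<beta> e = (0, A, B 0)" by (rule odd_edge)
    then show ?thesis using state_label(3)[OF st] by (force simp: lab_def)
  qed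
  have "odd (cnt \<alpha> \<beta> es (0, a, B 0))" using par0 nu_ge2 by simp
  then obtain e' where e': "e' \<in> set es" "lab \<alpha> \<beta> e' = (0, a, B 0)" by (rule odd_edge)
  let ?f = "\<lambda>t::nat. if t = 0 then a else (?j, 1)"
  let ?a = "upd ?j ?f \<alpha>" and ?b = "upd ?j B \<beta>"
  have e: "Edge (col 0) (?j, 0) (?j, 0) \<in> set (fE ?j True)" using nu_ge2 by (auto simp: fE_def)
  have fb: "fst (?f t) \<le> ?j" for t using P[of a] by auto
  obtain es' where es': "state (Suc s) (ks @ [True]) es' ?a ?b"
    and par: "\<And>t. even (cnt ?a ?b es' t) \<longleftrightarrow> even (cnt \<alpha> \<beta> es t + cnt ?a ?b (fE ?j True) t)"
    by (rule state_ext[OF st e e'(1), of ?f B])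
       (use e'(2) B in \<open>simp_all add: lab_def upd_def col_asym[OF ns] fb[simplified] less_imp_le\<close>)
  have new: "(?j, 1) \<notin> insert a P" using P by force
  then have "odd (cnt ?a ?b es' (c, A, J)) \<longleftrightarrow> c < \<nu> \<and> J = B c \<and> A \<in> insert (?j, 1) P" for c A J
    using par[of "(c, A, J)"] par0[of c A J] assms(3)
    by (auto simp: cnt_fE_True mcnt_asym[OF ns] upd_def split: if_splits)
  moreover have "Suc (card (\<alpha> ` KV ks)) \<le> card (?a ` KV (ks @ [True]))"
  proof -
    have "(?j, 1) \<notin> \<alpha> ` KV ks" by (rule state_fresh(1)[OF st])
    then have "Suc (card (\<alpha> ` KV ks)) = card (insert (?j, 1) (\<alpha> ` KV ks))" by simp
    also have "\<dots> \<le> card (?a ` KV (ks @ [True]))" unfolding upd_KV by (intro card_mono) (auto intro: image_eqI[of _ _ 1])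
    finally show ?thesis .
  qed
  moreover have "card (\<beta> ` IV ks) \<le> card (?b ` IV (ks @ [True]))"
    unfolding upd_IV by (intro card_mono) auto
  ultimately have "star B (Suc s) (Suc D) (Suc n) q (insert (?j, 1) P)"
    unfolding star_def using es' n q D
    by (intro exI[of _ "ks @ [True]"] exI[of _ es'] exI[of _ ?a] exI[of _ ?b]) (simp add: nD_snoc)
  then show ?thesis using new by blast
qed

lemma star_steps:
  assumes "\<not> sy" "star B s D n q (insert a P)" "a \<notin> P"
  shows "\<exists>a'. star B (s + r) (D + r) (n + r) q (insert a' P) \<and> a' \<notin> P"
proof (induction r)
  case (Suc r)
  then obtain a' where "star B (s + r) (D + r) (n + r) q (insert a' P)" "a' \<notin> P" by blast
  from star_step[OF assms(1) this] show ?case unfolding add_Suc_right .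
next
  case 0
  show ?case using assms(2,3) unfolding add_0_right by blast
qed

lemma state_single:
  assumes "\<And>x. x \<in> vK 0 k \<Longrightarrow> fst (\<alpha> x) = 0" "\<And>x. x \<in> vI 0 k \<Longrightarrow> fst (\<beta> x) = 0"
  shows "state 0 [k] (fE 0 k) \<alpha> \<beta>"
  using assms by (cases k) (auto simp: state_def KV_def IV_def lessThan_Suc)

lemma KV_single: "KV [k] = vK 0 k" and IV_single: "IV [k] = vI 0 k"
  by (auto simp: KV_def IV_def)

text \<open>The corner \<open>n = s\<^sub>D + 1\<close> of the front, with
  \<open>s\<^sub>R = 2\<close>: the whole path runs through a single coordinate.\<close>

lemma path_closed:
  assumes ns: "\<not> sy" shows "closed_diag (Suc r) r (Suc r) 1"
proof -
  let ?b = "\<lambda>_::nat. (0, 0) :: vert"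
  have "{m. m < \<nu> \<and> col m = c} = (if c < \<nu> then {c} else {})" for c
    unfolding col_asym[OF ns] by auto
  then have cc: "card {m. m < \<nu> \<and> col m = c} = (if c < \<nu> then 1 else 0)" for c by simp
  have "state 0 [False] (fE 0 False) (\<lambda>_. (0, 0)) (\<lambda>_. (0, 0))" by (rule state_single) auto
  then have "star ?b 0 0 1 1 (insert (0, 0) {})"
    unfolding star_def
    by (intro exI[of _ "[False]"] exI[of _ "fE 0 False"] exI[of _ "\<lambda>_. (0, 0)"])
       (auto simp: nD_def cnt_fE_False cc KV_single IV_single vK_False vI_False)
  from star_steps[OF ns this, of r] obtain a where "star ?b r r (Suc r) 1 {a}" by auto
  then obtain ks es \<alpha> \<beta> where st: "state r ks es \<alpha> \<beta>" and D: "nD ks = r"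
    and par0: "\<And>c A J. odd (cnt \<alpha> \<beta> es (c, A, J)) \<longleftrightarrow> c < \<nu> \<and> J = (0, 0) \<and> A \<in> {a}"
    and n: "Suc r \<le> card (\<alpha> ` KV ks)" and q: "1 \<le> card (\<beta> ` IV ks)"
    unfolding star_def by blast
  have "odd (cnt \<alpha> \<beta> es (0, a, (0, 0)))" using par0 nu_ge2 by simp
  then obtain e' where e': "e' \<in> set es" "lab \<alpha> \<beta> e' = (0, a, (0, 0))" by (rule odd_edge)
  obtain es' \<alpha>' \<beta>' where es': "state (Suc r) (ks @ [False]) es' \<alpha>' \<beta>'"
    and par: "\<And>c A J. even (cnt \<alpha>' \<beta>' es' (c, A, J)) \<longleftrightarrow> even (cnt \<alpha> \<beta> es (c, A, J) +
       (if A = \<alpha> (eK e') \<and> J = \<beta> (eI e') then card {m. m < \<nu> \<and> col m = c} else 0))"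
    and im: "\<alpha>' ` KV (ks @ [False]) = \<alpha> ` KV ks" "\<beta>' ` IV (ks @ [False]) = \<beta> ` IV ks"
    by (rule state_add_R[OF st e'(1)]) (rule that, assumption+)
  have "even (cnt \<alpha>' \<beta>' es' (c, A, J))" for c A J
    using par[of c A J] par0[of c A J] e'(2) by (auto simp: cc lab_def split: if_splits)
  then have "even (cnt \<alpha>' \<beta>' es' t)" for t by (cases t) simp
  then show ?thesis
    unfolding closed_diag_def using es' n q D im
    by (intro exI[of _ "ks @ [False]"] exI[of _ es'] exI[of _ \<alpha>'] exI[of _ \<beta>']) (simp add: nD_snoc)
qed

text \<open>The corner \<open>n = s\<^sub>D\<close> of the front without fF factors: all factors of
  the ring share the same \<nu> coordinates.\<close>

lemma ring_closed:
  assumes ns: "\<not> sy" shows "closed_diag r (Suc r) (Suc r) \<nu>"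
proof -
  have "state 0 [True] (fE 0 True) (\<lambda>x. x) (\<lambda>x. x)"
    by (rule state_single) (auto simp: vK_def vI_def)
  then have "star (Pair 0) 0 1 2 \<nu> (insert (0, 1) {(0, 0)})"
    unfolding star_def
    by (intro exI[of _ "[True]"] exI[of _ "fE 0 True"] exI[of _ "\<lambda>x. x"])
       (auto simp: nD_def cnt_fE_True mcnt_asym[OF ns] KV_single IV_single vK_True vI_True card_cartesian_product)
  from star_steps[OF ns this, of r] obtain a where "star (Pair 0) r (Suc r) (Suc (Suc r)) \<nu> {a, (0, 0)}" and a: "a \<noteq> (0, 0)"
    by auto
  then obtain ks es \<alpha> \<beta> where st: "state r ks es \<alpha> \<beta>" and D: "nD ks = Suc r"
    and par: "\<And>c A J. odd (cnt \<alpha> \<beta> es (c, A, J)) \<longleftrightarrow> c < \<nu> \<and> J = (0, c) \<and> A \<in> {a, (0, 0)}"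
    and n: "Suc (Suc r) \<le> card (\<alpha> ` KV ks)" and q: "\<nu> \<le> card (\<beta> ` IV ks)"
    unfolding star_def by blast
  \<comment> \<open>Identifying the two ends makes their odd edges pair up and costs one of the
    \<open>r + 2\<close> rank labels.\<close>
  define \<alpha>' where "\<alpha>' x = (if \<alpha> x = a then (0, 0) else \<alpha> x)" for x
  have cn: "cnt \<alpha>' \<beta> es (c, A, J) = (if A = a then 0 else
      cnt \<alpha> \<beta> es (c, A, J) + (if A = (0, 0) then cnt \<alpha> \<beta> es (c, a, J) else 0))" for es c A J
    using a by (induction es) (auto simp: cnt_Cons lab_def \<alpha>'_def)
  have "even (cnt \<alpha>' \<beta> es (c, A, J))" for c A J
    using par[of c A J] par[of c a J] by (auto simp: cn)
  then have "even (cnt \<alpha>' \<beta> es t)" for t by (cases t) simp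
  moreover obtain C where "(ks, C, es) \<in> set (gens r)" "compat \<alpha> \<beta> C" using st by (auto simp: state_def)
  then have "state r ks es \<alpha>' \<beta>"
    using st unfolding state_def by (auto simp: \<alpha>'_def compat_def lab_def intro!: exI[of _ C])
  moreover have "\<alpha> ` KV ks - {a} \<subseteq> \<alpha>' ` KV ks" by (auto simp: \<alpha>'_def image_iff)
  then have "card (\<alpha> ` KV ks - {a}) \<le> card (\<alpha>' ` KV ks)" by (intro card_mono) auto
  then have "Suc r \<le> card (\<alpha>' ` KV ks)" using n card_Diff1_le[of "\<alpha> ` KV ks" a] card_Diff_singleton_if[of "\<alpha> ` KV ks" a]
    by (auto split: if_splits)
  ultimately show ?thesis unfolding closed_diag_def using D q by blast
qed

lemma closed_add_Ds:
  assumes "closed_diag s D n q"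
  shows "closed_diag (s + k) (D + k) n (q + (\<nu> - 1) * k)"
proof (induction k)
  case (Suc k)
  have "q + (\<nu> - 1) * Suc k = q + (\<nu> - 1) * k + (\<nu> - 1)" by (simp only: mult_Suc_right add_ac)
  with closed_add_D[OF Suc.IH] show ?case unfolding add_Suc_right by metis
qed (simp add: assms)

lemma closed_add_Ds_sym:
  assumes sy "closed_diag s D n q"
  shows "closed_diag (s + k) (D + k) (n + k) (q + (\<nu> div 2 - 1) * k)"
proof (induction k)
  case 0
  show ?case using assms(2) unfolding add_0_right mult_0_right .
next
  case (Suc k)
  have "q + (\<nu> div 2 - 1) * Suc k = q + (\<nu> div 2 - 1) * k + (\<nu> div 2 - 1)" by (simp only: mult_Suc_right add_ac)
  with closed_add_D_sym[OF assms(1) Suc.IH] show ?case unfolding add_Suc_right by metis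
qed

lemma closed_add_Rs_sym:
  assumes sy "closed_diag s D n q"
  shows "closed_diag (s + k) D n q"
proof (induction k)
  case 0
  show ?case using assms(2) unfolding add_0_right .
next
  case (Suc k)
  show ?case using closed_add_R_sym[OF assms(1) Suc.IH] unfolding add_Suc_right .
qed

lemma closed_add_RRs:
  assumes "\<not> sy" "closed_diag s D n q"
  shows "closed_diag (s + 2 * k) D n q"
proof (induction k)
  case 0
  show ?case using assms(2) unfolding mult_0_right add_0_right .
next
  case (Suc k)
  have "s + 2 * Suc k = s + 2 * k + 2" by simp
  with closed_add_RR[OF assms(1) Suc.IH] show ?case by metis
qed

text \<open>The ring or path is chosen with exactly \<open>n\<close> rank labels; the other f^2
  factors then only raise the number of coordinates, and surplus fF factors enter in pairs.\<close>

lemma asym_attained: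
  assumes ns: "\<not> sy" and D: "D \<le> s + 1" and n: "1 \<le> n" "n \<le> D + 1" and ev: "even (s + 1 - D)" and ne: "(n, D) \<noteq> (s + 2, s + 1)"
  shows "closed_diag s D n (1 + (\<nu> - 1) * (D + 1 - n))"
proof (cases "D = s + 1")
  case True
  then have nD: "n \<le> D" using n ne by auto
  obtain r where r: "n = Suc r" using n by (cases n) auto
  have "closed_diag (r + (D - n)) (Suc r + (D - n)) (Suc r) (\<nu> + (\<nu> - 1) * (D - n))"
    by (rule closed_add_Ds[OF ring_closed[OF ns]])
  moreover have "\<nu> + (\<nu> - 1) * (D - n) = 1 + (\<nu> - 1) * (D + 1 - n)"
    using nD nu_ge2 by (simp add: Suc_diff_le)
  ultimately show ?thesis using nD True r by simp
next
  case False
  obtain r where r: "n = Suc r" using n by (cases n) auto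
  obtain k where k: "s + 1 - D = 2 * k" using ev by (elim evenE)
  \<comment> \<open>\<open>D \<noteq> s + 1\<close> makes \<open>k\<close> positive, and the path
    already contains one of the \<open>k\<close> pairs of fF factors.\<close>
  then have s: "s = Suc r + (D - r) + 2 * (k - 1)" using False D n r by (cases k) auto
  have "closed_diag (Suc r + (D - r) + 2 * (k - 1)) (r + (D - r)) (Suc r) (1 + (\<nu> - 1) * (D - r))"
    by (intro closed_add_RRs[OF ns] closed_add_Ds path_closed[OF ns])
  moreover have "r + (D - r) = D" using n r by simp
  ultimately show ?thesis using s r by simp
qed

text \<open>Of the f^2 factors, \<open>n - 1\<close> contribute a rank class and the rest are
  inserted for coordinates only. The starting factor is fF when one is available; otherwise it is an
  f^2 with one or two rank classes according to whether \<open>n = 1\<close>.\<close>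

lemma sym_attained:
  assumes sy and D: "D \<le> s + 1" and n: "1 \<le> n" "n \<le> D + 1"
  shows "closed_diag s D n (1 + (\<nu> - 1) * D - (\<nu> div 2) * (n - 1))"
proof -
  obtain h where h: "\<nu> = 2 * h" using sy_even[OF assms(1)] by (elim evenE)
  then obtain g where g: "h = Suc g" using nu_ge2 by (cases h) auto
  obtain r where r: "n = Suc r" using n by (cases n) auto
  obtain d where d: "D = r + d" using n r by (metis add_Suc_right le_Suc_ex plus_1_eq_Suc Suc_le_mono add.commute)
  have val: "1 + (\<nu> - 1) * D - (\<nu> div 2) * (n - 1) = 1 + g * r + (2 * g + 1) * d"
    by (simp add: h g r d algebra_simps)
  have nu1: "\<nu> - 1 = 2 * g + 1" "\<nu> div 2 - 1 = g" "\<nu> div 2 = Suc g" by (simp_all add: h g)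
  have single: "closed_diag 0 0 1 1"
  proof -
    have "{m. m < \<nu> \<and> col m = c} = (if c = 0 then {..<\<nu>} else {})" for c
      unfolding col_sym[OF assms(1)] by auto
    then have "even (card {m. m < \<nu> \<and> col m = c})" for c by (simp add: h)
    moreover have "state 0 [False] (fE 0 False) (\<lambda>_. (0, 0)) (\<lambda>_. (0, 0))" by (rule state_single) auto
    ultimately show ?thesis
      unfolding closed_diag_def
      by (intro exI[of _ "[False]"] exI[of _ "fE 0 False"] exI[of _ "\<lambda>_. (0, 0)"])
         (auto simp: nD_def cnt_fE_False KV_single IV_single vK_False vI_False)
  qed
  have double1: "closed_diag 0 1 1 \<nu>"
  proof -
    have "state 0 [True] (fE 0 True) (\<lambda>_. (0, 0)) (\<lambda>x. x)" by (rule state_single) (auto simp: vI_def)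
    then show ?thesis
      unfolding closed_diag_def
      by (intro exI[of _ "[True]"] exI[of _ "fE 0 True"] exI[of _ "\<lambda>_. (0, 0)"] exI[of _ "\<lambda>x. x"])
         (auto simp: nD_def cnt_fE_True KV_single IV_single vK_True vI_True card_cartesian_product)
  qed
  have double2: "closed_diag 0 1 2 (\<nu> div 2)"
  proof -
    let ?b = "\<lambda>x :: vert. (0 :: nat, snd x div 2)"
    have "state 0 [True] (fE 0 True) (\<lambda>x. x) ?b" by (rule state_single) (auto simp: vK_def)
    moreover have "even (cnt (\<lambda>x. x) ?b (fE 0 True) t)" for t
      using mcnt_div2[OF assms(1), of "Pair (0::nat)"] by (cases t) (simp add: cnt_fE_True)
    moreover have "Pair 0 ` {..<h} \<subseteq> ?b ` IV [True]"
    proof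
      fix z assume "z \<in> Pair (0 :: nat) ` {..<h}"
      then obtain i where "z = (0, i)" "i < h" by auto
      then have "z = ?b (0, 2 * i)" "(0, 2 * i) \<in> {0} \<times> {..<\<nu>}" using h by auto
      then show "z \<in> ?b ` IV [True]" unfolding IV_single vI_True by blast
    qed
    then have "card (Pair (0 :: nat) ` {..<h}) \<le> card (?b ` IV [True])" by (intro card_mono) auto
    then have "\<nu> div 2 \<le> card (?b ` IV [True])" by (simp add: card_image inj_on_def h)
    moreover have "2 \<le> card ((\<lambda>x. x) ` KV [True])" by (simp add: KV_single vK_True)
    ultimately show ?thesis
      unfolding closed_diag_def
      by (intro exI[of _ "[True]"] exI[of _ "fE 0 True"] exI[of _ "\<lambda>x. x"] exI[of _ ?b]) (simp add: nD_def)
  qed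
  show ?thesis
  proof (cases "D = s + 1")
    case False
    then have s: "s = 0 + r + d + (s - D)" using D d by simp
    have "closed_diag (0 + r + d + (s - D)) (0 + r + d) (1 + r) (1 + (\<nu> div 2 - 1) * r + (\<nu> - 1) * d)"
      by (intro closed_add_Rs_sym[OF assms(1)] closed_add_Ds closed_add_Ds_sym[OF assms(1)] single)
    from this[unfolded nu1] show ?thesis unfolding val using s d r by simp
  next
    case True
    show ?thesis
    proof (cases r)
      case 0
      then obtain d' where d': "d = Suc d'" using True d by (cases d) auto
      have "closed_diag (0 + d') (1 + d') 1 (\<nu> + (\<nu> - 1) * d')" by (intro closed_add_Ds double1)
      from this[unfolded nu1] show ?thesis unfolding val using 0 d' d True r by (simp add: h g)
    next
      case (Suc r')
      have "closed_diag (0 + r' + d) (1 + r' + d) (2 + r') (\<nu> div 2 + (\<nu> div 2 - 1) * r' + (\<nu> - 1) * d)"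
        by (intro closed_add_Ds closed_add_Ds_sym[OF assms(1)] double2)
      from this[unfolded nu1] show ?thesis unfolding val using Suc d True r by simp
    qed
  qed
qed

end

section \<open>Uniqueness of the coefficients\<close>

lemma power_sum_zero:
  fixes a :: "nat \<Rightarrow> real"
  assumes "infinite X" "\<And>x. x \<in> X \<Longrightarrow> (\<Sum>i\<le>M. a i * x ^ i) = 0" "i \<le> M"
  shows "a i = 0"
proof -
  let ?P = "\<Sum>i\<le>M. monom (a i) i"
  have "poly ?P x = (\<Sum>i\<le>M. a i * x ^ i)" for x by (simp add: poly_sum poly_monom)
  then have "X \<subseteq> {x. poly ?P x = 0}" using assms(2) by auto
  then have "?P = 0" using assms(1) poly_roots_finite finite_subset by blast
  moreover have "coeff ?P i = a i"
    using assms(3) by (simp add: coeff_sum if_distrib cong: if_cong)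
  ultimately show ?thesis by simp
qed

lemma infinite_pos_nats: "infinite (real ` {1..})"
  using finite_imageD[of real "{1..}"] infinite_Ici[of "1::nat"] by (auto simp: inj_on_def)

text \<open>The difference of two representations is a polynomial in p whose coefficients are
  polynomials in H and \<sigma>^2; its coefficients vanish one variable at a time, each variable
  ranging over an infinite set.\<close>

lemma poly_rep_unique:
  assumes "poly_rep Yf c" "poly_rep Yf c'"
  shows "c = c'"
proof -
  let ?S = "{x. c x \<noteq> 0} \<union> {x. c' x \<noteq> 0}"
  have fin: "finite ?S" using assms by (simp add: poly_rep_def)
  obtain M where M: "\<And>q n l. (q, n, l) \<in> ?S \<Longrightarrow> q \<le> M \<and> n \<le> M \<and> l \<le> M"
  proof -
    let ?f = "\<lambda>(q, n, l). q + n + l :: nat"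
    have "?f x \<le> Max (?f ` ?S)" if "x \<in> ?S" for x using fin that by (intro Max_ge) auto
    then show ?thesis using that[of "Max (?f ` ?S)"] by fastforce
  qed
  let ?B = "{..M} \<times> {..M} \<times> {..M}"
  let ?d = "\<lambda>q n l. c (q, n, l) - c' (q, n, l)"
  have SB: "?S \<subseteq> ?B"
  proof
    fix x assume "x \<in> ?S"
    then show "x \<in> ?B" using M by (cases x) auto
  qed
  have box: "(\<Sum>(q, n, l)\<in>{x. f x \<noteq> 0}. f (q, n, l) * P ^ q * K ^ n * \<sigma> ^ (2 * l)) =
      (\<Sum>(q, n, l)\<in>?B. f (q, n, l) * P ^ q * K ^ n * \<sigma> ^ (2 * l))"
    if "{x. f x \<noteq> 0} \<subseteq> ?S" for f :: "nat \<times> nat \<times> nat \<Rightarrow> real" and P K \<sigma> :: real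
    by (rule sum.mono_neutral_left, simp, rule subset_trans[OF that SB], auto)
  have z: "(\<Sum>q\<le>M. (\<Sum>n\<le>M. (\<Sum>l\<le>M. ?d q n l * (\<sigma>\<^sup>2) ^ l) * real H ^ n) * real p ^ q) = 0"
    if "1 \<le> H" "1 \<le> p" "0 < \<sigma>" for H p \<sigma>
  proof -
    have "(\<Sum>(q, n, l)\<in>?B. c (q, n, l) * real p ^ q * real H ^ n * \<sigma> ^ (2 * l)) = Yf H p \<sigma> 1"
      using assms(1) that unfolding poly_rep_def by (subst box[symmetric]) auto
    moreover have "(\<Sum>(q, n, l)\<in>?B. c' (q, n, l) * real p ^ q * real H ^ n * \<sigma> ^ (2 * l)) = Yf H p \<sigma> 1"
      using assms(2) that unfolding poly_rep_def by (subst box[symmetric]) auto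
    ultimately have "(\<Sum>(q, n, l)\<in>?B. ?d q n l * real p ^ q * real H ^ n * \<sigma> ^ (2 * l)) = 0"
      by (simp add: case_prod_unfold sum_subtractf algebra_simps)
    then show ?thesis
      unfolding power_mult by (simp add: sum.cartesian_product' sum_distrib_right sum_distrib_left mult_ac)
  qed
  have "?d q n l = 0" if "q \<le> M" "n \<le> M" "l \<le> M" for q n l
  proof -
    have 1: "(\<Sum>n\<le>M. (\<Sum>l\<le>M. ?d q n l * (\<sigma>\<^sup>2) ^ l) * real H ^ n) = 0" if "1 \<le> H" "0 < \<sigma>" for H \<sigma>
      by (rule power_sum_zero[OF infinite_pos_nats _ \<open>q \<le> M\<close>]) (use z that in auto)
    have 2: "(\<Sum>l\<le>M. ?d q n l * (\<sigma>\<^sup>2) ^ l) = 0" if "0 < \<sigma>" for \<sigma>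
      by (rule power_sum_zero[OF infinite_pos_nats _ \<open>n \<le> M\<close>]) (use 1 that in auto)
    have 3: "(\<Sum>l\<le>M. ?d q n l * x ^ l) = 0" if "0 < x" for x :: real
      using 2[of "sqrt x"] that by simp
    show ?thesis
      by (rule power_sum_zero[OF _ _ \<open>l \<le> M\<close>, of "{0<..}"]) (use 3 infinite_Ioi in auto)
  qed
  then have "c (q, n, l) = c' (q, n, l)" for q n l
    using M[of q n l] by (cases "(q, n, l) \<in> ?S") auto
  then show ?thesis by (auto simp: fun_eq_iff)
qed

section \<open>The Pareto front from matching bounds\<close>

text \<open>Injectivity of \<open>lev\<close> separates the powers of \<sigma>. A monomial
  \<open>(q', n')\<close> that dominates \<open>(Q n D, n)\<close> coincides with it, because
  \<open>n' > n\<close> would give \<open>q' \<le> Q n' D < Q n D\<close>. The bound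
  \<open>nmax\<close> is a parameter because the asymmetric front is one point shorter at the top
  level.\<close>

lemma pareto_terms_eq:
  assumes U: "\<And>q n l. c (q, n, l) \<noteq> 0 \<Longrightarrow> \<exists>D. ok D \<and> 2 * l = lev D \<and> 1 \<le> n \<and> n \<le> nmax D \<and> q \<le> Q n D"
    and L: "\<And>D n. ok D \<Longrightarrow> 1 \<le> n \<Longrightarrow> n \<le> nmax D \<Longrightarrow>
      \<exists>q' n' l. 2 * l = lev D \<and> Q n D \<le> q' \<and> n \<le> n' \<and> c (q', n', l) \<noteq> 0"
    and lev: "\<And>D D'. lev D = lev D' \<Longrightarrow> D = D'"
    and dec: "\<And>D n n'. ok D \<Longrightarrow> 1 \<le> n \<Longrightarrow> n < n' \<Longrightarrow> n' \<le> nmax D \<Longrightarrow> Q n' D < Q n D"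
  shows "pareto_terms c = {(Q n D, n, l) | n D l. ok D \<and> 1 \<le> n \<and> n \<le> nmax D \<and> 2 * l = lev D}"
proof -
  have bound: "q \<le> Q n D \<and> 1 \<le> n \<and> n \<le> nmax D" if "c (q, n, l) \<noteq> 0" "2 * l = lev D" for q n l D
    using U[OF that(1)] lev that(2) by metis
  have nz: "c (Q n D, n, l) \<noteq> 0" if *: "ok D" "1 \<le> n" "n \<le> nmax D" "2 * l = lev D" for n D l
  proof -
    obtain q' n' l' where c: "2 * l' = lev D" "Q n D \<le> q'" "n \<le> n'" "c (q', n', l') \<noteq> 0"
      using L[OF *(1-3)] by blast
    have "l' = l" using c(1) *(4) by simp
    have b: "q' \<le> Q n' D" "n' \<le> nmax D" using bound[OF c(4,1)] by auto
    have "n' = n"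
    proof (rule ccontr)
      assume "n' \<noteq> n"
      then have "Q n' D < Q n D" using dec[OF *(1,2)] c(3) b(2) by simp
      then show False using b(1) c(2) by simp
    qed
    then show ?thesis using c b \<open>l' = l\<close> by (metis le_antisym)
  qed
  show ?thesis
  proof (intro set_eqI iffI)
    fix x assume x: "x \<in> pareto_terms c"
    obtain q n l where xe: "x = (q, n, l)" by (cases x)
    have c: "c (q, n, l) \<noteq> 0" and p: "\<And>q' n'. c (q', n', l) \<noteq> 0 \<Longrightarrow> q \<le> q' \<Longrightarrow> n \<le> n' \<Longrightarrow> (q', n') = (q, n)"
      using x unfolding xe pareto_terms_def by blast+
    obtain D where D: "ok D" "2 * l = lev D" "1 \<le> n" "n \<le> nmax D" "q \<le> Q n D" using U[OF c] by blast
    have "(Q n D, n) = (q, n)" by (rule p) (use nz[of D n l] D in auto)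
    then show "x \<in> {(Q n D, n, l) | n D l. ok D \<and> 1 \<le> n \<and> n \<le> nmax D \<and> 2 * l = lev D}"
      unfolding xe using D by blast
  next
    fix x assume "x \<in> {(Q n D, n, l) | n D l. ok D \<and> 1 \<le> n \<and> n \<le> nmax D \<and> 2 * l = lev D}"
    then obtain n D l where x: "x = (Q n D, n, l)" and *: "ok D" "1 \<le> n" "n \<le> nmax D" "2 * l = lev D" by blast
    have "(q', n') = (Q n D, n)" if c: "c (q', n', l) \<noteq> 0" "Q n D \<le> q'" "n \<le> n'" for q' n'
    proof -
      have b: "q' \<le> Q n' D" "n' \<le> nmax D" using bound[OF c(1) *(4)] by auto
      have "n' = n"
      proof (rule ccontr)
        assume "n' \<noteq> n"
        then have "Q n' D < Q n D" using dec[OF *(1,2)] c(3) b(2) by simp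
        then show False using b(1) c(2) by simp
      qed
      then show ?thesis using b c by simp
    qed
    then show "x \<in> pareto_terms c" unfolding x pareto_terms_def using nz[OF *] by blast
  qed
qed

context cp_model begin

section \<open>The coefficients of Y\<close>

definition expo :: "bool list \<times> nat \<times> (edge \<times> edge) list \<Rightarrow> nat \<times> nat \<times> nat" where
  "expo = (\<lambda>(ks, N, C). (nI ks C, nK ks C, N div 2))"

definition ycoef :: "nat \<Rightarrow> nat \<times> nat \<times> nat \<Rightarrow> real" where
  "ycoef s y = (- 1) ^ s * (\<Sum>x\<leftarrow>full s. if expo x = y then coef (fst x) else 0)"

lemma coef_nD: "coef ks = (- 1) ^ length ks * (- 1 / 2) ^ nD ks"
  by (induction ks rule: rev_induct) (auto simp: coef_def nD_def)

lemma full_expo: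
  assumes "x \<in> set (full s)" "expo x = (q, n, l)"
  shows "2 * l = \<nu> * (nD (fst x) + 1) + (\<nu> - 2) * s" "length (fst x) = Suc s"
proof -
  obtain ks N C where x: "x = (ks, N, C)" by (rule prod_cases3)
  note b = full_bounds[OF assms(1)[unfolded x]]
  obtain w where w: "\<nu> = w + 2" using nu_ge2 by (metis add.commute le_Suc_ex)
  have "l = N div 2" using assms(2) by (simp add: x expo_def)
  then have "2 * l = N" using b(4) by simp
  then show "2 * l = \<nu> * (nD (fst x) + 1) + (\<nu> - 2) * s"
    using b(3) by (simp add: x w algebra_simps)
  show "length (fst x) = Suc s" using b(1) by (simp add: x)
qed

lemma lev_inj: "\<nu> * (D + 1) + (\<nu> - 2) * s = \<nu> * (D' + 1) + (\<nu> - 2) * s \<Longrightarrow> D = D'"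
  using nu_ge2 by simp

lemma sum_list_if_const:
  fixes k :: real
  assumes "\<And>x. x \<in> set xs \<Longrightarrow> P x \<Longrightarrow> w x = k"
  shows "(\<Sum>x\<leftarrow>xs. if P x then w x else 0) = k * real (length (filter P xs))"
  using assms by (induction xs) (auto simp: algebra_simps)

text \<open>The sign of a diagram depends only on its number of factors of each kind, which is determined by
  the power of \<open>\<sigma>\<close>; hence no cancellation takes place.\<close>

lemma ycoef_nonzero: "ycoef s y \<noteq> 0 \<longleftrightarrow> y \<in> expo ` set (full s)"
proof
  assume "ycoef s y \<noteq> 0"
  show "y \<in> expo ` set (full s)"
  proof (rule ccontr)
    assume "y \<notin> expo ` set (full s)"
    then have "(\<Sum>x\<leftarrow>full s. if expo x = y then coef (fst x) else 0) = 0 * real (length (filter (\<lambda>x. expo x = y) (full s)))"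
      by (intro sum_list_if_const) auto
    with \<open>ycoef s y \<noteq> 0\<close> show False by (simp add: ycoef_def)
  qed
next
  assume "y \<in> expo ` set (full s)"
  then obtain x where x: "x \<in> set (full s)" "expo x = y" by auto
  obtain q n l where y: "y = (q, n, l)" by (rule prod_cases3)
  have "coef (fst x') = coef (fst x)" if x': "x' \<in> set (full s)" "expo x' = y" for x'
    using full_expo[OF x(1) x(2)[unfolded y]] full_expo[OF x'(1) x'(2)[unfolded y]] lev_inj[of "nD (fst x')" s "nD (fst x)"]
    by (simp add: coef_nD)
  then have "(\<Sum>x\<leftarrow>full s. if expo x = y then coef (fst x) else 0) =
      coef (fst x) * real (length (filter (\<lambda>x. expo x = y) (full s)))"
    by (intro sum_list_if_const) auto
  moreover have "length (filter (\<lambda>x. expo x = y) (full s)) \<noteq> 0"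
    using x by (auto simp: filter_empty_conv)
  ultimately show "ycoef s y \<noteq> 0" by (simp add: ycoef_def coef_nD)
qed

lemma sum_list_group:
  fixes w :: "'x \<Rightarrow> real"
  assumes "finite S" "f ` set xs \<subseteq> S"
  shows "(\<Sum>x\<leftarrow>xs. w x * g (f x)) = (\<Sum>y\<in>S. (\<Sum>x\<leftarrow>xs. if f x = y then w x else 0) * g y)"
  using assms(2)
proof (induction xs)
  case (Cons x xs)
  have "(\<Sum>y\<in>S. (if f x = y then w x else 0) * g y) = (\<Sum>y\<in>S. if f x = y then w x * g y else 0)"
    by (intro sum.cong) auto
  also have "\<dots> = w x * g (f x)" using assms(1) Cons.prems by simp
  finally show ?case using Cons by (simp add: distrib_right sum.distrib)
qed simp

text \<open>Diagrams with equal exponents are collected; a complete pairing exists only for an even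
  number of open edges, so \<sigma> enters through even powers.\<close>

lemma Y_rep: "poly_rep (Y sy \<nu> s) (ycoef s)"
proof -
  have supp: "{y. ycoef s y \<noteq> 0} = expo ` set (full s)" using ycoef_nonzero by auto
  have "Y sy \<nu> s H p \<sigma> T = (\<Sum>(q, n, l)\<in>{y. ycoef s y \<noteq> 0}. ycoef s (q, n, l) * real p ^ q * real H ^ n * \<sigma> ^ (2 * l))"
    if "0 < \<sigma>" "0 < T" for H p \<sigma> T
  proof -
    let ?g = "\<lambda>(q, n, l). real p ^ q * real H ^ n * \<sigma> ^ (2 * l)"
    have "(\<Sum>(ks, N, C)\<leftarrow>full s. coef ks * \<sigma> ^ N * real (card (Asg H p ks C))) =
      (\<Sum>x\<leftarrow>full s. coef (fst x) * ?g (expo x))"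
    proof (intro arg_cong[where f = sum_list] map_cong refl)
      fix x assume x: "x \<in> set (full s)"
      obtain ks N C where xe: "x = (ks, N, C)" by (rule prod_cases3)
      note b = full_bounds[OF x[unfolded xe]]
      show "(case x of (ks, N, C) \<Rightarrow> coef ks * \<sigma> ^ N * real (card (Asg H p ks C))) = coef (fst x) * ?g (expo x)"
        using b(4) by (simp add: xe expo_def b(10))
    qed
    also have "\<dots> = (\<Sum>y\<in>expo ` set (full s). (\<Sum>x\<leftarrow>full s. if expo x = y then coef (fst x) else 0) * ?g y)"
      by (rule sum_list_group) auto
    finally show ?thesis
      unfolding Y_full[OF that] supp by (simp add: sum_distrib_left ycoef_def case_prod_unfold mult_ac)
  qed
  then show ?thesis unfolding poly_rep_def supp by simp
qed

lemma ycoef_bounds: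
  assumes "ycoef s (q, n, l) \<noteq> 0"
  obtains D where "D \<le> s + 1" "2 * l = \<nu> * (D + 1) + (\<nu> - 2) * s" "1 \<le> n" "n \<le> D + 1"
    "q + wgt * (n - 1) \<le> 1 + (\<nu> - 1) * D" "\<not> sy \<Longrightarrow> even (s + 1 - D)" "\<not> sy \<Longrightarrow> D = s + 1 \<Longrightarrow> n \<le> D"
proof -
  obtain x where x: "x \<in> set (full s)" "expo x = (q, n, l)" using assms ycoef_nonzero by fastforce
  obtain ks N C where xe: "x = (ks, N, C)" by (rule prod_cases3)
  note b = full_bounds[OF x(1)[unfolded xe]]
  have e: "q = nI ks C" "n = nK ks C" using x(2) by (auto simp: xe expo_def)
  show ?thesis
    by (rule that[of "nD ks"]) (use b(2,5-9) full_expo(1)[OF x] e xe in simp_all)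
qed

lemma ycoef_attained:
  assumes "closed_diag s D n q"
  shows "\<exists>q' n' l. 2 * l = \<nu> * (D + 1) + (\<nu> - 2) * s \<and> q \<le> q' \<and> n \<le> n' \<and> ycoef s (q', n', l) \<noteq> 0"
proof -
  obtain ks N C where x: "(ks, N, C) \<in> set (full s)" "nD ks = D" "n \<le> nK ks C" "q \<le> nI ks C"
    using closed_diag_full[OF assms] by auto
  have "expo (ks, N, C) = (nI ks C, nK ks C, N div 2)" by (simp add: expo_def)
  moreover from full_expo(1)[OF x(1) this] have "2 * (N div 2) = \<nu> * (D + 1) + (\<nu> - 2) * s" using x(2) by simp
  moreover have "ycoef s (nI ks C, nK ks C, N div 2) \<noteq> 0"
    unfolding ycoef_nonzero using x(1) calculation(1) by force
  ultimately show ?thesis using x(3,4) by blast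
qed

lemma pareto_sym:
  assumes sy
  shows "pareto_terms (ycoef s) = sym_terms \<nu> s"
proof -
  have "pareto_terms (ycoef s) = {(Q_sym \<nu> n D, n, l) | n D l. D \<le> s + 1 \<and> 1 \<le> n \<and> n \<le> D + 1 \<and>
      2 * l = \<nu> * (D + 1) + (\<nu> - 2) * s}"
  proof (rule pareto_terms_eq)
    fix q n l assume "ycoef s (q, n, l) \<noteq> 0"
    then show "\<exists>D. D \<le> s + 1 \<and> 2 * l = \<nu> * (D + 1) + (\<nu> - 2) * s \<and> 1 \<le> n \<and> n \<le> D + 1 \<and> q \<le> Q_sym \<nu> n D"
    proof (rule ycoef_bounds)
      fix D assume "D \<le> s + 1" "2 * l = \<nu> * (D + 1) + (\<nu> - 2) * s" "1 \<le> n" "n \<le> D + 1"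
        and "q + wgt * (n - 1) \<le> 1 + (\<nu> - 1) * D"
      then show ?thesis unfolding wgt_sym[OF assms] by (intro exI[of _ D]) (simp add: Q_sym_def)
    qed
  next
    fix D n assume "D \<le> s + 1" "1 \<le> n" "n \<le> D + 1"
    then show "\<exists>q' n' l. 2 * l = \<nu> * (D + 1) + (\<nu> - 2) * s \<and> Q_sym \<nu> n D \<le> q' \<and> n \<le> n' \<and> ycoef s (q', n', l) \<noteq> 0"
      unfolding Q_sym_def by (intro ycoef_attained sym_attained assms)
  next
    fix D D' assume "\<nu> * (D + 1) + (\<nu> - 2) * s = \<nu> * (D' + 1) + (\<nu> - 2) * s"
    then show "D = D'" by (rule lev_inj)
  next
    fix D n n' :: nat assume n: "1 \<le> n" "n < n'" "n' \<le> D + 1"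
    \<comment> \<open>This shows that the subtraction in \<open>Q_sym\<close> does not truncate,
      without which the decrease in \<open>n\<close> would not be strict.\<close>
    have "(\<nu> div 2) * (n' - 1) \<le> (\<nu> - 1) * D" using n nu_ge2 by (intro mult_le_mono) auto
    moreover have "(\<nu> div 2) * (n - 1) < (\<nu> div 2) * (n' - 1)" using n nu_ge2 by simp
    ultimately show "Q_sym \<nu> n' D < Q_sym \<nu> n D" unfolding Q_sym_def by linarith
  qed
  then show ?thesis by (simp add: sym_terms_def)
qed

lemma pareto_asym:
  assumes "\<not> sy"
  shows "pareto_terms (ycoef s) = asym_terms \<nu> s"
proof -
  \<comment> \<open>At \<open>D = s + 1\<close> there is no fF factor, and the value
    \<open>n = D + 1\<close> drops out: exclusion (b). Exclusion (a) is part of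
    \<open>?ok\<close>.\<close>
  let ?ok = "\<lambda>D. D \<le> s + 1 \<and> even (s + 1 - D)" and ?nmax = "\<lambda>D. if D = s + 1 then D else D + 1"
  have "pareto_terms (ycoef s) = {(Q_asym \<nu> n D, n, l) | n D l. ?ok D \<and> 1 \<le> n \<and> n \<le> ?nmax D \<and>
      2 * l = \<nu> * (D + 1) + (\<nu> - 2) * s}"
  proof (rule pareto_terms_eq)
    fix q n l assume "ycoef s (q, n, l) \<noteq> 0"
    then show "\<exists>D. ?ok D \<and> 2 * l = \<nu> * (D + 1) + (\<nu> - 2) * s \<and> 1 \<le> n \<and> n \<le> ?nmax D \<and> q \<le> Q_asym \<nu> n D"
    proof (rule ycoef_bounds)
      fix D assume D: "D \<le> s + 1" "2 * l = \<nu> * (D + 1) + (\<nu> - 2) * s" "1 \<le> n" "n \<le> D + 1"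
        and q: "q + wgt * (n - 1) \<le> 1 + (\<nu> - 1) * D"
        and "\<not> sy \<Longrightarrow> even (s + 1 - D)" "\<not> sy \<Longrightarrow> D = s + 1 \<Longrightarrow> n \<le> D"
      moreover obtain d where d: "D + 1 = n + d" using D(4) le_Suc_ex by blast
      obtain r where r: "n = Suc r" using D(3) by (cases n) auto
      have "D = r + d" using d r by simp
      then have "q \<le> Q_asym \<nu> n D"
        using q unfolding wgt_asym[OF assms] by (simp add: Q_asym_def r distrib_left)
      ultimately show ?thesis using assms by (intro exI[of _ D]) auto
    qed
  next
    fix D n assume "?ok D" "1 \<le> n" "n \<le> ?nmax D"
    then show "\<exists>q' n' l. 2 * l = \<nu> * (D + 1) + (\<nu> - 2) * s \<and> Q_asym \<nu> n D \<le> q' \<and> n \<le> n' \<and> ycoef s (q', n', l) \<noteq> 0"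
      unfolding Q_asym_def by (intro ycoef_attained asym_attained assms) (auto split: if_splits)
  next
    fix D D' assume "\<nu> * (D + 1) + (\<nu> - 2) * s = \<nu> * (D' + 1) + (\<nu> - 2) * s"
    then show "D = D'" by (rule lev_inj)
  next
    fix D n n' :: nat assume n: "1 \<le> n" "n < n'" "n' \<le> ?nmax D"
    then have "D + 1 - n' < D + 1 - n" by (auto split: if_splits)
    then show "Q_asym \<nu> n' D < Q_asym \<nu> n D" using nu_ge2 by (simp add: Q_asym_def)
  qed
  also have "\<dots> = asym_terms \<nu> s"
  proof -
    have key: "?ok D \<and> 1 \<le> n \<and> n \<le> ?nmax D \<longleftrightarrow>
        D \<le> s + 1 \<and> 1 \<le> n \<and> n \<le> D + 1 \<and> even (s + 1 - D) \<and> (n, D) \<noteq> (s + 2, s + 1)" for n D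
      by (auto split: if_splits)
    show ?thesis
    proof (intro set_eqI iffI)
      fix x assume "x \<in> {(Q_asym \<nu> n D, n, l) | n D l. ?ok D \<and> 1 \<le> n \<and> n \<le> ?nmax D \<and> 2 * l = \<nu> * (D + 1) + (\<nu> - 2) * s}"
      then obtain n D l where "x = (Q_asym \<nu> n D, n, l)" "?ok D \<and> 1 \<le> n \<and> n \<le> ?nmax D"
        "2 * l = \<nu> * (D + 1) + (\<nu> - 2) * s" by blast
      then show "x \<in> asym_terms \<nu> s" unfolding key asym_terms_def by blast
    next
      fix x assume "x \<in> asym_terms \<nu> s"
      then obtain n D l where x: "x = (Q_asym \<nu> n D, n, l)" "2 * l = \<nu> * (D + 1) + (\<nu> - 2) * s"
        and "D \<le> s + 1 \<and> 1 \<le> n \<and> n \<le> D + 1 \<and> even (s + 1 - D) \<and> (n, D) \<noteq> (s + 2, s + 1)"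
        unfolding asym_terms_def by blast
      then have "?ok D \<and> 1 \<le> n \<and> n \<le> ?nmax D" unfolding key by blast
      with x show "x \<in> {(Q_asym \<nu> n D, n, l) | n D l. ?ok D \<and> 1 \<le> n \<and> n \<le> ?nmax D \<and> 2 * l = \<nu> * (D + 1) + (\<nu> - 2) * s}"
        by blast
    qed
  qed
  finally show ?thesis .
qed

end

theorem theorem2:
  fixes \<nu> s :: nat
  assumes "2 \<le> \<nu>"
  shows "(\<exists>c. poly_rep (Y False \<nu> s) c)
       \<and> (\<forall>c. poly_rep (Y False \<nu> s) c \<longrightarrow> pareto_terms c = asym_terms \<nu> s)
       \<and> (even \<nu> \<longrightarrow>
            (\<exists>c. poly_rep (Y True \<nu> s) c)
          \<and> (\<forall>c. poly_rep (Y True \<nu> s) c \<longrightarrow> pareto_terms c = sym_terms \<nu> s))"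
proof (intro conjI impI)
  interpret asym: cp_model False \<nu> by unfold_locales (use assms in auto)
  show "\<exists>c. poly_rep (Y False \<nu> s) c" using asym.Y_rep by blast
  show "\<forall>c. poly_rep (Y False \<nu> s) c \<longrightarrow> pareto_terms c = asym_terms \<nu> s"
    using poly_rep_unique[OF asym.Y_rep] asym.pareto_asym by auto
next
  assume "even \<nu>"
  then interpret sym: cp_model True \<nu> by unfold_locales (use assms in auto)
  show "\<exists>c. poly_rep (Y True \<nu> s) c" using sym.Y_rep by blast
  show "\<forall>c. poly_rep (Y True \<nu> s) c \<longrightarrow> pareto_terms c = sym_terms \<nu> s"
    using poly_rep_unique[OF sym.Y_rep] sym.pareto_sym by auto
qed

end
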